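(* Suppose $X$ is an $E_\infty$--ring space. Then $$r\circ(x\circ y)=(r\circ x)\circ y$$ for all $r\in\bigoplus_{k\ge0}H_*(\Sigma_k)$ and $x,y\in H_*(X)$, where $r\circ(-)$ denotes the action arising from the additive $E_\infty$-structure on $X$ and $\circ$ between elements of $H_*(X)$ denotes the product arising from the multiplicative $E_\infty$-structure.
   Context: Fix a prime $p$; $H_*$ denotes homology with $\mathbb{F}_p$-coefficients. Spaces are compactly generated weak Hausdorff. Operads are operads in spaces with $0$-th space a point, indexed functorially on finite sets and bijections ($\mathcal{O}(n)=\mathcal{O}(\{1,\dots,n\})$), with unit $1_{\mathcal{O}}$ and compositions $\gamma:\mathcal{O}(A)\times\prod_{a\in A}\mathcal{O}(B_a)\to\mathcal{O}(\bigsqcup_aB_a)$. An $E_\infty$-operad is an operad $\mathcal{C}$ such that every $\mathcal{C}(n)$ is contractible, has a free $\Sigma_n$-action, and is $\Sigma_n$-equivariantly homotopy equivalent to a $\Sigma_n$-CW complex. An action of an operad $\mathcal{G}$ on an operad $\mathcal{C}$ (in the sense of May) consists of maps $\lambda:\mathcal{G}(A)\times\prod_{a\in A}\mathcal{C}(B_a)\to\mathcal{C}(\prod_{a\in A}B_a)$ for finite sets $A,B_a$, natural in bijections of $A$ and the $B_a$, such that (under the evident bijections of indexing sets) $\lambda(1_{\mathcal{G}};c)=c$; $\lambda(g;(1_{\mathcal{C}})_a)=1_{\mathcal{C}}$; $\lambda(\gamma(g;(g_a)_a);(c_{a,b})_{a\in A,b\in B_a})=\lambda(g;(\lambda(g_a;(c_{a,b})_b))_a)$;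 and $\lambda(g;(\gamma(c_a;(d_{a,b})_{b\in B_a}))_a)=\gamma(\lambda(g;(c_a)_a);(\lambda(g;(d_{a,b_a})_a))_{(b_a)_a\in\prod_aB_a})$. Fix an $E_\infty$-operad pair $(\mathcal{C},\mathcal{G})$, i.e. two $E_\infty$-operads with an action of $\mathcal{G}$ on $\mathcal{C}$. An $E_\infty$--ring space is a space $X$ with a $\mathcal{C}$-algebra structure $\theta$ (additive $E_\infty$-structure) and a $\mathcal{G}$-algebra structure $\xi$ (multiplicative $E_\infty$-structure) such that for all finite sets $A$, $B_a$, $$\xi\bigl(g;(\theta(c_a;(x_{a,b})_{b\in B_a}))_{a\in A}\bigr)=\theta\bigl(\lambda(g;(c_a)_{a});(\xi(g;(x_{a,b_a})_{a\in A}))_{(b_a)_a\in\prod_aB_a}\bigr).$$ The product $\circ$ on $H_*(X)$ is induced by $x\circ y=\xi(g_2;x,y)$ for a fixed $g_2\in\mathcal{G}(2)$. For $r\in H_*(\Sigma_k)$, the action $r\circ x$ is the image of $r\times x\in H_*((\mathcal{C}(k)/\Sigma_k)\times X)$ under the map induced by $([c],x)\mapsto\theta(c;x,\dots,x)$ (with $\mathcal{C}(k)/\Sigma_k$ a model for $B\Sigma_k$), extended linearly to $\bigoplus_kH_*(\Sigma_k)$. *)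

theory Defs
  imports
    "HOL-Analysis.Analysis"
    "HOL-Homology.Homology"
    "HOL-Algebra.Sym_Groups"
    "HOL-Algebra.Group_Action"
    "HOL-Library.FSet"
    "HOL-Computational_Algebra.Primes"
begin

section \<open>Compactly generated weak Hausdorff spaces\<close>

text \<open>
  The weak Hausdorff condition quantifies over maps from arbitrary compact Hausdorff spaces. It is
  enough to test with spaces whose points are sets of sets of points of \<open>X\<close>; the lemma
  \<open>weak_Hausdorff_space_closedin_image\<close> below recovers the condition for test spaces of any type.
\<close>

definition weak_Hausdorff_space :: "'a topology \<Rightarrow> bool" where
  "weak_Hausdorff_space X \<longleftrightarrow>
     (\<forall>(K :: 'a set set topology) u.
        compact_space K \<and> Hausdorff_space K \<and> continuous_map K X u \<longrightarrow> closedin X (u ` topspace K))"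

text \<open>
  The k-ification. For weak Hausdorff \<open>X\<close>, testing on compact Hausdorff subspaces is the same as
  testing along all maps from compact Hausdorff spaces (\<open>continuous_map_kify\<close> below). The library
  predicate \<^const>\<open>k_space\<close> tests on all compact subsets instead; compact subsets of a compactly
  generated weak Hausdorff space need not be Hausdorff, and with those the product below would come
  out too coarse.
\<close>

definition kify :: "'a topology \<Rightarrow> 'a topology" where
  "kify X = topology (\<lambda>U. U \<subseteq> topspace X \<and>
     (\<forall>K. compactin X K \<and> Hausdorff_space (subtopology X K) \<longrightarrow> openin (subtopology X K) (U \<inter> K)))"

definition cgwh_space :: "'a topology \<Rightarrow> bool" where
  "cgwh_space X \<longleftrightarrow> kify X = X \<and> weak_Hausdorff_space X"

abbreviation kprod :: "'a topology \<Rightarrow> 'b topology \<Rightarrow> ('a \<times> 'b) topology" where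
  "kprod X Y \<equiv> kify (prod_topology X Y)"

text \<open>The product \<open>X \<times> \<Prod>\<^sub>a Y\<^sub>a\<close> over a finite set, whose elements are pairs \<open>(x, (y\<^sub>a)\<^sub>a)\<close>.\<close>

abbreviation kprod_family :: "'a topology \<Rightarrow> 'i set \<Rightarrow> ('i \<Rightarrow> 'b topology) \<Rightarrow> ('a \<times> ('i \<Rightarrow> 'b)) topology"
  where "kprod_family X A Y \<equiv> kify (prod_topology X (product_topology Y A))"

lemma openin_kify:
  "openin (kify X) U \<longleftrightarrow> U \<subseteq> topspace X \<and>
     (\<forall>K. compactin X K \<and> Hausdorff_space (subtopology X K) \<longrightarrow> openin (subtopology X K) (U \<inter> K))"
proof -
  define Q where "Q K \<longleftrightarrow> compactin X K \<and> Hausdorff_space (subtopology X K)" for K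
  have "istopology (\<lambda>U. U \<subseteq> topspace X \<and> (\<forall>K. Q K \<longrightarrow> openin (subtopology X K) (U \<inter> K)))"
    unfolding istopology_def
  proof (intro conjI allI impI)
    fix S T K
    assume S: "S \<subseteq> topspace X \<and> (\<forall>K. Q K \<longrightarrow> openin (subtopology X K) (S \<inter> K))"
      and T: "T \<subseteq> topspace X \<and> (\<forall>K. Q K \<longrightarrow> openin (subtopology X K) (T \<inter> K))"
    show "S \<inter> T \<subseteq> topspace X" using S by blast
    assume "Q K"
    then have "openin (subtopology X K) (S \<inter> K)" "openin (subtopology X K) (T \<inter> K)"
      using S T by blast+
    then have "openin (subtopology X K) ((S \<inter> K) \<inter> (T \<inter> K))" by (rule openin_Int)
    then show "openin (subtopology X K) (S \<inter> T \<inter> K)"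
      by (simp add: Int_ac)
  next
    fix \<K> K
    assume \<K>: "\<forall>S\<in>\<K>. S \<subseteq> topspace X \<and> (\<forall>K. Q K \<longrightarrow> openin (subtopology X K) (S \<inter> K))"
    show "\<Union>\<K> \<subseteq> topspace X" using \<K> by blast
    assume "Q K"
    then have "openin (subtopology X K) (\<Union>S\<in>\<K>. S \<inter> K)"
      using \<K> by (intro openin_Union) auto
    then show "openin (subtopology X K) (\<Union>\<K> \<inter> K)" by (simp add: Int_commute)
  qed
  then show ?thesis by (simp add: kify_def Q_def)
qed

lemma topspace_kify [simp]: "topspace (kify X) = topspace X"
proof
  show "topspace (kify X) \<subseteq> topspace X"
    using openin_kify[of X "topspace (kify X)"] by simp
  have "openin (subtopology X K) (topspace X \<inter> K)" for K
    by (metis openin_topspace topspace_subtopology)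
  then have "openin (kify X) (topspace X)"
    by (simp add: openin_kify)
  then show "topspace X \<subseteq> topspace (kify X)" by (rule openin_subset)
qed

lemma weak_Hausdorff_space_closedin_image:
  fixes K :: "'b topology" and X :: "'a topology"
  assumes X: "weak_Hausdorff_space X" and K: "compact_space K" "Hausdorff_space K"
    and u: "continuous_map K X u"
  shows "closedin X (u ` topspace K)"
proof -
  define S where "S = u ` topspace K"
  define k where "k = inv_into (topspace K) u"
  have k: "k s \<in> topspace K" "u (k s) = s" if "s \<in> S" for s
    using that inv_into_into[of s u "topspace K"] f_inv_into_f[of s u "topspace K"]
    unfolding S_def k_def by blast+
  define L where "L = K closure_of (k ` S)"
  define Y where "Y = subtopology K L"
  have LK: "L \<subseteq> topspace K" by (simp add: L_def closure_of_subset_topspace)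
  then have tY: "topspace Y = L" by (auto simp: Y_def)
  have cY: "compact_space Y"
    unfolding Y_def L_def
    by (rule compact_space_subtopology, rule closedin_compact_space[OF K(1)]) simp
  have hY: "Hausdorff_space Y" unfolding Y_def by (simp add: K Hausdorff_space_subtopology)
  define e :: "'b \<Rightarrow> 'a set set" where "e x = {A. A \<subseteq> S \<and> x \<in> K closure_of (k ` A)}" for x
  have inj: "inj_on e L"
  proof (rule inj_onI, rule ccontr)
    fix x y assume xy: "x \<in> L" "y \<in> L" "e x = e y" "x \<noteq> y"
    then obtain U V where UV: "openin K U" "openin K V" "x \<in> U" "y \<in> V" "disjnt U V"
      using K(2) subsetD[OF LK xy(1)] subsetD[OF LK xy(2)] unfolding Hausdorff_space_def by meson
    define A where "A = {s \<in> S. k s \<in> U}"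
    have "x \<in> K closure_of (k ` A)"
      unfolding in_closure_of
    proof (intro conjI allI impI)
      show "x \<in> topspace K" by (rule subsetD[OF LK xy(1)])
      fix T assume "x \<in> T \<and> openin K T"
      then have "x \<in> T \<inter> U \<and> openin K (T \<inter> U)" using UV by (simp add: openin_Int)
      moreover have "x \<in> K closure_of (k ` S)" using xy(1) by (simp only: L_def)
      ultimately obtain z where "z \<in> k ` S" "z \<in> T \<inter> U"
        unfolding in_closure_of[of x] by meson
      then show "\<exists>z. z \<in> k ` A \<and> z \<in> T" by (auto simp: A_def)
    qed
    then have "A \<in> e x" by (simp add: e_def A_def)
    then have "A \<in> e y" by (simp only: xy(3))
    then have "y \<in> K closure_of (k ` A)" by (simp add: e_def)
    then obtain z where "z \<in> k ` A" "z \<in> V"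
      using UV(2,4) unfolding in_closure_of[of y] by meson
    then show False using UV(5) by (auto simp: A_def disjnt_iff)
  qed
  define Z where "Z = pullback_topology (e ` L) (inv_into L e) Y"
  have tZ: "topspace Z = e ` L"
    using inj by (auto simp: Z_def topspace_pullback_topology tY inv_into_f_f)
  have inv: "continuous_map Z Y (inv_into L e)"
    using continuous_map_pullback[of Y Y id "e ` L" "inv_into L e"] by (simp add: Z_def)
  have "continuous_map Y Y (inv_into L e \<circ> e)"
    by (rule continuous_map_eq[of Y Y id]) (simp_all add: inj tY)
  then have e: "continuous_map Y Z e"
    unfolding Z_def by (rule continuous_map_pullback') (auto simp: tY)
  have "compact_space Z"
    using image_compactin[OF _ e, of L] cY by (simp add: compact_space_def tY tZ)
  moreover have "Hausdorff_space Z"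
    using Hausdorff_space_injective_preimage[OF hY inv] by (simp add: tZ inj_on_inv_into)
  moreover have "continuous_map Z X (u \<circ> inv_into L e)"
    by (rule continuous_map_compose[OF inv]) (simp add: Y_def continuous_map_from_subtopology u)
  ultimately have "closedin X ((u \<circ> inv_into L e) ` topspace Z)"
    using X unfolding weak_Hausdorff_space_def by blast
  moreover have "(u \<circ> inv_into L e) ` topspace Z = u ` L"
    using inj unfolding tZ image_comp[symmetric] by (simp add: image_image)
  moreover have "u ` L = S"
  proof
    show "u ` L \<subseteq> S" using LK by (auto simp: S_def)
    have "k ` S \<subseteq> L" unfolding L_def by (rule closure_of_subset) (auto simp: k)
    then have "k s \<in> L" if "s \<in> S" for s using that by blast
    then show "S \<subseteq> u ` L" using k(2) by force
  qed
  ultimately show ?thesis by (simp add: S_def)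
qed

lemma continuous_map_kify:
  fixes K :: "'b topology" and X :: "'a topology"
  assumes X: "weak_Hausdorff_space X" and K: "compact_space K" "Hausdorff_space K"
    and u: "continuous_map K X u"
  shows "continuous_map K (kify X) u"
proof -
  define L where "L = u ` topspace K"
  have cm: "closed_map K X u"
    unfolding closed_map_def
  proof (intro allI impI)
    fix T assume T: "closedin K T"
    have "closedin X (u ` topspace (subtopology K T))"
    proof (rule weak_Hausdorff_space_closedin_image[OF X])
      show "compact_space (subtopology K T)"
        using T K closedin_compact_space compact_space_subtopology by blast
    qed (auto simp: K u Hausdorff_space_subtopology continuous_map_from_subtopology)
    then show "closedin X (u ` T)"
      using T by (simp add: closedin_subset Int_absorb1)
  qed
  have LX: "L \<subseteq> topspace X"
    using u by (auto simp: L_def continuous_map_def)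
  have compact: "compactin X L"
    using image_compactin[OF _ u] K unfolding compact_space_def L_def by blast
  have uL: "continuous_map K (subtopology X L) u"
    using u by (simp add: L_def continuous_map_in_subtopology)
  moreover have cmL: "closed_map K (subtopology X L) u"
    by (rule closed_map_into_subtopology[OF cm]) (simp add: L_def)
  moreover have "u ` topspace K = topspace (subtopology X L)"
    using LX by (auto simp: L_def)
  ultimately have "normal_space (subtopology X L)"
    using K normal_space_continuous_closed_map_image compact_Hausdorff_or_regular_imp_normal_space
    by blast
  moreover have "t1_space (subtopology X L)"
  proof -
    have "closedin (subtopology X L) {y}" if "y \<in> topspace (subtopology X L)" for y
    proof -
      obtain x where x: "x \<in> topspace K" "y = u x" using \<open>y \<in> _\<close> by (auto simp: L_def)
      have "closedin K {x}" using K(2) x by (simp add: closedin_Hausdorff_singleton)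
      then show ?thesis using cmL x unfolding closed_map_def by force
    qed
    then show ?thesis by (simp add: t1_space_closedin_singleton)
  qed
  ultimately have haus: "Hausdorff_space (subtopology X L)"
    by (simp add: normal_t1_imp_Hausdorff_space)
  show ?thesis
    unfolding continuous_map_def
  proof (intro conjI allI impI)
    show "u \<in> topspace K \<rightarrow> topspace (kify X)"
      using u by (simp add: continuous_map_def)
    fix U assume "openin (kify X) U"
    then have "openin (subtopology X L) (U \<inter> L)"
      using compact haus by (simp add: openin_kify)
    then have "openin K {x \<in> topspace K. u x \<in> U \<inter> L}"
      by (rule openin_continuous_map_preimage[OF uL])
    moreover have "{x \<in> topspace K. u x \<in> U \<inter> L} = {x \<in> topspace K. u x \<in> U}"
      by (auto simp: L_def)
    ultimately show "openin K {x \<in> topspace K. u x \<in> U}" by simp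
  qed
qed


section \<open>Actions of discrete groups\<close>

definition G_space :: "('g, 'm) monoid_scheme \<Rightarrow> ('g \<Rightarrow> 'a \<Rightarrow> 'a) \<Rightarrow> 'a topology \<Rightarrow> bool" where
  "G_space \<Gamma> act X \<longleftrightarrow>
     (\<forall>g\<in>carrier \<Gamma>. continuous_map X X (act g)) \<and>
     (\<forall>x\<in>topspace X. act \<one>\<^bsub>\<Gamma>\<^esub> x = x) \<and>
     (\<forall>g\<in>carrier \<Gamma>. \<forall>h\<in>carrier \<Gamma>. \<forall>x\<in>topspace X. act (g \<otimes>\<^bsub>\<Gamma>\<^esub> h) x = act g (act h x))"

definition free_action :: "('g, 'm) monoid_scheme \<Rightarrow> ('g \<Rightarrow> 'a \<Rightarrow> 'a) \<Rightarrow> 'a topology \<Rightarrow> bool" where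
  "free_action \<Gamma> act X \<longleftrightarrow> (\<forall>g\<in>carrier \<Gamma>. \<forall>x\<in>topspace X. act g x = x \<longrightarrow> g = \<one>\<^bsub>\<Gamma>\<^esub>)"

definition equivariant ::
  "('g, 'm) monoid_scheme \<Rightarrow> ('g \<Rightarrow> 'a \<Rightarrow> 'a) \<Rightarrow> 'a topology \<Rightarrow> ('g \<Rightarrow> 'b \<Rightarrow> 'b) \<Rightarrow> ('a \<Rightarrow> 'b) \<Rightarrow> bool" where
  "equivariant \<Gamma> act X act' f \<longleftrightarrow>
     (\<forall>g\<in>carrier \<Gamma>. \<forall>x\<in>topspace X. f (act g x) = act' g (f x))"

definition G_homotopy_equivalent ::
  "('g, 'm) monoid_scheme \<Rightarrow> ('g \<Rightarrow> 'a \<Rightarrow> 'a) \<Rightarrow> 'a topology \<Rightarrow> ('g \<Rightarrow> 'b \<Rightarrow> 'b) \<Rightarrow> 'b topology \<Rightarrow> bool"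
  where
  "G_homotopy_equivalent \<Gamma> act X act' Y \<longleftrightarrow>
     (\<exists>f h. continuous_map X Y f \<and> equivariant \<Gamma> act X act' f \<and>
            continuous_map Y X h \<and> equivariant \<Gamma> act' Y act h \<and>
            homotopic_with (equivariant \<Gamma> act X act) X X (h \<circ> f) id \<and>
            homotopic_with (equivariant \<Gamma> act' Y act') Y Y (f \<circ> h) id)"

definition disc :: "nat \<Rightarrow> (nat \<Rightarrow> real) set" where
  "disc n = {x \<in> topspace (Euclidean_space n). (\<Sum>i<n. x i ^ 2) \<le> 1}"

definition open_disc :: "nat \<Rightarrow> (nat \<Rightarrow> real) set" where
  "open_disc n = {x \<in> topspace (Euclidean_space n). (\<Sum>i<n. x i ^ 2) < 1}"

text \<open>
  \<open>attaches_G_cells \<Gamma> act W n A B J H\<close> says that the subspace \<open>B\<close> of \<open>W\<close> is the pushout of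
  \<open>A\<close> along equivariant maps from the boundary of a disjoint union of cells \<open>\<Gamma>/H \<phi> \<times> D\<^sup>n\<close> to \<open>A\<close>.
  Each cell is given by the restriction \<open>\<phi> \<in> J\<close> of its characteristic map to \<open>{H \<phi>} \<times> D\<^sup>n\<close>;
  the whole characteristic map is \<open>(g H \<phi>, x) \<mapsto> g \<cdot> \<phi> x\<close>.
\<close>

definition attaches_G_cells ::
  "('g, 'm) monoid_scheme \<Rightarrow> ('g \<Rightarrow> 'w \<Rightarrow> 'w) \<Rightarrow> 'w topology \<Rightarrow> nat \<Rightarrow> 'w set \<Rightarrow> 'w set \<Rightarrow>
   ((nat \<Rightarrow> real) \<Rightarrow> 'w) set \<Rightarrow> (((nat \<Rightarrow> real) \<Rightarrow> 'w) \<Rightarrow> 'g set) \<Rightarrow> bool" where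
  "attaches_G_cells \<Gamma> act W n A B J H \<longleftrightarrow>
     A \<subseteq> B \<and> B \<subseteq> topspace W \<and>
     (\<forall>\<phi>\<in>J. subgroup (H \<phi>) \<Gamma> \<and>
        continuous_map (subtopology (Euclidean_space n) (disc n)) W \<phi> \<and>
        \<phi> ` (disc n - open_disc n) \<subseteq> A \<and>
        (\<forall>h\<in>H \<phi>. \<forall>x\<in>disc n. act h (\<phi> x) = \<phi> x)) \<and>
     B = A \<union> (\<Union>\<phi>\<in>J. \<Union>g\<in>carrier \<Gamma>. act g ` \<phi> ` disc n) \<and>
     (\<forall>\<phi>\<in>J. \<forall>g\<in>carrier \<Gamma>. \<forall>x\<in>open_disc n. act g (\<phi> x) \<notin> A) \<and>
     (\<forall>\<phi>\<in>J. \<forall>\<phi>'\<in>J. \<forall>g\<in>carrier \<Gamma>. \<forall>g'\<in>carrier \<Gamma>. \<forall>x\<in>open_disc n. \<forall>x'\<in>open_disc n.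
        act g (\<phi> x) = act g' (\<phi>' x') \<longrightarrow> \<phi> = \<phi>' \<and> x = x' \<and> inv\<^bsub>\<Gamma>\<^esub> g \<otimes>\<^bsub>\<Gamma>\<^esub> g' \<in> H \<phi>) \<and>
     (\<forall>S\<subseteq>B. closedin (subtopology W A) (S \<inter> A) \<and>
        (\<forall>\<phi>\<in>J. \<forall>g\<in>carrier \<Gamma>.
           closedin (subtopology (Euclidean_space n) (disc n)) {x \<in> disc n. act g (\<phi> x) \<in> S}) \<longrightarrow>
        closedin (subtopology W B) S)"

text \<open>\<open>F 0\<close> is the empty (-1)-skeleton and \<open>F (Suc n)\<close> is the \<open>n\<close>-skeleton.\<close>

definition G_CW_complex :: "('g, 'm) monoid_scheme \<Rightarrow> ('g \<Rightarrow> 'w \<Rightarrow> 'w) \<Rightarrow> 'w topology \<Rightarrow> bool" where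
  "G_CW_complex \<Gamma> act W \<longleftrightarrow> G_space \<Gamma> act W \<and>
     (\<exists>F :: nat \<Rightarrow> 'w set.
        F 0 = {} \<and> (\<Union>n. F n) = topspace W \<and>
        (\<forall>n. \<exists>J H. attaches_G_cells \<Gamma> act W n (F n) (F (Suc n)) J H) \<and>
        (\<forall>S\<subseteq>topspace W. (\<forall>n. closedin (subtopology W (F n)) (S \<inter> F n)) \<longrightarrow> closedin W S))"

definition orbit_space :: "('g, 'm) monoid_scheme \<Rightarrow> ('g \<Rightarrow> 'a \<Rightarrow> 'a) \<Rightarrow> 'a topology \<Rightarrow> 'a set topology" where
  "orbit_space \<Gamma> act X =
     topology (\<lambda>U. U \<subseteq> orbits \<Gamma> (topspace X) act \<and> openin X {x \<in> topspace X. orbit \<Gamma> act x \<in> U})"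

lemma openin_orbit_space:
  "openin (orbit_space \<Gamma> act X) U \<longleftrightarrow>
     U \<subseteq> orbits \<Gamma> (topspace X) act \<and> openin X {x \<in> topspace X. orbit \<Gamma> act x \<in> U}"
proof -
  have "istopology (\<lambda>U. U \<subseteq> orbits \<Gamma> (topspace X) act \<and> openin X {x \<in> topspace X. orbit \<Gamma> act x \<in> U})"
    (is "istopology (\<lambda>U. U \<subseteq> ?O \<and> openin X (?pre U))")
    unfolding istopology_def
  proof (intro conjI allI impI)
    fix S T
    assume S: "S \<subseteq> ?O \<and> openin X (?pre S)" and T: "T \<subseteq> ?O \<and> openin X (?pre T)"
    show "S \<inter> T \<subseteq> ?O" using S by blast
    have "openin X (?pre S \<inter> ?pre T)" using S T openin_Int by blast
    moreover have "?pre S \<inter> ?pre T = ?pre (S \<inter> T)" by blast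
    ultimately show "openin X (?pre (S \<inter> T))" by simp
  next
    fix \<K> assume \<K>: "\<forall>S\<in>\<K>. S \<subseteq> ?O \<and> openin X (?pre S)"
    show "\<Union>\<K> \<subseteq> ?O" using \<K> by blast
    have "openin X (\<Union>S\<in>\<K>. ?pre S)" using \<K> by (intro openin_Union) auto
    moreover have "(\<Union>S\<in>\<K>. ?pre S) = ?pre (\<Union>\<K>)" by blast
    ultimately show "openin X (?pre (\<Union>\<K>))" by simp
  qed
  then show ?thesis by (simp add: orbit_space_def)
qed


section \<open>Finite index sets\<close>

text \<open>
  A universe of index points closed under ordered pairs and finite tuples. Finite sets are taken to
  be finite sets of such points; this class contains a set of every finite cardinality and is closed
  under the disjoint unions and products occurring in the axioms.
\<close>

datatype ix = Pt nat | IPair ix ix | Tup "(ix \<times> ix) fset"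

primrec ix_fst :: "ix \<Rightarrow> ix" where
  "ix_fst (IPair a b) = a"

primrec ix_snd :: "ix \<Rightarrow> ix" where
  "ix_snd (IPair a b) = b"

text \<open>A tuple \<open>(f a)\<^sub>a\<^sub>\<in>\<^sub>A\<close> is encoded by the graph of \<open>f\<close> on \<open>A\<close>.\<close>

definition tuple :: "ix set \<Rightarrow> (ix \<Rightarrow> ix) \<Rightarrow> ix" where
  "tuple A f = Tup (Abs_fset ((\<lambda>a. (a, f a)) ` A))"

primrec proj :: "ix \<Rightarrow> ix \<Rightarrow> ix" where
  "proj (Tup F) = (\<lambda>a. THE b. (a, b) |\<in>| F)"

lemma proj_tuple [simp]: "finite A \<Longrightarrow> a \<in> A \<Longrightarrow> proj (tuple A f) a = f a"
  by (auto simp: tuple_def Abs_fset_inverse)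

definition dsum :: "ix set \<Rightarrow> (ix \<Rightarrow> ix set) \<Rightarrow> ix set" where
  "dsum A B = {IPair a b | a b. a \<in> A \<and> b \<in> B a}"

definition dprod :: "ix set \<Rightarrow> (ix \<Rightarrow> ix set) \<Rightarrow> ix set" where
  "dprod A B = tuple A ` (\<Pi>\<^sub>E a\<in>A. B a)"

abbreviation finite_family :: "ix set \<Rightarrow> (ix \<Rightarrow> ix set) \<Rightarrow> bool" where
  "finite_family A B \<equiv> finite A \<and> (\<forall>a\<in>A. finite (B a))"

definition std :: "nat \<Rightarrow> ix set" where
  "std n = Pt ` {1..n}"

definition lift_perm :: "(nat \<Rightarrow> nat) \<Rightarrow> ix \<Rightarrow> ix" where
  "lift_perm \<sigma> u = (case u of Pt i \<Rightarrow> Pt (\<sigma> i) | _ \<Rightarrow> u)"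


section \<open>Operads\<close>

text \<open>
  \<open>op_space \<O> A\<close> is \<open>\<O>(A)\<close>, \<open>op_map \<O> A A' \<sigma>\<close> is the map \<open>\<O>(A) \<rightarrow> \<O>(A')\<close> induced by a bijection
  \<open>\<sigma> : A \<rightarrow> A'\<close>, \<open>op_unit \<O>\<close> is the unit in \<open>\<O>({1})\<close>, and \<open>op_comp \<O> A B g c\<close> is
  \<open>\<gamma>(g; (c\<^sub>a)\<^sub>a\<^sub>\<in>\<^sub>A)\<close>, where \<open>c\<^sub>a \<in> \<O>(B\<^sub>a)\<close>.
\<close>

record 'c operad =
  op_space :: "ix set \<Rightarrow> 'c topology"
  op_map :: "ix set \<Rightarrow> ix set \<Rightarrow> (ix \<Rightarrow> ix) \<Rightarrow> 'c \<Rightarrow> 'c"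
  op_unit :: 'c
  op_comp :: "ix set \<Rightarrow> (ix \<Rightarrow> ix set) \<Rightarrow> 'c \<Rightarrow> (ix \<Rightarrow> 'c) \<Rightarrow> 'c"

abbreviation op_pts :: "'c operad \<Rightarrow> ix set \<Rightarrow> 'c set" where
  "op_pts \<O> A \<equiv> topspace (op_space \<O> A)"

abbreviation op_fam :: "'c operad \<Rightarrow> ix set \<Rightarrow> (ix \<Rightarrow> ix set) \<Rightarrow> (ix \<Rightarrow> 'c) set" where
  "op_fam \<O> A B \<equiv> (\<Pi>\<^sub>E a\<in>A. op_pts \<O> (B a))"

definition unit_at :: "'c operad \<Rightarrow> ix \<Rightarrow> 'c" where
  "unit_at \<O> a = op_map \<O> (std 1) {a} (\<lambda>_. a) (op_unit \<O>)"

text \<open>The transport of a family along bijections \<open>\<sigma> : A \<rightarrow> A'\<close> and \<open>\<tau> a : B a \<rightarrow> B' (\<sigma> a)\<close>.\<close>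

definition fam_map ::
  "'c operad \<Rightarrow> ix set \<Rightarrow> (ix \<Rightarrow> ix set) \<Rightarrow> ix set \<Rightarrow> (ix \<Rightarrow> ix set) \<Rightarrow>
   (ix \<Rightarrow> ix) \<Rightarrow> (ix \<Rightarrow> ix \<Rightarrow> ix) \<Rightarrow> (ix \<Rightarrow> 'c) \<Rightarrow> (ix \<Rightarrow> 'c)" where
  "fam_map \<O> A B A' B' \<sigma> \<tau> c =
     (\<lambda>a'\<in>A'. let a = inv_into A \<sigma> a' in op_map \<O> (B a) (B' a') (\<tau> a) (c a))"

text \<open>
  The identity law is stated for bijections that are the identity on \<open>A\<close> only, so that
  \<open>op_map \<O> A A' \<sigma>\<close> depends only on the restriction of \<open>\<sigma>\<close> to \<open>A\<close>.
\<close>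

definition operad :: "'c operad \<Rightarrow> bool" where
  "operad \<O> \<longleftrightarrow>
    (\<forall>A. finite A \<longrightarrow> cgwh_space (op_space \<O> A)) \<and>
    (\<forall>A A' \<sigma>. finite A \<and> bij_betw \<sigma> A A' \<longrightarrow>
       continuous_map (op_space \<O> A) (op_space \<O> A') (op_map \<O> A A' \<sigma>)) \<and>
    (\<forall>A \<sigma>. finite A \<and> (\<forall>a\<in>A. \<sigma> a = a) \<longrightarrow> (\<forall>c\<in>op_pts \<O> A. op_map \<O> A A \<sigma> c = c)) \<and>
    (\<forall>A A' A'' \<sigma> \<tau>. finite A \<and> bij_betw \<sigma> A A' \<and> bij_betw \<tau> A' A'' \<longrightarrow>
       (\<forall>c\<in>op_pts \<O> A. op_map \<O> A A'' (\<tau> \<circ> \<sigma>) c = op_map \<O> A' A'' \<tau> (op_map \<O> A A' \<sigma> c))) \<and>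
    (\<exists>c. op_pts \<O> {} = {c}) \<and>
    op_unit \<O> \<in> op_pts \<O> (std 1) \<and>
    (\<forall>A B. finite_family A B \<longrightarrow>
       continuous_map (kprod_family (op_space \<O> A) A (\<lambda>a. op_space \<O> (B a)))
         (op_space \<O> (dsum A B)) (\<lambda>(g, c). op_comp \<O> A B g c)) \<and>
    (\<forall>A B A' B' \<sigma> \<tau>. finite_family A B \<and> bij_betw \<sigma> A A' \<and>
         (\<forall>a\<in>A. bij_betw (\<tau> a) (B a) (B' (\<sigma> a))) \<longrightarrow>
       (\<forall>g\<in>op_pts \<O> A. \<forall>c\<in>op_fam \<O> A B.
          op_comp \<O> A' B' (op_map \<O> A A' \<sigma> g) (fam_map \<O> A B A' B' \<sigma> \<tau> c) =
          op_map \<O> (dsum A B) (dsum A' B')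
            (\<lambda>u. IPair (\<sigma> (ix_fst u)) (\<tau> (ix_fst u) (ix_snd u))) (op_comp \<O> A B g c))) \<and>
    (\<forall>a B. finite B \<longrightarrow> (\<forall>c\<in>op_pts \<O> B.
       op_comp \<O> {a} (\<lambda>_. B) (unit_at \<O> a) (\<lambda>_\<in>{a}. c) =
       op_map \<O> B (dsum {a} (\<lambda>_. B)) (IPair a) c)) \<and>
    (\<forall>A t. finite A \<longrightarrow> (\<forall>g\<in>op_pts \<O> A.
       op_comp \<O> A (\<lambda>a. {t a}) g (\<lambda>a\<in>A. unit_at \<O> (t a)) =
       op_map \<O> A (dsum A (\<lambda>a. {t a})) (\<lambda>a. IPair a (t a)) g)) \<and>
    (\<forall>A B D. finite_family A B \<and> finite_family (dsum A B) D \<longrightarrow>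
       (\<forall>g\<in>op_pts \<O> A. \<forall>c\<in>op_fam \<O> A B. \<forall>d\<in>op_fam \<O> (dsum A B) D.
          op_comp \<O> A (\<lambda>a. dsum (B a) (\<lambda>b. D (IPair a b))) g
            (\<lambda>a\<in>A. op_comp \<O> (B a) (\<lambda>b. D (IPair a b)) (c a) (\<lambda>b\<in>B a. d (IPair a b))) =
          op_map \<O> (dsum (dsum A B) D) (dsum A (\<lambda>a. dsum (B a) (\<lambda>b. D (IPair a b))))
            (\<lambda>u. IPair (ix_fst (ix_fst u)) (IPair (ix_snd (ix_fst u)) (ix_snd u)))
            (op_comp \<O> (dsum A B) D (op_comp \<O> A B g c) d)))"

abbreviation sigma_act :: "'c operad \<Rightarrow> nat \<Rightarrow> (nat \<Rightarrow> nat) \<Rightarrow> 'c \<Rightarrow> 'c" where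
  "sigma_act \<O> n \<sigma> \<equiv> op_map \<O> (std n) (std n) (lift_perm \<sigma>)"

text \<open>
  The type argument is the type in which the points of the \<open>\<Sigma>\<^sub>n\<close>-CW complexes live.
  Note that \<^const>\<open>contractible_space\<close> holds of the empty space.
\<close>

definition einf_operad :: "'w itself \<Rightarrow> 'c operad \<Rightarrow> bool" where
  "einf_operad TW \<O> \<longleftrightarrow> operad \<O> \<and>
     (\<forall>n. op_pts \<O> (std n) \<noteq> {} \<and> contractible_space (op_space \<O> (std n)) \<and>
        free_action (sym_group n) (sigma_act \<O> n) (op_space \<O> (std n)) \<and>
        (\<exists>(W :: 'w topology) act. G_CW_complex (sym_group n) act W \<and>
           G_homotopy_equivalent (sym_group n) (sigma_act \<O> n) (op_space \<O> (std n)) act W))"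

text \<open>\<open>\<lambda>(g; (c\<^sub>a)\<^sub>a\<^sub>\<in>\<^sub>A)\<close>, with \<open>c\<^sub>a \<in> \<C>(B\<^sub>a)\<close>, is written \<open>lam A B g c\<close>.\<close>

definition operad_action ::
  "'g operad \<Rightarrow> 'c operad \<Rightarrow> (ix set \<Rightarrow> (ix \<Rightarrow> ix set) \<Rightarrow> 'g \<Rightarrow> (ix \<Rightarrow> 'c) \<Rightarrow> 'c) \<Rightarrow> bool" where
  "operad_action \<G> \<C> lam \<longleftrightarrow>
    (\<forall>A B. finite_family A B \<longrightarrow>
       continuous_map (kprod_family (op_space \<G> A) A (\<lambda>a. op_space \<C> (B a)))
         (op_space \<C> (dprod A B)) (\<lambda>(g, c). lam A B g c)) \<and>
    (\<forall>A B A' B' \<sigma> \<tau>. finite_family A B \<and> bij_betw \<sigma> A A' \<and>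
         (\<forall>a\<in>A. bij_betw (\<tau> a) (B a) (B' (\<sigma> a))) \<longrightarrow>
       (\<forall>g\<in>op_pts \<G> A. \<forall>c\<in>op_fam \<C> A B.
          lam A' B' (op_map \<G> A A' \<sigma> g) (fam_map \<C> A B A' B' \<sigma> \<tau> c) =
          op_map \<C> (dprod A B) (dprod A' B')
            (\<lambda>u. tuple A' (\<lambda>a'. let a = inv_into A \<sigma> a' in \<tau> a (proj u a))) (lam A B g c))) \<and>
    \<comment> \<open>\<open>\<lambda>(1; c) = c\<close>\<close>
    (\<forall>a B. finite B \<longrightarrow> (\<forall>c\<in>op_pts \<C> B.
       lam {a} (\<lambda>_. B) (unit_at \<G> a) (\<lambda>_\<in>{a}. c) =
       op_map \<C> B (dprod {a} (\<lambda>_. B)) (\<lambda>b. tuple {a} (\<lambda>_. b)) c)) \<and>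
    \<comment> \<open>\<open>\<lambda>(g; (1)\<^sub>a) = 1\<close>\<close>
    (\<forall>A t. finite A \<longrightarrow> (\<forall>g\<in>op_pts \<G> A.
       lam A (\<lambda>a. {t a}) g (\<lambda>a\<in>A. unit_at \<C> (t a)) = unit_at \<C> (tuple A t))) \<and>
    \<comment> \<open>\<open>\<lambda>(\<gamma>(g; h); c) = \<lambda>(g; (\<lambda>(h\<^sub>a; (c\<^sub>a\<^sub>b)\<^sub>b))\<^sub>a)\<close>\<close>
    (\<forall>A B D. finite_family A B \<and> finite_family (dsum A B) D \<longrightarrow>
       (\<forall>g\<in>op_pts \<G> A. \<forall>h\<in>op_fam \<G> A B. \<forall>c\<in>op_fam \<C> (dsum A B) D.
          op_map \<C> (dprod (dsum A B) D) (dprod A (\<lambda>a. dprod (B a) (\<lambda>b. D (IPair a b))))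
            (\<lambda>u. tuple A (\<lambda>a. tuple (B a) (\<lambda>b. proj u (IPair a b))))
            (lam (dsum A B) D (op_comp \<G> A B g h) c) =
          lam A (\<lambda>a. dprod (B a) (\<lambda>b. D (IPair a b))) g
            (\<lambda>a\<in>A. lam (B a) (\<lambda>b. D (IPair a b)) (h a) (\<lambda>b\<in>B a. c (IPair a b))))) \<and>
    \<comment> \<open>\<open>\<lambda>(g; (\<gamma>(c\<^sub>a; (d\<^sub>a\<^sub>b)\<^sub>b))\<^sub>a) = \<gamma>(\<lambda>(g; c); (\<lambda>(g; (d(a, u a))\<^sub>a))\<^sub>u)\<close>\<close>
    (\<forall>A B D. finite_family A B \<and> finite_family (dsum A B) D \<longrightarrow>
       (\<forall>g\<in>op_pts \<G> A. \<forall>c\<in>op_fam \<C> A B. \<forall>d\<in>op_fam \<C> (dsum A B) D.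
          lam A (\<lambda>a. dsum (B a) (\<lambda>b. D (IPair a b))) g
            (\<lambda>a\<in>A. op_comp \<C> (B a) (\<lambda>b. D (IPair a b)) (c a) (\<lambda>b\<in>B a. d (IPair a b))) =
          op_map \<C> (dsum (dprod A B) (\<lambda>u. dprod A (\<lambda>a. D (IPair a (proj u a)))))
            (dprod A (\<lambda>a. dsum (B a) (\<lambda>b. D (IPair a b))))
            (\<lambda>v. tuple A (\<lambda>a. IPair (proj (ix_fst v) a) (proj (ix_snd v) a)))
            (op_comp \<C> (dprod A B) (\<lambda>u. dprod A (\<lambda>a. D (IPair a (proj u a)))) (lam A B g c)
              (\<lambda>u\<in>dprod A B. lam A (\<lambda>a. D (IPair a (proj u a))) g
                 (\<lambda>a\<in>A. d (IPair a (proj u a)))))))"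

definition einf_operad_pair ::
  "'v itself \<Rightarrow> 'w itself \<Rightarrow> 'c operad \<Rightarrow> 'g operad \<Rightarrow>
   (ix set \<Rightarrow> (ix \<Rightarrow> ix set) \<Rightarrow> 'g \<Rightarrow> (ix \<Rightarrow> 'c) \<Rightarrow> 'c) \<Rightarrow> bool" where
  "einf_operad_pair TV TW \<C> \<G> lam \<longleftrightarrow>
     einf_operad TV \<C> \<and> einf_operad TW \<G> \<and> operad_action \<G> \<C> lam"

definition operad_algebra ::
  "'c operad \<Rightarrow> 'x topology \<Rightarrow> (ix set \<Rightarrow> 'c \<Rightarrow> (ix \<Rightarrow> 'x) \<Rightarrow> 'x) \<Rightarrow> bool" where
  "operad_algebra \<O> X \<theta> \<longleftrightarrow>
    (\<forall>A. finite A \<longrightarrow>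
       continuous_map (kprod_family (op_space \<O> A) A (\<lambda>_. X)) X (\<lambda>(c, x). \<theta> A c x)) \<and>
    (\<forall>A A' \<sigma>. finite A \<and> bij_betw \<sigma> A A' \<longrightarrow>
       (\<forall>c\<in>op_pts \<O> A. \<forall>x\<in>(\<Pi>\<^sub>E a\<in>A'. topspace X).
          \<theta> A' (op_map \<O> A A' \<sigma> c) x = \<theta> A c (\<lambda>a\<in>A. x (\<sigma> a)))) \<and>
    (\<forall>a. \<forall>x\<in>topspace X. \<theta> {a} (unit_at \<O> a) (\<lambda>_\<in>{a}. x) = x) \<and>
    (\<forall>A B. finite_family A B \<longrightarrow>
       (\<forall>g\<in>op_pts \<O> A. \<forall>c\<in>op_fam \<O> A B. \<forall>x\<in>(\<Pi>\<^sub>E u\<in>dsum A B. topspace X).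
          \<theta> (dsum A B) (op_comp \<O> A B g c) x =
          \<theta> A g (\<lambda>a\<in>A. \<theta> (B a) (c a) (\<lambda>b\<in>B a. x (IPair a b)))))"

definition einf_ring_space ::
  "'c operad \<Rightarrow> 'g operad \<Rightarrow> (ix set \<Rightarrow> (ix \<Rightarrow> ix set) \<Rightarrow> 'g \<Rightarrow> (ix \<Rightarrow> 'c) \<Rightarrow> 'c) \<Rightarrow> 'x topology \<Rightarrow>
   (ix set \<Rightarrow> 'c \<Rightarrow> (ix \<Rightarrow> 'x) \<Rightarrow> 'x) \<Rightarrow> (ix set \<Rightarrow> 'g \<Rightarrow> (ix \<Rightarrow> 'x) \<Rightarrow> 'x) \<Rightarrow> bool" where
  "einf_ring_space \<C> \<G> lam X \<theta> \<xi> \<longleftrightarrow>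
    cgwh_space X \<and> operad_algebra \<C> X \<theta> \<and> operad_algebra \<G> X \<xi> \<and>
    (\<forall>A B. finite_family A B \<longrightarrow>
       (\<forall>g\<in>op_pts \<G> A. \<forall>c\<in>op_fam \<C> A B. \<forall>x\<in>(\<Pi>\<^sub>E u\<in>dsum A B. topspace X).
          \<xi> A g (\<lambda>a\<in>A. \<theta> (B a) (c a) (\<lambda>b\<in>B a. x (IPair a b))) =
          \<theta> (dprod A B) (lam A B g c) (\<lambda>u\<in>dprod A B. \<xi> A g (\<lambda>a\<in>A. x (IPair a (proj u a))))))"


section \<open>Homology with coefficients in the field with \<open>p\<close> elements\<close>

text \<open>
  The homology of the complex of integral singular chains modulo \<open>p\<close>, written as in the library's
  integral homology: cycles are the integral chains whose boundary is divisible by \<open>p\<close>, and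
  boundaries are taken up to multiples of \<open>p\<close>. As in the library, groups are written multiplicatively.
\<close>

definition modp_cycle :: "nat \<Rightarrow> nat \<Rightarrow> 'a topology \<Rightarrow> 'a chain \<Rightarrow> bool" where
  "modp_cycle p n X c \<longleftrightarrow> singular_chain n X c \<and>
     (\<exists>e. singular_chain (n - 1) X e \<and> chain_boundary n c = frag_cmul (int p) e)"

definition modp_boundary :: "nat \<Rightarrow> nat \<Rightarrow> 'a topology \<Rightarrow> 'a chain \<Rightarrow> bool" where
  "modp_boundary p n X b \<longleftrightarrow>
     (\<exists>d e. singular_chain (Suc n) X d \<and> singular_chain n X e \<and>
        b = chain_boundary (Suc n) d + frag_cmul (int p) e)"

definition modp_cycle_group :: "nat \<Rightarrow> nat \<Rightarrow> 'a topology \<Rightarrow> 'a chain monoid" where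
  "modp_cycle_group p n X = subgroup_generated (chain_group n X) (Collect (modp_cycle p n X))"

definition modp_homology_group :: "nat \<Rightarrow> nat \<Rightarrow> 'a topology \<Rightarrow> 'a chain set monoid" where
  "modp_homology_group p n X = modp_cycle_group p n X Mod Collect (modp_boundary p n X)"

definition modp_class :: "nat \<Rightarrow> nat \<Rightarrow> 'a topology \<Rightarrow> 'a chain \<Rightarrow> 'a chain set" where
  "modp_class p n X c = Collect (modp_boundary p n X) #>\<^bsub>modp_cycle_group p n X\<^esub> c"

definition modp_homology :: "nat \<Rightarrow> 'a topology \<Rightarrow> (nat \<Rightarrow> 'a chain set) monoid" where
  "modp_homology p X = sum_group UNIV (\<lambda>n. modp_homology_group p n X)"

lemma subgroup_modp_cycle: "subgroup (Collect (modp_cycle p n X)) (chain_group n X)"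
proof (rule group.subgroupI)
  show "Collect (modp_cycle p n X) \<noteq> {}"
    by (auto simp: modp_cycle_def intro!: exI[of _ 0])
  fix a assume a: "a \<in> Collect (modp_cycle p n X)"
  then obtain e where "singular_chain (n - 1) X e" "chain_boundary n a = frag_cmul (int p) e"
    by (auto simp: modp_cycle_def)
  moreover have "- frag_cmul (int p) e = frag_cmul (int p) (- e)"
    by (simp add: frag_cmul_def uminus_poly_mapping_def poly_mapping_eqI)
  ultimately have "singular_chain (n - 1) X (- e)" "chain_boundary n (- a) = frag_cmul (int p) (- e)"
    by (simp_all add: singular_chain_minus chain_boundary_minus)
  moreover have "singular_chain n X (- a)"
    using a by (simp add: modp_cycle_def singular_chain_minus)
  ultimately have "modp_cycle p n X (- a)"
    unfolding modp_cycle_def by blast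
  moreover have "inv\<^bsub>chain_group n X\<^esub> a = - a"
    using a by (simp add: modp_cycle_def chain_group_def singular_chain_def)
  ultimately show "inv\<^bsub>chain_group n X\<^esub> a \<in> Collect (modp_cycle p n X)" by simp
next
  fix a b assume "a \<in> Collect (modp_cycle p n X)" "b \<in> Collect (modp_cycle p n X)"
  then obtain e f where "singular_chain n X a" "singular_chain n X b"
    "singular_chain (n - 1) X e" "chain_boundary n a = frag_cmul (int p) e"
    "singular_chain (n - 1) X f" "chain_boundary n b = frag_cmul (int p) f"
    by (auto simp: modp_cycle_def)
  then show "a \<otimes>\<^bsub>chain_group n X\<^esub> b \<in> Collect (modp_cycle p n X)"
    by (auto simp: modp_cycle_def singular_chain_add chain_boundary_add
        intro!: exI[of _ "e + f"] frag_cmul_distrib2[symmetric])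
qed (auto simp: modp_cycle_def)

lemma carrier_modp_cycle_group [simp]:
  "carrier (modp_cycle_group p n X) = Collect (modp_cycle p n X)"
  unfolding modp_cycle_group_def
  by (simp add: subgroup.carrier_subgroup_generated_subgroup subgroup_modp_cycle)

subsection \<open>Induced maps and cross products\<close>

definition modp_induced ::
  "nat \<Rightarrow> 'a topology \<Rightarrow> 'b topology \<Rightarrow> ('a \<Rightarrow> 'b) \<Rightarrow> (nat \<Rightarrow> 'a chain set) \<Rightarrow> (nat \<Rightarrow> 'b chain set)" where
  "modp_induced p X Y f x = (\<lambda>n. \<Union>c\<in>x n. modp_class p n Y (chain_map n f c))"

text \<open>
  The chain-level cross product is the shuffle map. A subset \<open>S\<close> of \<open>{..<i+j}\<close> with \<open>i\<close> elements is
  the lattice path from \<open>(0,0)\<close> to \<open>(i,j)\<close> whose step number \<open>s\<close> goes in the first direction if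
  \<open>s \<in> S\<close> and in the second direction otherwise. The \<open>t\<close>-th vertex on the path is
  \<open>(card (S \<inter> {..<t}), card ({..<t} - S))\<close>, and the sign is that of the shuffle.
\<close>

definition collapse_simplex :: "nat \<Rightarrow> (nat \<Rightarrow> nat) \<Rightarrow> (nat \<Rightarrow> real) \<Rightarrow> nat \<Rightarrow> real" where
  "collapse_simplex n v = oriented_simplex n (\<lambda>t k. if k = v t then 1 else 0)"

definition shuffle_sign :: "nat \<Rightarrow> nat set \<Rightarrow> int" where
  "shuffle_sign n S = (-1) ^ card {(s, t). s \<in> S \<and> t \<in> {..<n} - S \<and> t < s}"

definition cross_simplex ::
  "nat \<Rightarrow> nat \<Rightarrow> ((nat \<Rightarrow> real) \<Rightarrow> 'a) \<Rightarrow> ((nat \<Rightarrow> real) \<Rightarrow> 'b) \<Rightarrow> ('a \<times> 'b) chain" where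
  "cross_simplex i j \<sigma> \<tau> =
     (\<Sum>S | S \<subseteq> {..<i + j} \<and> card S = i.
        frag_cmul (shuffle_sign (i + j) S)
          (frag_of (\<lambda>x\<in>standard_simplex (i + j).
             (\<sigma> (collapse_simplex (i + j) (\<lambda>t. card (S \<inter> {..<t})) x),
              \<tau> (collapse_simplex (i + j) (\<lambda>t. card ({..<t} - S)) x)))))"

definition cross_chain :: "nat \<Rightarrow> nat \<Rightarrow> 'a chain \<Rightarrow> 'b chain \<Rightarrow> ('a \<times> 'b) chain" where
  "cross_chain i j c d = frag_extend (\<lambda>\<sigma>. frag_extend (\<lambda>\<tau>. cross_simplex i j \<sigma> \<tau>) d) c"

definition modp_cross ::
  "nat \<Rightarrow> 'a topology \<Rightarrow> 'b topology \<Rightarrow> (nat \<Rightarrow> 'a chain set) \<Rightarrow> (nat \<Rightarrow> 'b chain set) \<Rightarrow>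
   (nat \<Rightarrow> ('a \<times> 'b) chain set)" where
  "modp_cross p X Y x y = (\<lambda>n.
     finprod (modp_homology_group p n (kprod X Y))
       (\<lambda>i. \<Union>c\<in>x i. \<Union>d\<in>y (n - i). modp_class p n (kprod X Y) (cross_chain i (n - i) c d))
       {..n})"


section \<open>The operations on the homology of an \<open>E\<^sub>\<infinity>\<close> ring space\<close>

definition homology_product ::
  "nat \<Rightarrow> 'x topology \<Rightarrow> (ix set \<Rightarrow> 'g \<Rightarrow> (ix \<Rightarrow> 'x) \<Rightarrow> 'x) \<Rightarrow> 'g \<Rightarrow>
   (nat \<Rightarrow> 'x chain set) \<Rightarrow> (nat \<Rightarrow> 'x chain set) \<Rightarrow> (nat \<Rightarrow> 'x chain set)" where
  "homology_product p X \<xi> g\<^sub>2 x y =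
     modp_induced p (kprod X X) X
       (\<lambda>(a, b). \<xi> (std 2) g\<^sub>2 (\<lambda>u\<in>std 2. if u = Pt 1 then a else b))
       (modp_cross p X X x y)"

text \<open>\<open>\<C>(k)/\<Sigma>\<^sub>k\<close>, the model for \<open>B\<Sigma>\<^sub>k\<close>\<close>

abbreviation Bsigma :: "'c operad \<Rightarrow> nat \<Rightarrow> 'c set topology" where
  "Bsigma \<C> k \<equiv> orbit_space (sym_group k) (sigma_act \<C> k) (op_space \<C> (std k))"

definition sigma_homology :: "nat \<Rightarrow> 'c operad \<Rightarrow> (nat \<Rightarrow> nat \<Rightarrow> 'c set chain set) monoid" where
  "sigma_homology p \<C> = sum_group UNIV (\<lambda>k. modp_homology p (Bsigma \<C> k))"

text \<open>The map \<open>([c], x) \<mapsto> \<theta>(c; x,\<dots>,x)\<close>; its value does not depend on the representative \<open>c\<close>.\<close>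

definition diagonal_action ::
  "(ix set \<Rightarrow> 'c \<Rightarrow> (ix \<Rightarrow> 'x) \<Rightarrow> 'x) \<Rightarrow> nat \<Rightarrow> 'c set \<times> 'x \<Rightarrow> 'x" where
  "diagonal_action \<theta> k = (\<lambda>(Q, x). the_elem ((\<lambda>c. \<theta> (std k) c (\<lambda>_\<in>std k. x)) ` Q))"

definition homology_action ::
  "nat \<Rightarrow> 'c operad \<Rightarrow> 'x topology \<Rightarrow> (ix set \<Rightarrow> 'c \<Rightarrow> (ix \<Rightarrow> 'x) \<Rightarrow> 'x) \<Rightarrow>
   (nat \<Rightarrow> nat \<Rightarrow> 'c set chain set) \<Rightarrow> (nat \<Rightarrow> 'x chain set) \<Rightarrow> (nat \<Rightarrow> 'x chain set)" where
  "homology_action p \<C> X \<theta> r x =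
     gfinprod (modp_homology p X)
       (\<lambda>k. modp_induced p (kprod (Bsigma \<C> k) X) X (diagonal_action \<theta> k)
              (modp_cross p (Bsigma \<C> k) X (r k) x))
       UNIV"

end

theory Submission
  imports Defs
begin

text \<open>
  On points, distributivity gives
  \<open>\<xi>(g; \<theta>(c; a, \<dots>, a), b) = \<theta>(\<lambda>(g; c, 1); \<xi>(g; a, b), \<dots>, \<xi>(g; a, b))\<close>, so the claim follows once
  \<open>c \<mapsto> \<lambda>(g; c, 1)\<close> is homotopic to the identity as a self-map of \<open>\<C>(k)/\<Sigma>\<^sub>k\<close>. No obstruction theory
  for free actions is needed: the unit of \<open>\<C>\<close> is \<open>\<lambda>(*; ())\<close> with \<open>* \<in> \<G>(\<emptyset>)\<close>, whence
  \<open>\<lambda>(g; c, 1) = \<lambda>(\<gamma>(g; 1, *); c)\<close>, and a path from \<open>\<gamma>(g; 1, *)\<close> to \<open>1\<close> in the contractible space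
  \<open>\<G>(1)\<close> is an equivariant homotopy. The rest is naturality and associativity of the cross product,
  which hold strictly for shuffles of chains.
\<close>

section \<open>Shuffles of vertex lists\<close>

text \<open>As \<open>r\<close>, \<open>x\<close>, \<open>y\<close> keep their order, no interchange
  of factors with its signs arises. Once the cycle for \<open>r\<close> is moved along the homotopy,
  both sides are images of one chain, the triple shuffle product, under maps that agree on points.
  The homotopy is equivariant at every time because the operad action is natural in relabellings of
  \<open>c\<close>, whichever unary operation acts. The obstacle is topological. Shuffle chains live
  in the ordinary product, the structure maps are continuous on k-ified products, and
  \<open>\<C>(k)/\<Sigma>\<^sub>k\<close> carries a quotient topology. Simplices are compact
  Hausdorff, so k-ifying a weak Hausdorff space does not change its singular chains; this is why the
  orbit space must be shown to be weak Hausdorff. Continuity on the orbit space is tested on compact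
  Hausdorff pieces, using that the product with a locally compact Hausdorff factor preserves
  quotient maps.\<close>

definition frag_cons :: "'a \<Rightarrow> ('a list \<Rightarrow>\<^sub>0 int) \<Rightarrow> ('a list \<Rightarrow>\<^sub>0 int)" where
  "frag_cons v = frag_extend (\<lambda>L. frag_of (v # L))"

lemma frag_cons_0 [simp]: "frag_cons v 0 = 0"
  and frag_cons_of [simp]: "frag_cons v (frag_of L) = frag_of (v # L)"
  and frag_cons_add: "frag_cons v (c + d) = frag_cons v c + frag_cons v d"
  and frag_cons_diff: "frag_cons v (c - d) = frag_cons v c - frag_cons v d"
  and frag_cons_cmul: "frag_cons v (frag_cmul k c) = frag_cmul k (frag_cons v c)"
  by (simp_all add: frag_cons_def frag_extend_add frag_extend_diff frag_extend_cmul)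

text \<open>Compatibility with differences is the whole of linearity here:
  \<open>frag_induction\<close> builds every chain from generators by differences, and
  \<open>h 0 = 0\<close> is the instance \<open>0 - 0\<close>.\<close>

lemma frag_extend_linear:
  assumes "\<And>c d. h (c - d) = h c - h d"
  shows "h (frag_extend f c) = frag_extend (\<lambda>x. h (f x)) c"
proof -
  have h0: "h 0 = 0" using assms[of 0 0] by simp
  show ?thesis
    using subset_UNIV
    by (induction c rule: frag_induction) (simp_all add: assms frag_extend_diff h0)
qed

lemma frag_extend_frag_cons: "frag_extend f (frag_cons a c) = frag_extend (\<lambda>L. f (a # L)) c"
  unfolding frag_cons_def
  by (subst frag_extend_linear[of "frag_extend f"]) (simp_all add: frag_extend_diff)

lemma frag_extend_add_fun: "frag_extend (\<lambda>x. f x + g x) c = frag_extend f c + frag_extend g c"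
  using subset_UNIV by (induction c rule: frag_induction) (simp_all add: frag_extend_diff)

lemma frag_extend_cmul_fun: "frag_extend (\<lambda>x. frag_cmul k (f x)) c = frag_cmul k (frag_extend f c)"
  using subset_UNIV
  by (induction c rule: frag_induction)
    (simp_all add: frag_extend_diff poly_mapping_eq_iff lookup_minus fun_eq_iff algebra_simps)

lemma frag_extend_diff_fun: "frag_extend (\<lambda>x. f x - g x) c = frag_extend f c - frag_extend g c"
  using subset_UNIV by (induction c rule: frag_induction) (simp_all add: frag_extend_diff)

lemma frag_extend_zero_fun [simp]: "frag_extend (\<lambda>x. 0) c = 0"
  using subset_UNIV by (induction c rule: frag_induction) (simp_all add: frag_extend_diff)

lemma frag_extend_swap:
  "frag_extend (\<lambda>x. frag_extend (f x) d) c = frag_extend (\<lambda>y. frag_extend (\<lambda>x. f x y) c) d"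
  using subset_UNIV
proof (induction c rule: frag_induction)
  case (diff a b)
  then show ?case by (simp add: frag_extend_diff frag_extend_diff_fun)
qed simp_all

text \<open>
  The shuffles in recursive form, so that the boundary formula and associativity are inductions;
  \<open>shuffles_frag_conv_sum\<close> below is the explicit sum.
\<close>

fun shuffles_frag :: "'a list \<Rightarrow> 'b list \<Rightarrow> ('a \<times> 'b) list \<Rightarrow>\<^sub>0 int" where
  "shuffles_frag (a # as) (b # bs) =
     (if as = [] \<and> bs = [] then frag_of [(a, b)]
      else frag_cons (a, b)
        (shuffles_frag as (b # bs) + frag_cmul ((-1) ^ length as) (shuffles_frag (a # as) bs)))"
| "shuffles_frag [] B = 0"
| "shuffles_frag A [] = 0"

lemma shuffles_frag_Nil2 [simp]: "shuffles_frag A [] = 0"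
  by (cases A) auto

lemma shuffles_frag_Nil1 [simp]: "shuffles_frag [] = (\<lambda>B. 0)"
  by (rule ext) simp

text \<open>Augmented: a single vertex has boundary \<open>[]\<close>.\<close>

fun list_boundary :: "'a list \<Rightarrow> 'a list \<Rightarrow>\<^sub>0 int" where
  "list_boundary [] = 0"
| "list_boundary (a # as) = frag_of as - frag_cons a (list_boundary as)"

section \<open>The Leibniz rule for shuffles\<close>

lemma list_boundary_frag_cons:
  "frag_extend list_boundary (frag_cons a c) = c - frag_cons a (frag_extend list_boundary c)"
  unfolding frag_cons_def using subset_UNIV
  by (induction c rule: frag_induction) (simp_all add: frag_extend_diff frag_cons_def)

lemma list_boundary_conv_sum:
  "list_boundary L = (\<Sum>k<length L. frag_cmul ((-1) ^ k) (frag_of (take k L @ drop (Suc k) L)))"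
proof (induction L)
  case (Cons a L)
  have "frag_cons a (\<Sum>k<length L. frag_cmul ((-1) ^ k) (frag_of (take k L @ drop (Suc k) L))) =
     (\<Sum>k<length L. frag_cmul ((-1) ^ k) (frag_of (a # take k L @ drop (Suc k) L)))"
    by (simp add: frag_cons_def frag_extend_sum o_def frag_extend_cmul)
  then show ?case
    by (simp add: Cons sum.lessThan_Suc_shift sum_negf[symmetric] del: sum.lessThan_Suc)
qed simp

text \<open>The side condition keeps every \<open>b # L\<close> away from the base case of the
  recursion, where both tails are empty: there the value is \<open>[(a, b)]\<close>, while the
  recursive formula would give 0.\<close>

lemma shuffles_frag_cons_right:
  "frag_extend (shuffles_frag (a # as)) (frag_cons b c) =
     (frag_cons (a, b) (frag_extend (\<lambda>B. shuffles_frag as (b # B)) c +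
       frag_cmul ((-1) ^ length as) (frag_extend (shuffles_frag (a # as)) c)))"
  if "as \<noteq> [] \<or> [] \<notin> Poly_Mapping.keys c"
proof -
  have "frag_extend (shuffles_frag (a # as)) (frag_cons b c) = frag_extend (\<lambda>L. shuffles_frag (a # as) (b # L)) c"
    by (rule frag_extend_frag_cons)
  also have "\<dots> = frag_extend (\<lambda>L. frag_cons (a, b) (shuffles_frag as (b # L) +
        frag_cmul ((-1) ^ length as) (shuffles_frag (a # as) L))) c"
    by (rule frag_extend_eq) (use that in auto)
  also have "\<dots> = frag_cons (a, b) (frag_extend (\<lambda>L. shuffles_frag as (b # L) +
        frag_cmul ((-1) ^ length as) (shuffles_frag (a # as) L)) c)"
    by (rule frag_extend_linear[symmetric]) (simp add: frag_cons_diff)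
  finally show ?thesis by (simp add: frag_extend_add_fun frag_extend_cmul_fun)
qed

text \<open>The recursive sign depends on the length of the first list. It can be pulled out of the
  sum only if all lists in \<open>c\<close> have one common length \<open>n\<close>.\<close>

lemma shuffles_frag_cons_left:
  assumes "bs \<noteq> [] \<or> [] \<notin> Poly_Mapping.keys c"
    and "\<And>L. L \<in> Poly_Mapping.keys c \<Longrightarrow> length L = n"
  shows "frag_extend (\<lambda>A. shuffles_frag A (b # bs)) (frag_cons a c) =
     (frag_cons (a, b) (frag_extend (\<lambda>A. shuffles_frag A (b # bs)) c +
       frag_cmul ((-1) ^ n) (frag_extend (\<lambda>A. shuffles_frag (a # A) bs) c)))"
proof -
  have "frag_extend (\<lambda>A. shuffles_frag A (b # bs)) (frag_cons a c) = frag_extend (\<lambda>L. shuffles_frag (a # L) (b # bs)) c"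
    by (rule frag_extend_frag_cons)
  also have "\<dots> = frag_extend (\<lambda>L. frag_cons (a, b) (shuffles_frag L (b # bs) +
        frag_cmul ((-1) ^ n) (shuffles_frag (a # L) bs))) c"
    by (rule frag_extend_eq) (use assms in auto)
  also have "\<dots> = frag_cons (a, b) (frag_extend (\<lambda>L. shuffles_frag L (b # bs) +
        frag_cmul ((-1) ^ n) (shuffles_frag (a # L) bs)) c)"
    by (rule frag_extend_linear[symmetric]) (simp add: frag_cons_diff)
  finally show ?thesis by (simp add: frag_extend_add_fun frag_extend_cmul_fun)
qed

lemma keys_frag_cons: "Poly_Mapping.keys (frag_cons a c) \<subseteq> (#) a ` Poly_Mapping.keys c"
  using keys_frag_extend[of "\<lambda>L. frag_of (a # L)" c] by (auto simp: frag_cons_def)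

lemma length_keys_list_boundary:
  "L \<in> Poly_Mapping.keys (list_boundary A) \<Longrightarrow> Suc (length L) = length A"
proof (induction A arbitrary: L)
  case (Cons a A)
  then have "L = A \<or> L \<in> (#) a ` Poly_Mapping.keys (list_boundary A)"
    using keys_diff[of "frag_of A" "frag_cons a (list_boundary A)"]
    using keys_frag_cons[of a "list_boundary A"] by auto
  then show ?case using Cons.IH by auto
qed simp

text \<open>Deleting the first vertex \<open>(a, b)\<close> leaves the shuffles of \<open>as\<close>
  with \<open>b # bs\<close> and of \<open>a # as\<close> with \<open>bs\<close>, which are the
  faces at \<open>a\<close> and at \<open>b\<close>; the other faces follow by induction. Two single
  vertices are excluded because the augmented boundary of \<open>[(a, b)]\<close> is
  \<open>[]\<close>, whereas both terms on the right vanish.\<close>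

lemma list_boundary_shuffles_frag:
  assumes "length A + length B > 2"
  shows "frag_extend list_boundary (shuffles_frag A B) =
     frag_extend (\<lambda>A. shuffles_frag A B) (list_boundary A) +
     frag_cmul ((-1) ^ (length A - 1)) (frag_extend (shuffles_frag A) (list_boundary B))"
  using assms
proof (induction A B rule: shuffles_frag.induct)
  case (1 a as b bs)
  let ?s = "(-1 :: int) ^ length as"
  consider "as = []" "bs \<noteq> []" | "as \<noteq> []" "bs = []" | "as \<noteq> []" "bs \<noteq> []" using 1(3) by fastforce
  then show ?case
  proof cases
    case 1
    show ?thesis
    \<comment> \<open>A tail with one vertex has boundary \<open>[]\<close>, which violates the side
      condition of \<open>shuffles_frag_cons_right\<close>, so this instance is computed
      outright.\<close>
    proof (cases "length bs = 1")
      case True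
      then obtain b' where "bs = [b']" by (auto simp: length_Suc_conv)
      then show ?thesis using \<open>as = []\<close> by (simp add: frag_extend_diff)
    next
      case False
      then have bs: "[] \<notin> Poly_Mapping.keys (list_boundary bs)" "length bs \<ge> 2"
        using \<open>bs \<noteq> []\<close> by (auto dest: length_keys_list_boundary simp: Suc_le_eq neq_Nil_conv)
      then have IH: "frag_extend list_boundary (shuffles_frag [a] bs) =
          frag_extend (shuffles_frag [a]) (list_boundary bs)"
        using "1.IH"(2) 1 by auto
      have r: "frag_extend (shuffles_frag [a]) (frag_cons b (list_boundary bs)) =
         frag_cons (a, b) (frag_extend (shuffles_frag [a]) (list_boundary bs))"
        using shuffles_frag_cons_right[of "[]" "list_boundary bs" a b] bs by simp
      show ?thesis using 1 r IH by (simp add: list_boundary_frag_cons frag_extend_diff)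
    qed
  next
    case 2
    show ?thesis
    proof (cases "length as = 1")
      case True
      then obtain a' where "as = [a']" by (auto simp: length_Suc_conv)
      then show ?thesis using \<open>bs = []\<close> by (simp add: frag_extend_diff)
    next
      case False
      then have as: "[] \<notin> Poly_Mapping.keys (list_boundary as)" "length as \<ge> 2"
        using \<open>as \<noteq> []\<close> by (auto dest: length_keys_list_boundary simp: Suc_le_eq neq_Nil_conv)
      then have IH: "frag_extend list_boundary (shuffles_frag as [b]) =
          frag_extend (\<lambda>A. shuffles_frag A [b]) (list_boundary as)"
        using "1.IH"(1) 2 by auto
      have l: "frag_extend (\<lambda>A. shuffles_frag A [b]) (frag_cons a (list_boundary as)) =
         frag_cons (a, b) (frag_extend (\<lambda>A. shuffles_frag A [b]) (list_boundary as))"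
      proof -
        have "length L = length as - 1" if "L \<in> Poly_Mapping.keys (list_boundary as)" for L
          using length_keys_list_boundary[OF that] by simp
        then show ?thesis
          using shuffles_frag_cons_left[of "[]" "list_boundary as" "length as - 1" b a] as by simp
      qed
      show ?thesis using 2 l IH by (simp add: list_boundary_frag_cons frag_extend_diff)
    qed
  next
    case 3
    have IH: "frag_extend list_boundary (shuffles_frag as (b # bs)) =
      frag_extend (\<lambda>A. shuffles_frag A (b # bs)) (list_boundary as) +
      frag_cmul ((- 1) ^ (length as - 1)) (frag_extend (shuffles_frag as) (list_boundary (b # bs)))"
      "frag_extend list_boundary (shuffles_frag (a # as) bs) =
      frag_extend (\<lambda>A. shuffles_frag A bs) (list_boundary (a # as)) +
      frag_cmul ?s (frag_extend (shuffles_frag (a # as)) (list_boundary bs))"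
      using 1 3 by (auto simp add: neq_Nil_conv)
    have r: "frag_extend (shuffles_frag (a # as)) (frag_cons b (list_boundary bs)) =
       frag_cons (a, b) (frag_extend (\<lambda>B. shuffles_frag as (b # B)) (list_boundary bs) +
       frag_cmul ?s (frag_extend (shuffles_frag (a # as)) (list_boundary bs)))"
      by (rule shuffles_frag_cons_right) (use 3 in auto)
    have l: "frag_extend (\<lambda>A. shuffles_frag A (b # bs)) (frag_cons a (list_boundary as)) =
     (frag_cons (a, b) (frag_extend (\<lambda>A. shuffles_frag A (b # bs)) (list_boundary as) +
       frag_cmul ((-1) ^ (length as - 1)) (frag_extend (\<lambda>A. shuffles_frag (a # A) bs) (list_boundary as))))"
      by (rule shuffles_frag_cons_left) (use 3 in \<open>auto dest: length_keys_list_boundary\<close>)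
    \<comment> \<open>The shuffles of \<open>as\<close> with \<open>bs\<close> arise twice, by
      deleting \<open>a\<close> and then \<open>b\<close> or in the other order; this sign makes the
      two copies cancel.\<close>
    have s: "?s = - ((-1) ^ (length as - 1))" using 3 by (cases as) auto
    have r': "frag_extend (\<lambda>B. shuffles_frag as (b # B)) (list_boundary bs) =
        frag_extend (shuffles_frag as) (frag_cons b (list_boundary bs))"
      by (rule frag_extend_frag_cons[symmetric])
    have l': "frag_extend (\<lambda>A. shuffles_frag (a # A) bs) (list_boundary as) =
        frag_extend (\<lambda>A. shuffles_frag A bs) (frag_cons a (list_boundary as))"
      by (rule frag_extend_frag_cons[symmetric])
    have U: "frag_extend list_boundary (shuffles_frag (a # as) (b # bs)) =
       shuffles_frag as (b # bs) + frag_cmul ?s (shuffles_frag (a # as) bs) -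
       frag_cons (a, b) (frag_extend list_boundary (shuffles_frag as (b # bs)) +
         frag_cmul ?s (frag_extend list_boundary (shuffles_frag (a # as) bs)))"
      using 3 by (simp add: list_boundary_frag_cons frag_extend_add frag_extend_cmul)
    show ?thesis
      unfolding U IH list_boundary.simps
      by (simp add: frag_extend_diff r l r' l' s)
        (simp add: frag_cons_add frag_cons_diff frag_cons_cmul frag_cmul_distrib2 poly_mapping_eq_iff fun_eq_iff
          lookup_minus lookup_add algebra_simps)
  qed
qed simp_all

section \<open>Length, naturality and associativity of shuffles\<close>

lemma length_keys_shuffles_frag:
  "P \<in> Poly_Mapping.keys (shuffles_frag A B) \<Longrightarrow> Suc (length P) = length A + length B"
proof (induction A B arbitrary: P rule: shuffles_frag.induct)
  case (1 a as b bs)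
  show ?case
  proof (cases "as = [] \<and> bs = []")
    case True then show ?thesis using 1 by simp
  next
    case False
    let ?u = "shuffles_frag as (b # bs)" and ?v = "shuffles_frag (a # as) bs"
    have "P \<in> (#) (a, b) ` Poly_Mapping.keys (?u + frag_cmul ((-1) ^ length as) ?v)"
      using 1(3) False subsetD[OF keys_frag_cons] by (auto split: if_splits)
    then obtain Q where Q: "P = (a, b) # Q" "Q \<in> Poly_Mapping.keys ?u \<or> Q \<in> Poly_Mapping.keys ?v"
      using keys_add[of ?u "frag_cmul ((-1) ^ length as) ?v"] by auto
    then show ?thesis using 1(1,2)[OF False, of Q] by auto
  qed
qed auto

lemma shuffles_frag_map:
  "shuffles_frag (map f A) (map g B) =
     frag_extend (\<lambda>P. frag_of (map (map_prod f g) P)) (shuffles_frag A B)"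
proof (induction A B rule: shuffles_frag.induct)
  case (1 a as b bs)
  have "frag_extend (\<lambda>P. frag_of (map (map_prod f g) P)) (frag_cons (a, b) c) =
      frag_cons (f a, g b) (frag_extend (\<lambda>P. frag_of (map (map_prod f g) P)) c)" for c
    unfolding frag_cons_def using subset_UNIV
    by (induction c rule: frag_induction) (simp_all add: frag_extend_diff)
  then show ?case using 1 by (auto simp: frag_extend_add frag_extend_cmul)
qed auto

text \<open>A lattice path in three directions leaves its first vertex along \<open>as\<close>,
  \<open>bs\<close> or \<open>ds\<close>, and the sign counts the steps still to come in the earlier
  directions. The other bracketing unfolds to the same three terms.\<close>

lemma shuffles_frag_right_nested_Cons:
  assumes "as \<noteq> [] \<or> bs \<noteq> [] \<or> ds \<noteq> []"
  shows "frag_extend (shuffles_frag (a # as)) (shuffles_frag (b # bs) (d # ds)) =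
    frag_cons (a, b, d)
      (frag_extend (shuffles_frag as) (shuffles_frag (b # bs) (d # ds)) +
       frag_cmul ((-1) ^ length as) (frag_extend (shuffles_frag (a # as)) (shuffles_frag bs (d # ds))) +
       frag_cmul ((-1) ^ (length as + length bs))
         (frag_extend (shuffles_frag (a # as)) (shuffles_frag (b # bs) ds)))"
proof (cases "bs = [] \<and> ds = []")
  case True
  then show ?thesis using assms by simp
next
  case False
  define M where "M = shuffles_frag bs (d # ds) + frag_cmul ((-1) ^ length bs) (shuffles_frag (b # bs) ds)"
  have M: "shuffles_frag (b # bs) (d # ds) = frag_cons (b, d) M" using False by (auto simp: M_def)
  have "[] \<notin> Poly_Mapping.keys M"
    using False keys_add[of "shuffles_frag bs (d # ds)" "frag_cmul ((-1) ^ length bs) (shuffles_frag (b # bs) ds)"]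
    by (auto simp: M_def dest!: length_keys_shuffles_frag)
  then have "frag_extend (shuffles_frag (a # as)) (frag_cons (b, d) M) =
     frag_cons (a, b, d) (frag_extend (\<lambda>L. shuffles_frag as ((b, d) # L)) M +
       frag_cmul ((-1) ^ length as) (frag_extend (shuffles_frag (a # as)) M))"
    by (intro shuffles_frag_cons_right) blast
  moreover have "frag_extend (\<lambda>L. shuffles_frag as ((b, d) # L)) M =
      frag_extend (shuffles_frag as) (frag_cons (b, d) M)"
    by (rule frag_extend_frag_cons[symmetric])
  moreover have "frag_extend (shuffles_frag (a # as)) M = frag_extend (shuffles_frag (a # as)) (shuffles_frag bs (d # ds)) +
      frag_cmul ((-1) ^ length bs) (frag_extend (shuffles_frag (a # as)) (shuffles_frag (b # bs) ds))"
    by (simp add: M_def frag_extend_add frag_extend_cmul)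
  ultimately show ?thesis
    unfolding M by (simp add: frag_cmul_distrib2 power_add ac_simps)
qed

lemma shuffles_frag_left_nested_Cons:
  assumes "as \<noteq> [] \<or> bs \<noteq> [] \<or> ds \<noteq> []"
  shows "frag_extend (\<lambda>P. shuffles_frag P (d # ds)) (shuffles_frag (a # as) (b # bs)) =
    frag_cons ((a, b), d)
      (frag_extend (\<lambda>P. shuffles_frag P (d # ds)) (shuffles_frag as (b # bs)) +
       frag_cmul ((-1) ^ length as) (frag_extend (\<lambda>P. shuffles_frag P (d # ds)) (shuffles_frag (a # as) bs)) +
       frag_cmul ((-1) ^ (length as + length bs))
         (frag_extend (\<lambda>P. shuffles_frag P ds) (shuffles_frag (a # as) (b # bs))))"
proof (cases "as = [] \<and> bs = []")
  case True
  then show ?thesis using assms by simp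
next
  case False
  define N where "N = shuffles_frag as (b # bs) + frag_cmul ((-1) ^ length as) (shuffles_frag (a # as) bs)"
  have N: "shuffles_frag (a # as) (b # bs) = frag_cons (a, b) N" using False by (auto simp: N_def)
  \<comment> \<open>All paths in \<open>N\<close> have the same number of vertices, so that
    \<open>shuffles_frag_cons_left\<close> meets a single sign.\<close>
  have len: "length L = length as + length bs" if "L \<in> Poly_Mapping.keys N" for L
    using that keys_add[of "shuffles_frag as (b # bs)" "frag_cmul ((-1) ^ length as) (shuffles_frag (a # as) bs)"]
    by (auto simp: N_def dest!: length_keys_shuffles_frag)
  then have "[] \<notin> Poly_Mapping.keys N" using False by fastforce
  with len have "frag_extend (\<lambda>P. shuffles_frag P (d # ds)) (frag_cons (a, b) N) =
     frag_cons ((a, b), d) (frag_extend (\<lambda>P. shuffles_frag P (d # ds)) N +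
       frag_cmul ((-1) ^ (length as + length bs)) (frag_extend (\<lambda>P. shuffles_frag ((a, b) # P) ds) N))"
    by (intro shuffles_frag_cons_left) blast+
  moreover have "frag_extend (\<lambda>P. shuffles_frag ((a, b) # P) ds) N =
      frag_extend (\<lambda>P. shuffles_frag P ds) (frag_cons (a, b) N)"
    by (rule frag_extend_frag_cons[symmetric])
  moreover have "frag_extend (\<lambda>P. shuffles_frag P (d # ds)) N =
      frag_extend (\<lambda>P. shuffles_frag P (d # ds)) (shuffles_frag as (b # bs)) +
      frag_cmul ((-1) ^ length as) (frag_extend (\<lambda>P. shuffles_frag P (d # ds)) (shuffles_frag (a # as) bs))"
    by (simp add: N_def frag_extend_add frag_extend_cmul)
  ultimately show ?thesis
    unfolding N by simp
qed

text \<open>Both bracketings obey the same three-term recursion. Each term shortens a different one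
  of the three lists, hence induction on the total length.\<close>

lemma shuffles_frag_assoc:
  "frag_extend (\<lambda>P. frag_of (map (\<lambda>((a, b), d). (a, b, d)) P))
     (frag_extend (\<lambda>P. shuffles_frag P D) (shuffles_frag A B)) =
   frag_extend (shuffles_frag A) (shuffles_frag B D)"
proof (induction "length A + length B + length D" arbitrary: A B D rule: less_induct)
  case less
  let ?f = "\<lambda>((a, b), d). (a, b, d)"
  let ?F = "frag_extend (\<lambda>P. frag_of (map ?f P))"
  have cons: "?F (frag_cons x c) = frag_cons (?f x) (?F c)" for x :: "('a \<times> 'b) \<times> 'c" and c
    unfolding frag_cons_def using subset_UNIV
    by (induction c rule: frag_induction) (simp_all add: frag_extend_diff)
  show ?case
  proof (cases "A = [] \<or> B = [] \<or> D = []")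
    case True
    then show ?thesis by auto
  next
    case False
    then obtain a as b bs d ds where eq: "A = a # as" "B = b # bs" "D = d # ds"
      by (meson neq_Nil_conv)
    show ?thesis
    proof (cases "as = [] \<and> bs = [] \<and> ds = []")
      case True then show ?thesis by (simp add: eq)
    next
      case False
      then have ne: "as \<noteq> [] \<or> bs \<noteq> [] \<or> ds \<noteq> []" by blast
      show ?thesis
        unfolding eq shuffles_frag_left_nested_Cons[OF ne] shuffles_frag_right_nested_Cons[OF ne]
        using less[of as "b # bs" "d # ds"] less[of "a # as" bs "d # ds"] less[of "a # as" "b # bs" ds]
        by (simp only: cons frag_extend_add frag_extend_cmul eq) simp
    qed
  qed
qed

section \<open>Lattice paths as subsets, and the explicit shuffle sum\<close>

lemma sum_subsets_Suc:
  fixes f :: "nat set \<Rightarrow> 'b::comm_monoid_add"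
  shows "(\<Sum>S | S \<subseteq> {..<Suc n} \<and> card S = k. f S) =
     (if k = 0 then 0 else \<Sum>S | S \<subseteq> {..<n} \<and> card S = k - 1. f (insert 0 (Suc ` S))) +
     (\<Sum>S | S \<subseteq> {..<n} \<and> card S = k. f (Suc ` S))"
proof -
  let ?F = "\<lambda>n k. {S. S \<subseteq> {..<n} \<and> card S = k}"
  have fin: "finite S" if "S \<subseteq> {..<n}" for S and n :: nat
    using finite_subset[OF that] by simp
  have finF: "finite (?F n k)" for n k :: nat by (rule finite_subset[of _ "Pow {..<n}"]) auto
  \<comment> \<open>\<open>?A\<close> collects the paths whose first step goes in the first
    direction, \<open>?B\<close> the others. The case \<open>k = 0\<close> is split off because
    \<open>k - 1\<close> would truncate to 0.\<close>
  let ?A = "if k = 0 then {} else (\<lambda>S. insert 0 (Suc ` S)) ` ?F n (k - 1)"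
  let ?B = "image Suc ` ?F n k"
  have card: "card (insert 0 (Suc ` S)) = Suc (card S)" if "S \<subseteq> {..<n}" for S
    using fin[OF that] by (subst card_insert_disjoint) (auto simp: card_image)
  have "?F (Suc n) k = ?A \<union> ?B"
  proof (intro equalityI subsetI)
    fix S assume S: "S \<in> ?F (Suc n) k"
    define T where "T = {t. Suc t \<in> S}"
    have T: "T \<subseteq> {..<n}" using S by (auto simp: T_def)
    show "S \<in> ?A \<union> ?B"
    proof (cases "0 \<in> S")
      case True
      then have eq: "S = insert 0 (Suc ` T)"
        by (auto simp: T_def image_iff) (metis not0_implies_Suc)
      then have "k = Suc (card T)" using S card[OF T] by simp
      then show ?thesis using eq T by auto
    next
      case False
      then have eq: "S = Suc ` T"
        by (auto simp: T_def image_iff) (metis not0_implies_Suc)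
      then have "k = card T" using S by (simp add: card_image)
      then show ?thesis using eq T by auto
    qed
  next
    fix S assume "S \<in> ?A \<union> ?B"
    then show "S \<in> ?F (Suc n) k" by (auto simp: card card_image split: if_splits)
  qed
  moreover have "?A \<inter> ?B = {}" by auto
  ultimately have "sum f (?F (Suc n) k) = sum f ?A + sum f ?B"
    using finF by (simp add: sum.union_disjoint)
  also have "sum f ?A = (if k = 0 then 0 else \<Sum>S\<in>?F n (k-1). f (insert 0 (Suc ` S)))"
  proof -
    have "inj_on (\<lambda>S. insert 0 (Suc ` S)) (?F n (k-1))"
      by (rule inj_onI) (metis (no_types, lifting) Suc_inject Suc_neq_Zero imageE image_insert insertE insert_ident inj_image_eq_iff inj_Suc)
    then show ?thesis by (simp add: sum.reindex)
  qed
  also have "sum f ?B = (\<Sum>S\<in>?F n k. f (Suc ` S))"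
    by (subst sum.reindex) (auto intro!: inj_onI simp: inj_image_eq_iff)
  finally show ?thesis .
qed

text \<open>A first step in the second direction precedes each of the \<open>card S\<close> steps in
  the first direction and so adds \<open>card S\<close> inversions.\<close>

lemma shuffle_sign_Suc_image:
  assumes "S \<subseteq> {..<n}"
  shows "shuffle_sign (Suc n) (Suc ` S) = (-1) ^ card S * shuffle_sign n S"
proof -
  have fin: "finite S" using finite_subset[OF assms] by simp
  let ?I = "{(s, t). s \<in> S \<and> t \<in> {..<n} - S \<and> t < s}"
  have "{(s, t). s \<in> Suc ` S \<and> t \<in> {..<Suc n} - Suc ` S \<and> t < s} = map_prod Suc Suc ` ?I \<union> Suc ` S \<times> {0}"
    (is "?L = ?R")
  proof (intro equalityI subsetI)
    fix z assume "z \<in> ?L"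
    then obtain s t where z: "z = (Suc s, t)" "s \<in> S" "t \<notin> Suc ` S" "t < Suc n" "t < Suc s" by auto
    then show "z \<in> ?R" by (cases t) (auto simp: image_iff)
  qed (use assms in auto)
  moreover have "finite ?I" by (rule finite_subset[of _ "S \<times> {..<n}"]) (use fin in auto)
  moreover have "card (map_prod Suc Suc ` ?I) = card ?I"
    by (rule card_image) (auto simp: inj_on_def)
  ultimately have "card {(s, t). s \<in> Suc ` S \<and> t \<in> {..<Suc n} - Suc ` S \<and> t < s} = card ?I + card S"
    using fin card_Un_disjoint[of "map_prod Suc Suc ` ?I" "Suc ` S \<times> {0}"]
    by (force simp: card_cartesian_product card_image)
  then show ?thesis by (simp add: shuffle_sign_def power_add)
qed

text \<open>A step in the first direction at time 0 has nothing before it, so no inversion is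
  added.\<close>

lemma shuffle_sign_insert_0:
  assumes "S \<subseteq> {..<n}"
  shows "shuffle_sign (Suc n) (insert 0 (Suc ` S)) = shuffle_sign n S"
proof -
  let ?I = "{(s, t). s \<in> S \<and> t \<in> {..<n} - S \<and> t < s}"
  have "{(s, t). s \<in> insert 0 (Suc ` S) \<and> t \<in> {..<Suc n} - insert 0 (Suc ` S) \<and> t < s} = map_prod Suc Suc ` ?I"
    (is "?L = ?R")
  proof (intro equalityI subsetI)
    fix z assume "z \<in> ?L"
    then obtain s t where z: "z = (s, t)" "s \<in> insert 0 (Suc ` S)" "t \<notin> Suc ` S" "0 < t" "t < Suc n" "t < s" by auto
    then show "z \<in> ?R" by (cases t) (auto simp: image_iff)
  qed (use assms in auto)
  moreover have "card (map_prod Suc Suc ` ?I) = card ?I"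
    by (rule card_image) (auto simp: inj_on_def)
  ultimately show ?thesis by (simp add: shuffle_sign_def)
qed

text \<open>Splitting the paths by their first step turns the explicit sum into the recursion. The
  recursive sign is that of \<open>shuffle_sign_Suc_image\<close>, as
  \<open>card S = length as\<close> for the paths concerned.\<close>

lemma shuffles_frag_conv_sum:
  assumes "A \<noteq> []" "B \<noteq> []" "n = length A + length B - 2"
  shows "shuffles_frag A B =
    (\<Sum>S | S \<subseteq> {..<n} \<and> card S = length A - 1. frag_cmul (shuffle_sign n S)
       (frag_of (map (\<lambda>t. (A ! card (S \<inter> {..<t}), B ! card ({..<t} - S))) [0..<Suc n])))"
  using assms
proof (induction A B arbitrary: n rule: shuffles_frag.induct)
  case (1 a as b bs)
  show ?case
  proof (cases "as = [] \<and> bs = []")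
    case True
    then have "{S. S \<subseteq> {..<n} \<and> card S = 0} = {{}}" using 1 by auto
    then show ?thesis using True 1 by (simp add: shuffle_sign_def)
  next
    case False
    then obtain m where n: "n = Suc m" and m: "Suc m = length as + length bs"
      using 1(5) by (cases n) auto
    have map: "map f [0..<Suc (Suc m)] = f 0 # map (\<lambda>t. f (Suc t)) [0..<Suc m]" for f :: "nat \<Rightarrow> 'a \<times> 'b"
      by (simp only: map_upt_Suc)
    have fin: "finite S" if "S \<subseteq> {..<m}" for S using finite_subset[OF that] by simp
    \<comment> \<open>\<open>c1\<close> to \<open>c4\<close> compare vertex coordinates before and
      after removal of the first step: the coordinate in its direction drops by one, the other is
      unchanged.\<close>
    have c1: "card (Suc ` S \<inter> {..<Suc t}) = card (S \<inter> {..<t})" for S t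
    proof -
      have "Suc ` S \<inter> {..<Suc t} = Suc ` (S \<inter> {..<t})" by auto
      then show ?thesis by (simp add: card_image)
    qed
    have c2: "card ({..<Suc t} - Suc ` S) = Suc (card ({..<t} - S))" for S t
    proof -
      have "{..<Suc t} - Suc ` S = insert 0 (Suc ` ({..<t} - S))"
      proof (rule Set.set_eqI)
        show "x \<in> {..<Suc t} - Suc ` S \<longleftrightarrow> x \<in> insert 0 (Suc ` ({..<t} - S))" for x
          by (cases x) auto
      qed
      then show ?thesis by (simp add: card_image)
    qed
    have c3: "card (insert 0 (Suc ` S) \<inter> {..<Suc t}) = Suc (card (S \<inter> {..<t}))" for S t
    proof -
      have "insert 0 (Suc ` S) \<inter> {..<Suc t} = insert 0 (Suc ` (S \<inter> {..<t}))" by auto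
      then show ?thesis by (simp add: card_image)
    qed
    have c4: "card ({..<Suc t} - insert 0 (Suc ` S)) = card ({..<t} - S)" for S t
    proof -
      have "{..<Suc t} - insert 0 (Suc ` S) = Suc ` ({..<t} - S)"
      proof (rule Set.set_eqI)
        show "x \<in> {..<Suc t} - insert 0 (Suc ` S) \<longleftrightarrow> x \<in> Suc ` ({..<t} - S)" for x
          by (cases x) auto
      qed
      then show ?thesis by (simp add: card_image)
    qed
    have h: "frag_cons (a, b) (shuffles_frag as (b # bs)) =
      (if length as = 0 then 0 else \<Sum>S | S \<subseteq> {..<m} \<and> card S = length as - 1.
         frag_cmul (shuffle_sign n (insert 0 (Suc ` S)))
           (frag_of (map (\<lambda>t. ((a # as) ! card (insert 0 (Suc ` S) \<inter> {..<t}), (b # bs) ! card ({..<t} - insert 0 (Suc ` S)))) [0..<Suc n])))"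
    proof (cases "as = []")
      case False
      have IH: "shuffles_frag as (b # bs) =
          (\<Sum>S | S \<subseteq> {..<m} \<and> card S = length as - 1. frag_cmul (shuffle_sign m S)
           (frag_of (map (\<lambda>t. (as ! card (S \<inter> {..<t}), (b # bs) ! card ({..<t} - S))) [0..<Suc m])))"
        by (rule 1(1)) (use False \<open>\<not> (as = [] \<and> bs = [])\<close> m in auto)
      show ?thesis
        unfolding IH n map c3 c4
        using False by (auto simp: frag_cons_def frag_extend_sum frag_extend_cmul shuffle_sign_insert_0 intro!: sum.cong)
    qed simp
    have v: "frag_cons (a, b) (frag_cmul ((-1) ^ length as) (shuffles_frag (a # as) bs)) =
      (\<Sum>S | S \<subseteq> {..<m} \<and> card S = length as.
         frag_cmul (shuffle_sign n (Suc ` S))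
           (frag_of (map (\<lambda>t. ((a # as) ! card (Suc ` S \<inter> {..<t}), (b # bs) ! card ({..<t} - Suc ` S))) [0..<Suc n])))"
    proof (cases "bs = []")
      case True
      \<comment> \<open>Here \<open>m < length as\<close>, so no subset of \<open>{..<m}\<close> is
        large enough, in agreement with \<open>shuffles_frag A [] = 0\<close>.\<close>
      then have "{S. S \<subseteq> {..<m} \<and> card S = length as} = {}"
      proof (intro equals0I)
        fix S assume S: "S \<in> {S. S \<subseteq> {..<m} \<and> card S = length as}"
        then have "S \<subseteq> {..<m}" by blast
        from card_mono[OF finite_lessThan this] S m True show False by simp
      qed
      then show ?thesis using True by (simp only: sum.empty) simp
    next
      case False
      have IH: "shuffles_frag (a # as) bs =
          (\<Sum>S | S \<subseteq> {..<m} \<and> card S = length (a # as) - 1. frag_cmul (shuffle_sign m S)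
           (frag_of (map (\<lambda>t. ((a # as) ! card (S \<inter> {..<t}), bs ! card ({..<t} - S))) [0..<Suc m])))"
        by (rule 1(2)) (use False \<open>\<not> (as = [] \<and> bs = [])\<close> m in auto)
      show ?thesis
        unfolding IH n map c1 c2
        using False by (auto simp: frag_cons_def frag_extend_sum frag_extend_cmul frag_cmul_sum shuffle_sign_Suc_image intro!: sum.cong)
    qed
    have "shuffles_frag (a # as) (b # bs) = frag_cons (a, b) (shuffles_frag as (b # bs)) +
        frag_cons (a, b) (frag_cmul ((-1) ^ length as) (shuffles_frag (a # as) bs))"
      using False by (auto simp: frag_cons_add)
    then show ?thesis
      unfolding h v n sum_subsets_Suc by simp
  qed
qed auto

section \<open>The shuffle cross product\<close>

lemma set_keys_shuffles_frag:
  "P \<in> Poly_Mapping.keys (shuffles_frag A B) \<Longrightarrow> set P \<subseteq> set A \<times> set B"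
proof (induction A B arbitrary: P rule: shuffles_frag.induct)
  case (1 a as b bs)
  show ?case
  proof (cases "as = [] \<and> bs = []")
    case True then show ?thesis using 1 by simp
  next
    case False
    let ?u = "shuffles_frag as (b # bs)" and ?v = "shuffles_frag (a # as) bs"
    have "P \<in> (#) (a, b) ` Poly_Mapping.keys (?u + frag_cmul ((-1) ^ length as) ?v)"
      using 1(3) False subsetD[OF keys_frag_cons] by (auto split: if_splits)
    then obtain Q where Q: "P = (a, b) # Q" "Q \<in> Poly_Mapping.keys ?u \<or> Q \<in> Poly_Mapping.keys ?v"
      using keys_add[of ?u "frag_cmul ((-1) ^ length as) ?v"] by auto
    from Q(2) 1(1)[OF False, of Q] 1(2)[OF False, of Q] have "set Q \<subseteq> set (a # as) \<times> set (b # bs)"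
      by auto
    then show ?thesis using Q(1) by simp
  qed
qed auto

section \<open>Affine maps between standard simplices given on vertices\<close>

lemma collapse_simplex_apply:
  "x \<in> standard_simplex n \<Longrightarrow> collapse_simplex n v x k = (\<Sum>t\<le>n. if k = v t then x t else 0)"
  by (simp add: collapse_simplex_def oriented_simplex_def if_distrib[of "\<lambda>u. u * _"] cong: if_cong)

lemma collapse_simplex_cong:
  "(\<And>t. t \<le> n \<Longrightarrow> v t = w t) \<Longrightarrow> collapse_simplex n v = collapse_simplex n w"
  unfolding collapse_simplex_def oriented_simplex_eq by simp

lemma collapse_simplex_id:
  assumes "x \<in> standard_simplex n" "\<And>t. t \<le> n \<Longrightarrow> v t = t"
  shows "collapse_simplex n v x = x"
proof
  fix k
  have "collapse_simplex n v x k = (\<Sum>t\<le>n. if k = t then x t else 0)"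
    unfolding collapse_simplex_apply[OF assms(1)] by (rule sum.cong) (use assms(2) in auto)
  also have "\<dots> = x k" using assms(1) by (auto simp: standard_simplex_def)
  finally show "collapse_simplex n v x k = x k" .
qed

lemma simplicial_simplex_collapse:
  assumes "\<And>t. t \<le> n \<Longrightarrow> v t \<le> m"
  shows "simplicial_simplex n (standard_simplex m) (collapse_simplex n v)"
  unfolding collapse_simplex_def simplicial_simplex_oriented_simplex
proof (clarsimp simp: if_distrib[of "\<lambda>u. u * _"] cong: if_cong)
  fix x assume x: "x \<in> standard_simplex n"
  have nn: "(if i = v t then x t else 0) \<ge> 0" for i t using x by (simp add: standard_simplex_def)
  have le: "(\<Sum>t\<le>n. if i = v t then x t else 0) \<le> 1" for i
  proof -
    have "(\<Sum>t\<le>n. if i = v t then x t else 0) \<le> (\<Sum>t\<le>n. x t)"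
      by (rule sum_mono) (use x in \<open>auto simp: standard_simplex_def\<close>)
    then show ?thesis using x by (simp add: standard_simplex_def)
  qed
  have "(\<Sum>i\<le>m. \<Sum>t\<le>n. if i = v t then x t else 0) = (\<Sum>t\<le>n. \<Sum>i\<le>m. if i = v t then x t else 0)"
    by (rule sum.swap)
  also have "\<dots> = (\<Sum>t\<le>n. x t)" using assms by (intro sum.cong) auto
  finally have "(\<Sum>i\<le>m. \<Sum>t\<le>n. if i = v t then x t else 0) = 1" using x by (simp add: standard_simplex_def)
  moreover have "(\<Sum>t\<le>n. if i = v t then x t else 0) = 0" if "i > m" for i
    using assms that by (intro sum.neutral) fastforce
  ultimately show "(\<lambda>i. \<Sum>t\<le>n. if i = v t then x t else 0) \<in> standard_simplex m"
    using nn le by (auto simp: standard_simplex_def intro!: sum_nonneg)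
qed

lemma collapse_simplex_in_standard_simplex:
  "x \<in> standard_simplex n \<Longrightarrow> (\<And>t. t \<le> n \<Longrightarrow> v t \<le> m) \<Longrightarrow> collapse_simplex n v x \<in> standard_simplex m"
  using simplicial_simplex_collapse[of n v m] by (auto simp: simplicial_simplex)

lemma collapse_simplex_compose:
  assumes x: "x \<in> standard_simplex n" and w: "\<And>t. t \<le> n \<Longrightarrow> w t \<le> m"
  shows "collapse_simplex m v (collapse_simplex n w x) = collapse_simplex n (\<lambda>t. v (w t)) x"
proof
  fix k
  have "collapse_simplex m v (collapse_simplex n w x) k =
      (\<Sum>t\<le>m. if k = v t then \<Sum>s\<le>n. if t = w s then x s else 0 else 0)"
    using collapse_simplex_in_standard_simplex[OF x w] x by (simp add: collapse_simplex_apply cong: if_cong)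
  also have "\<dots> = (\<Sum>t\<le>m. \<Sum>s\<le>n. if t = w s then if k = v (w s) then x s else 0 else 0)"
    by (intro sum.cong refl) (auto intro!: sum.cong sum.neutral)
  also have "\<dots> = (\<Sum>s\<le>n. \<Sum>t\<le>m. if t = w s then if k = v (w s) then x s else 0 else 0)"
    by (rule sum.swap)
  also have "\<dots> = (\<Sum>s\<le>n. if k = v (w s) then x s else 0)"
    using w by (intro sum.cong) auto
  finally show "collapse_simplex m v (collapse_simplex n w x) k = collapse_simplex n (\<lambda>t. v (w t)) x k"
    using x by (simp add: collapse_simplex_apply)
qed

text \<open>The pullback of \<open>\<sigma>\<close> along the affine map that sends vertex
  \<open>t\<close> to vertex \<open>L ! t\<close>. Faces omit vertices from the list and
  degeneracies repeat them, so both are covered by one notation.\<close>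

definition vertex_simplex :: "((nat \<Rightarrow> real) \<Rightarrow> 'a) \<Rightarrow> nat list \<Rightarrow> (nat \<Rightarrow> real) \<Rightarrow> 'a" where
  "vertex_simplex \<sigma> L = simplex_map (length L - 1) \<sigma> (collapse_simplex (length L - 1) ((!) L))"

lemma vertex_simplex_upt:
  assumes "\<sigma> \<in> extensional (standard_simplex i)"
  shows "vertex_simplex \<sigma> [0..<Suc i] = \<sigma>"
proof
  fix x
  have "collapse_simplex i ((!) [0..<Suc i]) x = x" if "x \<in> standard_simplex i"
    by (rule collapse_simplex_id[OF that]) (simp del: upt_Suc)
  then show "vertex_simplex \<sigma> [0..<Suc i] x = \<sigma> x"
    using assms by (auto simp: vertex_simplex_def simplex_map_def extensional_def simp del: upt_Suc)
qed

lemma vertex_simplex_vertex_simplex: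
  assumes "L \<noteq> []" "M \<noteq> []" "set M \<subseteq> {..<length L}"
  shows "vertex_simplex (vertex_simplex \<sigma> L) M = vertex_simplex \<sigma> (map ((!) L) M)"
proof
  fix x
  have M: "M ! t \<le> length L - 1" if "t \<le> length M - 1" for t
  proof -
    have "M ! t \<in> set M" using that assms(2) by (intro nth_mem) (cases M; auto)
    then show ?thesis using assms by auto
  qed
  have "collapse_simplex (length L - 1) ((!) L) (collapse_simplex (length M - 1) ((!) M) x) =
      collapse_simplex (length M - 1) ((!) (map ((!) L) M)) x" if x: "x \<in> standard_simplex (length M - 1)"
  proof -
    have "collapse_simplex (length L - 1) ((!) L) (collapse_simplex (length M - 1) ((!) M) x) =
      collapse_simplex (length M - 1) (\<lambda>t. L ! (M ! t)) x"
      by (rule collapse_simplex_compose[OF x M])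
    also have "collapse_simplex (length M - 1) (\<lambda>t. L ! (M ! t)) = collapse_simplex (length M - 1) ((!) (map ((!) L) M))"
    proof (rule collapse_simplex_cong)
      fix t assume "t \<le> length M - 1"
      then have "t < length M" using assms(2) by (cases M) auto
      then show "L ! (M ! t) = map ((!) L) M ! t" by simp
    qed
    finally show ?thesis .
  qed
  then show "vertex_simplex (vertex_simplex \<sigma> L) M x = vertex_simplex \<sigma> (map ((!) L) M) x"
    using collapse_simplex_in_standard_simplex[OF _ M]
    by (auto simp: vertex_simplex_def simplex_map_def)
qed

lemma singular_face_vertex_simplex:
  assumes "length L = Suc n" "1 \<le> n" "k \<le> n"
  shows "singular_face n k (vertex_simplex \<sigma> L) = vertex_simplex \<sigma> (take k L @ drop (Suc k) L)"
proof -
  have eq: "singular_face n k (collapse_simplex n ((!) L)) = collapse_simplex (n - 1) ((!) (take k L @ drop (Suc k) L))"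
    unfolding collapse_simplex_def singular_face_oriented_simplex[OF assms(2,3)] oriented_simplex_eq
    using assms by (auto simp: nth_append fun_eq_iff)
  have "collapse_simplex n ((!) L) (simplical_face k x) = collapse_simplex (n - 1) ((!) (take k L @ drop (Suc k) L)) x"
    if "x \<in> standard_simplex (n - Suc 0)" for x
    using that fun_cong[OF eq, of x] by (simp add: singular_face_def)
  then show ?thesis
    using assms simplical_face_in_standard_simplex[OF assms(2,3)]
    by (intro ext) (auto simp: vertex_simplex_def singular_face_def simplex_map_def)
qed

definition pair_simplex :: "nat \<Rightarrow> ((nat \<Rightarrow> real) \<Rightarrow> 'a) \<Rightarrow> ((nat \<Rightarrow> real) \<Rightarrow> 'b) \<Rightarrow> (nat \<Rightarrow> real) \<Rightarrow> 'a \<times> 'b" where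
  "pair_simplex n f g = (\<lambda>x\<in>standard_simplex n. (f x, g x))"

text \<open>Families of simplices indexed by vertex lists that behave like the restrictions of one simplex.\<close>

definition simplex_family :: "('v list \<Rightarrow> (nat \<Rightarrow> real) \<Rightarrow> 'a) \<Rightarrow> bool" where
  "simplex_family F \<longleftrightarrow> (\<forall>L. F L \<in> extensional (standard_simplex (length L - 1))) \<and>
     (\<forall>L M. L \<noteq> [] \<and> M \<noteq> [] \<and> set M \<subseteq> {..<length L} \<longrightarrow>
        vertex_simplex (F L) M = F (map ((!) L) M))"

definition pair_family ::
  "('v list \<Rightarrow> (nat \<Rightarrow> real) \<Rightarrow> 'a) \<Rightarrow> ('w list \<Rightarrow> (nat \<Rightarrow> real) \<Rightarrow> 'b) \<Rightarrow> ('v \<times> 'w) list \<Rightarrow> (nat \<Rightarrow> real) \<Rightarrow> 'a \<times> 'b"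
  where "pair_family F G P = pair_simplex (length P - 1) (F (map fst P)) (G (map snd P))"

lemma simplex_family_vertex_simplex: "simplex_family (vertex_simplex \<sigma>)"
  using vertex_simplex_vertex_simplex[of _ _ \<sigma>]
  by (auto simp: simplex_family_def vertex_simplex_def simplex_map_def)

lemma nth_compose_map: "set M \<subseteq> {..<length P} \<Longrightarrow> map f (map ((!) P) M) = map ((!) (map f P)) M"
  by (auto simp: subset_iff)

text \<open>Closure under pairing allows a cross product to be crossed again, which the boundary
  formula and associativity rely on.\<close>

lemma simplex_family_pair:
  assumes "simplex_family F" "simplex_family G"
  shows "simplex_family (pair_family F G)"
  unfolding simplex_family_def
proof (intro conjI allI impI)
  show "pair_family F G L \<in> extensional (standard_simplex (length L - 1))" for L
    by (simp add: pair_family_def pair_simplex_def)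
  fix P :: "('a \<times> 'c) list" and M :: "nat list"
  assume P: "P \<noteq> [] \<and> M \<noteq> [] \<and> set M \<subseteq> {..<length P}"
  have "vertex_simplex (pair_family F G P) M =
      pair_simplex (length M - 1) (vertex_simplex (F (map fst P)) M) (vertex_simplex (G (map snd P)) M)"
  proof
    fix x
    have M: "M ! t \<le> length P - 1" if "t \<le> length M - 1" for t
    proof -
      have "M ! t \<in> set M" using that P by (intro nth_mem) (cases M; auto)
      then show ?thesis using P by auto
    qed
    show "vertex_simplex (pair_family F G P) M x = pair_simplex (length M - 1) (vertex_simplex (F (map fst P)) M) (vertex_simplex (G (map snd P)) M) x"
      using collapse_simplex_in_standard_simplex[OF _ M]
      by (auto simp: vertex_simplex_def pair_family_def pair_simplex_def simplex_map_def)
  qed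
  also have "\<dots> = pair_family F G (map ((!) P) M)"
    using assms P unfolding simplex_family_def pair_family_def by (simp add: nth_compose_map del: map_map)
  finally show "vertex_simplex (pair_family F G P) M = pair_family F G (map ((!) P) M)" .
qed

lemma simplex_family_upt:
  assumes "simplex_family F" "length L = Suc i"
  shows "vertex_simplex (F L) [0..<Suc i] = F L"
  using assms by (intro vertex_simplex_upt) (metis diff_Suc_1 simplex_family_def)

text \<open>\<open>F L\<close> is its own restriction to the list of all its vertices, so the face
  formula for restrictions of a single simplex applies to it.\<close>

lemma singular_face_simplex_family:
  assumes "simplex_family F" "length L = Suc n" "1 \<le> n" "k \<le> n"
  shows "singular_face n k (F L) = F (take k L @ drop (Suc k) L)"
proof -
  let ?D = "take k [0..<Suc n] @ drop (Suc k) [0..<Suc n]"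
  have "singular_face n k (F L) = singular_face n k (vertex_simplex (F L) [0..<Suc n])"
    using simplex_family_upt[OF assms(1,2)] by simp
  also have "\<dots> = vertex_simplex (F L) ?D"
    by (rule singular_face_vertex_simplex) (use assms in auto)
  also have "\<dots> = F (map ((!) L) ?D)"
  proof -
    have "?D \<noteq> []" using assms(3,4) by (simp del: upt_Suc) linarith
    moreover have "set ?D \<subseteq> {..<length L}"
      using assms(2) by (auto simp del: upt_Suc dest!: in_set_takeD in_set_dropD)
    moreover have "L \<noteq> []" using assms(2) by auto
    ultimately show ?thesis using assms(1) unfolding simplex_family_def by blast
  qed
  also have "map ((!) L) ?D = take k (map ((!) L) [0..<Suc n]) @ drop (Suc k) (map ((!) L) [0..<Suc n])"
    by (simp only: map_append take_map drop_map)
  also have "map ((!) L) [0..<Suc n] = L" using map_nth[of L] assms(2) by simp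
  finally show ?thesis .
qed

text \<open>The passage from the sum over subsets in the definition to the recursive shuffles, for
  which the inductive results are available.\<close>

lemma cross_simplex_eq_shuffles:
  "cross_simplex i j \<sigma> \<tau> =
     frag_extend (\<lambda>P. frag_of (pair_family (vertex_simplex \<sigma>) (vertex_simplex \<tau>) P))
       (shuffles_frag [0..<Suc i] [0..<Suc j])"
proof -
  let ?R = "pair_family (vertex_simplex \<sigma>) (vertex_simplex \<tau>)"
  let ?P = "\<lambda>S. map (\<lambda>t. ([0..<Suc i] ! card (S \<inter> {..<t}), [0..<Suc j] ! card ({..<t} - S))) [0..<Suc (i + j)]"
  have R: "?R (?P S) = (\<lambda>x\<in>standard_simplex (i + j).
             (\<sigma> (collapse_simplex (i + j) (\<lambda>t. card (S \<inter> {..<t})) x),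
              \<tau> (collapse_simplex (i + j) (\<lambda>t. card ({..<t} - S)) x)))"
    if S: "S \<subseteq> {..<i + j}" "card S = i" for S
  proof -
    have fin: "finite S" using finite_subset[OF S(1)] by simp
    \<comment> \<open>Facts \<open>1\<close> and \<open>2\<close> say that the path stays inside the
      grid, so the list lookups below are in range.\<close>
    have 1: "card (S \<inter> {..<t}) \<le> i" for t using fin S by (metis card_mono inf_le1)
    have 2: "card ({..<t} - S) \<le> j" if "t \<le> i + j" for t
    proof -
      have "card ({..<t} - S) \<le> card ({..<i + j} - S)" using that by (intro card_mono) auto
      also have "\<dots> = j" using S fin by (simp add: card_Diff_subset)
      finally show ?thesis .
    qed
    have "collapse_simplex (i + j) ((!) (map fst (?P S))) = collapse_simplex (i + j) (\<lambda>t. card (S \<inter> {..<t}))"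
      by (rule collapse_simplex_cong) (use 1 in \<open>simp del: upt_Suc add: less_Suc_eq_le\<close>)
    moreover have "collapse_simplex (i + j) ((!) (map snd (?P S))) = collapse_simplex (i + j) (\<lambda>t. card ({..<t} - S))"
      by (rule collapse_simplex_cong) (use 2 in \<open>simp del: upt_Suc add: less_Suc_eq_le\<close>)
    moreover have "length (?P S) = Suc (i + j)" by simp
    ultimately show ?thesis
      by (auto simp: pair_family_def vertex_simplex_def pair_simplex_def simplex_map_def simp del: upt_Suc map_map)
  qed
  have "shuffles_frag [0..<Suc i] [0..<Suc j] = (\<Sum>S | S \<subseteq> {..<i + j} \<and> card S = i.
      frag_cmul (shuffle_sign (i + j) S) (frag_of (?P S)))"
    by (subst shuffles_frag_conv_sum[of _ _ "i + j"]) simp_all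
  moreover have "finite {S. S \<subseteq> {..<i + j} \<and> card S = i}" by (rule finite_subset[of _ "Pow {..<i + j}"]) auto
  ultimately show ?thesis
    unfolding cross_simplex_def by (simp add: frag_extend_sum frag_extend_cmul o_def R del: upt_Suc)
qed

text \<open>Shuffling commutes with relabelling of vertices, so arbitrary vertex lists may replace
  \<open>[0..<Suc i]\<close> and \<open>[0..<Suc j]\<close>. Faces and iterated products thereby
  become instances of one formula.\<close>

lemma cross_simplex_family:
  assumes F: "simplex_family F" and G: "simplex_family G" and A: "length A = Suc i" and B: "length B = Suc j"
  shows "cross_simplex i j (F A) (G B) = frag_extend (\<lambda>P. frag_of (pair_family F G P)) (shuffles_frag A B)"
proof -
  let ?f = "map_prod ((!) A) ((!) B)"
  have "cross_simplex i j (F A) (G B) =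
      frag_extend (\<lambda>P. frag_of (pair_family F G (map ?f P))) (shuffles_frag [0..<Suc i] [0..<Suc j])"
    unfolding cross_simplex_eq_shuffles
  proof (rule frag_extend_eq)
    fix P assume P: "P \<in> Poly_Mapping.keys (shuffles_frag [0..<Suc i] [0..<Suc j])"
    have s: "set P \<subseteq> {0..<Suc i} \<times> {0..<Suc j}" using set_keys_shuffles_frag[OF P] by (simp del: upt_Suc)
    have "P \<noteq> []" using length_keys_shuffles_frag[OF P] by (auto simp del: upt_Suc)
    moreover have "A \<noteq> []" "B \<noteq> []" using A B by auto
    moreover have "set (map fst P) \<subseteq> {..<length A}" "set (map snd P) \<subseteq> {..<length B}"
      using s A B by auto
    ultimately have "vertex_simplex (F A) (map fst P) = F (map fst (map ?f P))"
      "vertex_simplex (G B) (map snd P) = G (map snd (map ?f P))"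
      using F G unfolding simplex_family_def by (simp_all add: o_def)
    then show "frag_of (pair_family (vertex_simplex (F A)) (vertex_simplex (G B)) P) = frag_of (pair_family F G (map ?f P))"
      by (simp add: pair_family_def)
  qed
  also have "\<dots> = frag_extend (\<lambda>P. frag_of (pair_family F G P))
      (shuffles_frag (map ((!) A) [0..<Suc i]) (map ((!) B) [0..<Suc j]))"
    unfolding shuffles_frag_map by (subst frag_extend_linear[of "frag_extend (\<lambda>P. frag_of (pair_family F G P))"]) (simp_all only: frag_extend_diff frag_extend_of)
  also have "map ((!) A) [0..<Suc i] = A" using A map_nth[of A] by simp
  also have "map ((!) B) [0..<Suc j] = B" using B map_nth[of B] by simp
  finally show ?thesis .
qed

section \<open>Bilinearity, boundary, associativity and naturality of the cross product of
  chains\<close>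

lemma cross_chain_linear_simps [simp]:
  "cross_chain i j 0 d = 0" "cross_chain i j c 0 = 0"
  "cross_chain i j (frag_of \<sigma>) (frag_of \<tau>) = cross_simplex i j \<sigma> \<tau>"
  by (simp_all add: cross_chain_def)

lemma cross_chain_add_left: "cross_chain i j (c + c') d = cross_chain i j c d + cross_chain i j c' d"
  and cross_chain_diff_left: "cross_chain i j (c - c') d = cross_chain i j c d - cross_chain i j c' d"
  and cross_chain_cmul_left: "cross_chain i j (frag_cmul k c) d = frag_cmul k (cross_chain i j c d)"
  and cross_chain_add_right: "cross_chain i j c (d + d') = cross_chain i j c d + cross_chain i j c d'"
  and cross_chain_diff_right: "cross_chain i j c (d - d') = cross_chain i j c d - cross_chain i j c d'"
  and cross_chain_cmul_right: "cross_chain i j c (frag_cmul k d) = frag_cmul k (cross_chain i j c d)"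
  by (simp_all add: cross_chain_def frag_extend_add frag_extend_diff frag_extend_cmul
      frag_extend_add_fun frag_extend_diff_fun frag_extend_cmul_fun)

lemma cross_chain_sum_left: "cross_chain i j (sum f A) d = (\<Sum>a\<in>A. cross_chain i j (f a) d)"
  by (induction A rule: infinite_finite_induct) (simp_all add: cross_chain_add_left)

lemma cross_chain_sum_right: "cross_chain i j c (sum f A) = (\<Sum>a\<in>A. cross_chain i j c (f a))"
  by (induction A rule: infinite_finite_induct) (simp_all add: cross_chain_add_right)

lemma cross_chain_extend:
  "cross_chain i j (frag_extend f c) (frag_extend g d) =
     frag_extend (\<lambda>a. frag_extend (\<lambda>b. cross_chain i j (f a) (g b)) d) c"
  by (simp add: frag_extend_linear[of "\<lambda>c. cross_chain i j c _"] frag_extend_linear[of "cross_chain i j _"]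
      cross_chain_diff_left cross_chain_diff_right) (rule frag_extend_swap)

text \<open>The Leibniz rule for vertex lists, carried over by the paired family. The truncated
  \<open>i - 1\<close> and \<open>j - 1\<close> in degree 0 do no harm since the boundary there is
  0.\<close>

lemma cross_simplex_boundary:
  assumes F: "simplex_family F" and G: "simplex_family G" and A: "length A = Suc i" and B: "length B = Suc j"
  shows "chain_boundary (i + j) (cross_simplex i j (F A) (G B)) =
     cross_chain (i - 1) j (chain_boundary i (frag_of (F A))) (frag_of (G B)) +
     frag_cmul ((-1) ^ i) (cross_chain i (j - 1) (frag_of (F A)) (chain_boundary j (frag_of (G B))))"
proof (cases "i + j = 0")
  case True
  then show ?thesis by (simp add: chain_boundary_def)
next
  case False
  let ?R = "frag_extend (\<lambda>P. frag_of (pair_family F G P))"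
  have pf: "simplex_family (pair_family F G)" using F G by (rule simplex_family_pair)
  have "chain_boundary (i + j) (cross_simplex i j (F A) (G B)) =
     frag_extend (\<lambda>P. chain_boundary (i + j) (frag_of (pair_family F G P))) (shuffles_frag A B)"
    unfolding cross_simplex_family[OF assms]
    by (rule frag_extend_linear) (simp add: chain_boundary_diff)
  also have "\<dots> = frag_extend (\<lambda>P. ?R (list_boundary P)) (shuffles_frag A B)"
  proof (rule frag_extend_eq)
    fix P assume "P \<in> Poly_Mapping.keys (shuffles_frag A B)"
    then have len: "length P = Suc (i + j)" using length_keys_shuffles_frag[of P A B] A B by simp
    show "chain_boundary (i + j) (frag_of (pair_family F G P)) = ?R (list_boundary P)"
    proof -
      have "singular_face (i + j) k (pair_family F G P) = pair_family F G (take k P @ drop (Suc k) P)"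
        if "k \<le> i + j" for k
        using singular_face_simplex_family[OF pf len _ that] False by simp
      then show ?thesis
        unfolding list_boundary_conv_sum chain_boundary_of using False len
        by (simp add: frag_extend_sum frag_extend_cmul o_def lessThan_Suc_atMost)
    qed
  qed
  also have "\<dots> = ?R (frag_extend list_boundary (shuffles_frag A B))"
    by (rule frag_extend_linear[symmetric]) (simp add: frag_extend_diff)
  also have "\<dots> = ?R (frag_extend (\<lambda>A. shuffles_frag A B) (list_boundary A)) +
     frag_cmul ((-1) ^ i) (?R (frag_extend (shuffles_frag A) (list_boundary B)))"
    using False A B by (subst list_boundary_shuffles_frag) (auto simp: frag_extend_add frag_extend_cmul)
  also have "?R (frag_extend (\<lambda>A. shuffles_frag A B) (list_boundary A)) =
      cross_chain (i - 1) j (chain_boundary i (frag_of (F A))) (frag_of (G B))"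
  \<comment> \<open>For a single vertex the augmented boundary is \<open>[]\<close>, which shuffles
    to 0; this matches the zero boundary of a singular 0-simplex.\<close>
  proof (cases "i = 0")
    case True
    then obtain a where "A = [a]" using A by (auto simp: length_Suc_conv)
    then show ?thesis using True by (simp add: chain_boundary_def)
  next
    case False
    then have "?R (frag_extend (\<lambda>A. shuffles_frag A B) (list_boundary A)) =
       (\<Sum>k\<le>i. frag_cmul ((-1) ^ k) (?R (shuffles_frag (take k A @ drop (Suc k) A) B)))"
      by (simp add: list_boundary_conv_sum A frag_extend_sum frag_extend_cmul o_def lessThan_Suc_atMost)
    also have "\<dots> = (\<Sum>k\<le>i. frag_cmul ((-1) ^ k) (cross_simplex (i - 1) j (F (take k A @ drop (Suc k) A)) (G B)))"
      by (intro sum.cong refl arg_cong[where f = "frag_cmul _"] cross_simplex_family[symmetric] F G B)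
        (use A False in auto)
    finally show ?thesis
      using False by (simp add: chain_boundary_of cross_chain_sum_left cross_chain_cmul_left
          singular_face_simplex_family[OF F A])
  qed
  also have "?R (frag_extend (shuffles_frag A) (list_boundary B)) =
      cross_chain i (j - 1) (frag_of (F A)) (chain_boundary j (frag_of (G B)))"
  proof (cases "j = 0")
    case True
    then obtain a where "B = [a]" using B by (auto simp: length_Suc_conv)
    then show ?thesis using True by (simp add: chain_boundary_def)
  next
    case False
    then have "?R (frag_extend (shuffles_frag A) (list_boundary B)) =
       (\<Sum>k\<le>j. frag_cmul ((-1) ^ k) (?R (shuffles_frag A (take k B @ drop (Suc k) B))))"
      by (simp add: list_boundary_conv_sum B frag_extend_sum frag_extend_cmul o_def lessThan_Suc_atMost)
    also have "\<dots> = (\<Sum>k\<le>j. frag_cmul ((-1) ^ k) (cross_simplex i (j - 1) (F A) (G (take k B @ drop (Suc k) B))))"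
      by (intro sum.cong refl arg_cong[where f = "frag_cmul _"] cross_simplex_family[symmetric] F G A)
        (use B False in auto)
    finally show ?thesis
      using False by (simp add: chain_boundary_of cross_chain_sum_right cross_chain_cmul_right
          singular_face_simplex_family[OF G B])
  qed
  finally show ?thesis .
qed

lemma singular_simplex_vertices:
  assumes "singular_simplex i X \<sigma>"
  shows "vertex_simplex \<sigma> [0..<Suc i] = \<sigma>"
  using assms by (intro vertex_simplex_upt) (simp add: singular_simplex_def)

text \<open>Both sides are bilinear, and each singular simplex is its own restriction to all its
  vertices, hence a member of a family.\<close>

lemma chain_boundary_cross_chain:
  assumes "singular_chain i X c" "singular_chain j Y d"
  shows "chain_boundary (i + j) (cross_chain i j c d) =
     cross_chain (i - 1) j (chain_boundary i c) d +
     frag_cmul ((-1) ^ i) (cross_chain i (j - 1) c (chain_boundary j d))"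
  using assms(1) unfolding singular_chain_def
proof (induction c rule: frag_induction)
  case (one \<sigma>)
  show ?case
    using assms(2) unfolding singular_chain_def
  proof (induction d rule: frag_induction)
    case (one \<tau>)
    have "vertex_simplex \<sigma> [0..<Suc i] = \<sigma>" "vertex_simplex \<tau> [0..<Suc j] = \<tau>"
      using singular_simplex_vertices \<open>\<sigma> \<in> _\<close> \<open>\<tau> \<in> _\<close> by blast+
    then show ?case
      using cross_simplex_boundary[OF simplex_family_vertex_simplex simplex_family_vertex_simplex,
          of "[0..<Suc i]" i "[0..<Suc j]" j \<sigma> \<tau>]
      by (simp del: upt_Suc)
  next
    case (diff a b)
    then show ?case
      by (simp add: chain_boundary_diff cross_chain_diff_right poly_mapping_eq_iff fun_eq_iff lookup_minus lookup_add algebra_simps)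
  qed (simp add: chain_boundary_def)
next
  case (diff a b)
  then show ?case
    by (simp add: chain_boundary_diff cross_chain_diff_left poly_mapping_eq_iff fun_eq_iff lookup_minus lookup_add algebra_simps)
qed simp

text \<open>Both sides are the signed sum over the same paths in a three-dimensional grid, so
  equality holds on chains and not merely up to homotopy.\<close>

lemma cross_simplex_assoc:
  assumes F: "simplex_family F" and G: "simplex_family G" and H: "simplex_family H"
    and A: "length A = Suc i" and B: "length B = Suc j" and D: "length D = Suc k"
  shows "chain_map (i + j + k) (\<lambda>((a, b), c). (a, b, c)) (cross_chain (i + j) k (cross_simplex i j (F A) (G B)) (frag_of (H D))) =
    cross_chain i (j + k) (frag_of (F A)) (cross_simplex j k (G B) (H D))"
proof -
  let ?a = "\<lambda>((a, b), c). (a, b, c)"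
  let ?FG = "pair_family F G" and ?GH = "pair_family G H"
  let ?R = "frag_extend (\<lambda>P. frag_of (pair_family F ?GH P))"
  have FG: "simplex_family ?FG" and GH: "simplex_family ?GH"
    using F G H simplex_family_pair by blast+
  have "cross_chain (i + j) k (cross_simplex i j (F A) (G B)) (frag_of (H D)) =
     frag_extend (\<lambda>P. cross_simplex (i + j) k (?FG P) (H D)) (shuffles_frag A B)"
    unfolding cross_simplex_family[OF F G A B]
    by (subst frag_extend_linear[of "\<lambda>c. cross_chain (i + j) k c (frag_of (H D))"]) (simp_all add: cross_chain_diff_left)
  then have "chain_map (i + j + k) ?a (cross_chain (i + j) k (cross_simplex i j (F A) (G B)) (frag_of (H D))) =
     frag_extend (\<lambda>P. chain_map (i + j + k) ?a (cross_simplex (i + j) k (?FG P) (H D))) (shuffles_frag A B)"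
    by (simp only:) (rule frag_extend_linear, simp add: chain_map_diff)
  also have "\<dots> = frag_extend (\<lambda>P. frag_extend (\<lambda>Q. ?R (frag_of (map ?a Q))) (shuffles_frag P D)) (shuffles_frag A B)"
  proof (rule frag_extend_eq)
    fix P assume "P \<in> Poly_Mapping.keys (shuffles_frag A B)"
    then have len: "length P = Suc (i + j)" using length_keys_shuffles_frag[of P A B] A B by simp
    have "chain_map (i + j + k) ?a (cross_simplex (i + j) k (?FG P) (H D)) =
       frag_extend (\<lambda>Q. chain_map (i + j + k) ?a (frag_of (pair_family ?FG H Q))) (shuffles_frag P D)"
      unfolding cross_simplex_family[OF FG H len D]
      by (rule frag_extend_linear) (simp add: chain_map_diff)
    also have "\<dots> = frag_extend (\<lambda>Q. ?R (frag_of (map ?a Q))) (shuffles_frag P D)"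
    proof (rule frag_extend_eq)
      fix Q assume "Q \<in> Poly_Mapping.keys (shuffles_frag P D)"
      then have lQ: "length Q = Suc (i + j + k)" using length_keys_shuffles_frag[of Q P D] len D by simp
      \<comment> \<open>Regrouping the values of a triple simplex amounts to regrouping the entries
        of its vertex list.\<close>
      then show "chain_map (i + j + k) ?a (frag_of (pair_family ?FG H Q)) = ?R (frag_of (map ?a Q))"
        by (auto simp: frag_of_eq simplex_map_def pair_family_def pair_simplex_def case_prod_beta o_def restrict_def)
    qed
    finally show "chain_map (i + j + k) ?a (cross_simplex (i + j) k (?FG P) (H D)) =
        frag_extend (\<lambda>Q. ?R (frag_of (map ?a Q))) (shuffles_frag P D)" .
  qed
  also have "\<dots> = ?R (frag_extend (\<lambda>Q. frag_of (map ?a Q)) (frag_extend (\<lambda>P. shuffles_frag P D) (shuffles_frag A B)))"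
    by (simp only: frag_extend_linear[of "frag_extend _"] frag_extend_diff)
  also have "\<dots> = ?R (frag_extend (shuffles_frag A) (shuffles_frag B D))"
    by (simp only: shuffles_frag_assoc)
  also have "\<dots> = frag_extend (\<lambda>P. ?R (shuffles_frag A P)) (shuffles_frag B D)"
    by (rule frag_extend_linear) (rule frag_extend_diff)
  also have "\<dots> = frag_extend (\<lambda>P. cross_simplex i (j + k) (F A) (?GH P)) (shuffles_frag B D)"
    by (rule frag_extend_eq, rule cross_simplex_family[symmetric, OF F GH A])
      (use B D length_keys_shuffles_frag in fastforce)
  also have "\<dots> = cross_chain i (j + k) (frag_of (F A)) (cross_simplex j k (G B) (H D))"
    unfolding cross_simplex_family[OF G H B D]
    by (subst frag_extend_linear[of "cross_chain i (j + k) (frag_of (F A))"]) (simp_all add: cross_chain_diff_right)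
  finally show ?thesis .
qed

lemma cross_chain_assoc:
  assumes "singular_chain i X c" "singular_chain j Y d" "singular_chain k Z e"
  shows "chain_map (i + j + k) (\<lambda>((a, b), c). (a, b, c)) (cross_chain (i + j) k (cross_chain i j c d) e) =
    cross_chain i (j + k) c (cross_chain j k d e)"
  using assms(1) unfolding singular_chain_def
proof (induction c rule: frag_induction)
  case (one \<sigma>)
  show ?case
    using assms(2) unfolding singular_chain_def
  proof (induction d rule: frag_induction)
    case (one \<tau>)
    show ?case
      using assms(3) unfolding singular_chain_def
    proof (induction e rule: frag_induction)
      case (one \<rho>)
      have v: "vertex_simplex \<sigma> [0..<Suc i] = \<sigma>" "vertex_simplex \<tau> [0..<Suc j] = \<tau>"
        "vertex_simplex \<rho> [0..<Suc k] = \<rho>"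
        using singular_simplex_vertices \<open>\<sigma> \<in> _\<close> \<open>\<tau> \<in> _\<close> \<open>\<rho> \<in> _\<close> by blast+
      show ?case
        using cross_simplex_assoc[OF simplex_family_vertex_simplex simplex_family_vertex_simplex simplex_family_vertex_simplex,
            of "[0..<Suc i]" i "[0..<Suc j]" j "[0..<Suc k]" k \<sigma> \<tau> \<rho>]
        unfolding v cross_chain_linear_simps by simp
    qed (simp_all add: cross_chain_diff_right chain_map_diff)
  qed (simp_all add: cross_chain_diff_right cross_chain_diff_left chain_map_diff)
qed (simp_all add: cross_chain_diff_left chain_map_diff)

text \<open>The collapses act on the source simplex and \<open>f\<close>, \<open>g\<close> on the
  values, so they commute path by path.\<close>

lemma chain_map_cross_chain:
  "chain_map (i + j) (\<lambda>(a, b). (f a, g b)) (cross_chain i j c d) = cross_chain i j (chain_map i f c) (chain_map j g d)"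
  (is "chain_map _ ?fg _ = _")
proof -
  have *: "chain_map (i + j) ?fg (cross_simplex i j \<sigma> \<tau>) = cross_simplex i j (simplex_map i f \<sigma>) (simplex_map j g \<tau>)" for \<sigma> \<tau>
  proof -
    have "chain_map (i + j) ?fg (cross_simplex i j \<sigma> \<tau>) =
      frag_extend (\<lambda>P. frag_of (simplex_map (i + j) ?fg (pair_family (vertex_simplex \<sigma>) (vertex_simplex \<tau>) P)))
       (shuffles_frag [0..<Suc i] [0..<Suc j])"
      unfolding cross_simplex_eq_shuffles by (subst frag_extend_linear) (simp_all add: chain_map_diff)
    also have "\<dots> = cross_simplex i j (simplex_map i f \<sigma>) (simplex_map j g \<tau>)"
      unfolding cross_simplex_eq_shuffles
    proof (rule frag_extend_eq, rule arg_cong[where f = frag_of], rule ext)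
      fix P x assume P: "P \<in> Poly_Mapping.keys (shuffles_frag [0..<Suc i] [0..<Suc j])"
      have len: "length P = Suc (i + j)" using length_keys_shuffles_frag[OF P] by simp
      have "P ! t \<in> {0..<Suc i} \<times> {0..<Suc j}" if "t \<le> i + j" for t
        using set_keys_shuffles_frag[OF P] nth_mem[of t P] that len by (auto simp del: upt_Suc)
      then have "fst (P ! t) \<le> i" "snd (P ! t) \<le> j" if "t \<le> i + j" for t
        using that by (metis mem_Sigma_iff prod.collapse atLeastLessThan_iff less_Suc_eq_le)+
      then show "simplex_map (i + j) ?fg (pair_family (vertex_simplex \<sigma>) (vertex_simplex \<tau>) P) x =
          pair_family (vertex_simplex (simplex_map i f \<sigma>)) (vertex_simplex (simplex_map j g \<tau>)) P x"
        using len by (auto simp: pair_family_def pair_simplex_def vertex_simplex_def simplex_map_def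
            intro!: collapse_simplex_in_standard_simplex)
    qed
    finally show ?thesis .
  qed
  have "chain_map (i + j) ?fg (cross_chain i j (frag_extend frag_of c) (frag_extend frag_of d)) =
    cross_chain i j (frag_extend (\<lambda>\<sigma>. frag_of (simplex_map i f \<sigma>)) c) (frag_extend (\<lambda>\<tau>. frag_of (simplex_map j g \<tau>)) d)"
    unfolding cross_chain_extend
    by (simp add: frag_extend_linear[of "chain_map _ _"] chain_map_diff *)
  then show ?thesis by (simp add: frag_expansion[symmetric] chain_map_def o_def)
qed

lemma singular_chain_cross_chain:
  assumes "singular_chain i X c" "singular_chain j Y d"
  shows "singular_chain (i + j) (prod_topology X Y) (cross_chain i j c d)"
  unfolding cross_chain_def cross_simplex_eq_shuffles
proof (intro singular_chain_extend)
  fix \<sigma> \<tau> P assume \<sigma>: "\<sigma> \<in> Poly_Mapping.keys c" and \<tau>: "\<tau> \<in> Poly_Mapping.keys d"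
    and P: "P \<in> Poly_Mapping.keys (shuffles_frag [0..<Suc i] [0..<Suc j])"
  have len: "length P = Suc (i + j)" using length_keys_shuffles_frag[OF P] by simp
  have *: "P ! t \<in> {0..<Suc i} \<times> {0..<Suc j}" if "t \<le> i + j" for t
    using set_keys_shuffles_frag[OF P] nth_mem[of t P] that len by (auto simp del: upt_Suc)
  have le: "fst (P ! t) \<le> i" "snd (P ! t) \<le> j" if "t \<le> i + j" for t
    using *[OF that] by (auto simp: mem_Times_iff)
  have v: "singular_simplex (length L - 1) Z (vertex_simplex \<rho> L)"
    if "singular_simplex m Z \<rho>" "\<And>t. t \<le> length L - 1 \<Longrightarrow> L ! t \<le> m" for m L \<rho> and Z :: "'z topology"
    unfolding vertex_simplex_def
    by (rule singular_simplex_simplex_map[OF simplicial_imp_singular_simplex[OF simplicial_simplex_collapse[OF that(2)]]])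
      (use that(1) in \<open>simp_all add: singular_simplex_def\<close>)
  have "singular_simplex (i + j) X (vertex_simplex \<sigma> (map fst P))"
    "singular_simplex (i + j) Y (vertex_simplex \<tau> (map snd P))"
    using v[of i X \<sigma> "map fst P"] v[of j Y \<tau> "map snd P"] le len assms \<sigma> \<tau>
    by (auto simp: singular_chain_def)
  then show "singular_chain (i + j) (prod_topology X Y) (frag_of (pair_family (vertex_simplex \<sigma>) (vertex_simplex \<tau>) P))"
    using len by (simp add: singular_chain_of singular_simplex_def pair_family_def pair_simplex_def continuous_map_pairedI)
qed

section \<open>Homology modulo \<open>p\<close>\<close>

lemma frag_cmul_uminus: "frag_cmul k (- c) = - frag_cmul k c"
  by (simp add: poly_mapping_eq_iff fun_eq_iff lookup_minus)

lemma modp_boundaryE: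
  assumes "modp_boundary p n X c"
  obtains u e where "singular_chain (Suc n) X u" "singular_chain n X e"
    "c = chain_boundary (Suc n) u + frag_cmul (int p) e"
  using assms unfolding modp_boundary_def by (elim exE conjE) (rule that)

lemma modp_boundaryI:
  "singular_chain (Suc n) X u \<Longrightarrow> singular_chain n X e \<Longrightarrow>
   c = chain_boundary (Suc n) u + frag_cmul (int p) e \<Longrightarrow> modp_boundary p n X c"
  unfolding modp_boundary_def by (intro exI conjI)

lemma modp_cycleE:
  assumes "modp_cycle p n X c"
  obtains e where "singular_chain n X c" "singular_chain (n - 1) X e" "chain_boundary n c = frag_cmul (int p) e"
  using assms unfolding modp_cycle_def by (elim exE conjE) (rule that)

lemma modp_cycleI:
  "singular_chain n X c \<Longrightarrow> singular_chain (n - 1) X e \<Longrightarrow> chain_boundary n c = frag_cmul (int p) e \<Longrightarrow>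
   modp_cycle p n X c"
  unfolding modp_cycle_def by (intro exI conjI)

lemma modp_cycle_0 [simp]: "modp_cycle p n X 0"
  by (rule modp_cycleI[of _ _ _ 0]) simp_all

lemma modp_cycle_add:
  assumes "modp_cycle p n X c" "modp_cycle p n X d"
  shows "modp_cycle p n X (c + d)"
proof -
  obtain e where e: "singular_chain n X c" "singular_chain (n - 1) X e" "chain_boundary n c = frag_cmul (int p) e"
    using assms(1) by (rule modp_cycleE)
  obtain f where f: "singular_chain n X d" "singular_chain (n - 1) X f" "chain_boundary n d = frag_cmul (int p) f"
    using assms(2) by (rule modp_cycleE)
  show ?thesis
    by (rule modp_cycleI[OF singular_chain_add[OF e(1) f(1)] singular_chain_add[OF e(2) f(2)]])
      (simp add: chain_boundary_add e(3) f(3) frag_cmul_distrib2)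
qed

lemma modp_cycle_minus:
  assumes "modp_cycle p n X c"
  shows "modp_cycle p n X (- c)"
proof -
  obtain e where e: "singular_chain n X c" "singular_chain (n - 1) X e" "chain_boundary n c = frag_cmul (int p) e"
    using assms by (rule modp_cycleE)
  show ?thesis
    by (rule modp_cycleI[of _ _ _ "- e"])
      (simp_all add: singular_chain_minus e chain_boundary_minus frag_cmul_uminus del: minus_frag_cmul One_nat_def)
qed

lemma modp_cycle_sum: "(\<And>i. i \<in> I \<Longrightarrow> modp_cycle p n X (f i)) \<Longrightarrow> modp_cycle p n X (sum f I)"
  by (induction I rule: infinite_finite_induct) (auto intro: modp_cycle_add)

lemma modp_cycle_singular_chain: "modp_cycle p n X c \<Longrightarrow> singular_chain n X c"
  by (simp add: modp_cycle_def)

lemma modp_boundary_0 [simp]: "modp_boundary p n X 0"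
  by (rule modp_boundaryI[of _ _ 0 0]) simp_all

lemma modp_boundary_add:
  assumes "modp_boundary p n X c" "modp_boundary p n X d"
  shows "modp_boundary p n X (c + d)"
proof -
  obtain u e where 1: "singular_chain (Suc n) X u" "singular_chain n X e" "c = chain_boundary (Suc n) u + frag_cmul (int p) e"
    using assms(1) by (rule modp_boundaryE)
  obtain u' e' where 2: "singular_chain (Suc n) X u'" "singular_chain n X e'" "d = chain_boundary (Suc n) u' + frag_cmul (int p) e'"
    using assms(2) by (rule modp_boundaryE)
  show ?thesis
    by (rule modp_boundaryI[OF singular_chain_add[OF 1(1) 2(1)] singular_chain_add[OF 1(2) 2(2)]])
      (simp add: 1(3) 2(3) chain_boundary_add frag_cmul_distrib2)
qed

lemma modp_boundary_minus:
  assumes "modp_boundary p n X c"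
  shows "modp_boundary p n X (- c)"
proof -
  obtain u e where
    "singular_chain (Suc n) X u" "singular_chain n X e" "c = chain_boundary (Suc n) u + frag_cmul (int p) e"
    using assms by (rule modp_boundaryE)
  then show ?thesis
    by (intro modp_boundaryI[of n X "- u" "- e"])
      (simp_all add: singular_chain_minus chain_boundary_minus frag_cmul_uminus del: minus_frag_cmul)
qed

lemma modp_boundary_diff: "modp_boundary p n X c \<Longrightarrow> modp_boundary p n X d \<Longrightarrow> modp_boundary p n X (c - d)"
  using modp_boundary_add[of p n X c "- d"] modp_boundary_minus[of p n X d] by simp

lemma modp_boundary_imp_cycle:
  assumes "modp_boundary p n X c"
  shows "modp_cycle p n X c"
proof -
  obtain u e where ue:
    "singular_chain (Suc n) X u" "singular_chain n X e" "c = chain_boundary (Suc n) u + frag_cmul (int p) e"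
    using assms by (rule modp_boundaryE)
  have "chain_boundary n (chain_boundary (Suc n) u) = 0"
    using chain_boundary_boundary_alt[of n X u] ue(1) by (cases n) (auto simp: chain_boundary_def)
  then have "chain_boundary n c = frag_cmul (int p) (chain_boundary n e)"
    by (simp add: ue chain_boundary_add chain_boundary_cmul)
  moreover have "singular_chain (n - 1) X (chain_boundary n e)" "singular_chain n X c"
    using ue singular_chain_boundary[of n X e] singular_chain_boundary_alt[of n X u]
    by (auto intro!: singular_chain_add singular_chain_cmul)
  ultimately show ?thesis by (intro modp_cycleI)
qed

section \<open>Homology groups and their classes\<close>

lemma mult_modp_cycle_group [simp]: "c \<otimes>\<^bsub>modp_cycle_group p n X\<^esub> d = c + d"
  and one_modp_cycle_group [simp]: "\<one>\<^bsub>modp_cycle_group p n X\<^esub> = 0"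
  by (simp_all add: modp_cycle_group_def chain_group_def)

lemma comm_group_modp_cycle_group: "comm_group (modp_cycle_group p n X)"
  unfolding modp_cycle_group_def
  by (simp add: chain_group_def abelian_free_Abelian_group group.abelian_subgroup_generated)

lemma subgroup_modp_boundary: "subgroup (Collect (modp_boundary p n X)) (modp_cycle_group p n X)"
proof -
  interpret comm_group "modp_cycle_group p n X" by (rule comm_group_modp_cycle_group)
  have inv: "inv\<^bsub>modp_cycle_group p n X\<^esub> c = - c" if "modp_cycle p n X c" for c
    by (rule inv_equality) (use that modp_cycle_minus in auto)
  show ?thesis
    by (rule subgroupI)
      (use modp_boundary_0 in \<open>auto simp: inv modp_boundary_imp_cycle modp_boundary_minus modp_boundary_add simp del: modp_boundary_0\<close>)
qed

lemma comm_group_modp_homology_group: "comm_group (modp_homology_group p n X)"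
  unfolding modp_homology_group_def
  by (rule comm_group.abelian_FactGroup[OF comm_group_modp_cycle_group subgroup_modp_boundary])

lemma carrier_modp_homology_group:
  "carrier (modp_homology_group p n X) = modp_class p n X ` Collect (modp_cycle p n X)"
  by (simp add: modp_homology_group_def carrier_FactGroup modp_class_def)

lemma modp_class_conv_image: "modp_class p n X c = (\<lambda>b. b + c) ` Collect (modp_boundary p n X)"
  by (auto simp: modp_class_def r_coset_def)

lemma one_modp_homology_group: "\<one>\<^bsub>modp_homology_group p n X\<^esub> = modp_class p n X 0"
  by (simp add: modp_homology_group_def modp_class_conv_image)

lemma mult_modp_class:
  assumes "modp_cycle p n X c" "modp_cycle p n X d"
  shows "modp_class p n X c \<otimes>\<^bsub>modp_homology_group p n X\<^esub> modp_class p n X d = modp_class p n X (c + d)"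
proof -
  interpret comm_group "modp_cycle_group p n X" by (rule comm_group_modp_cycle_group)
  have "Collect (modp_boundary p n X) \<lhd> modp_cycle_group p n X"
    using normal_iff_subgroup subgroup_modp_boundary by blast
  from normal.rcos_sum[OF this] show ?thesis
    using assms by (simp add: modp_homology_group_def modp_class_def)
qed

lemma modp_class_eq_iff: "modp_class p n X c = modp_class p n X d \<longleftrightarrow> modp_boundary p n X (c - d)"
proof
  assume "modp_class p n X c = modp_class p n X d"
  then have "c \<in> modp_class p n X d" by (force simp: modp_class_conv_image)
  then show "modp_boundary p n X (c - d)" by (auto simp: modp_class_conv_image)
next
  assume b: "modp_boundary p n X (c - d)"
  have "b + c \<in> (\<lambda>b. b + d) ` Collect (modp_boundary p n X)" if "modp_boundary p n X b" for b
    using modp_boundary_add[OF that b] by (intro image_eqI[of _ _ "b + (c - d)"]) auto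
  moreover have "b' + d \<in> (\<lambda>b. b + c) ` Collect (modp_boundary p n X)" if "modp_boundary p n X b'" for b'
    using modp_boundary_diff[OF that b] by (intro image_eqI[of _ _ "b' - (c - d)"]) auto
  ultimately show "modp_class p n X c = modp_class p n X d" by (auto simp: modp_class_conv_image)
qed

lemma modp_class_memD:
  assumes "c \<in> modp_class p n X d" "modp_cycle p n X d"
  shows "modp_cycle p n X c" "modp_boundary p n X (c - d)"
  using assms by (auto simp: modp_class_conv_image intro: modp_cycle_add modp_boundary_imp_cycle)

lemma modp_class_self: "c \<in> modp_class p n X c"
  by (force simp: modp_class_conv_image)

lemma finprod_modp_class:
  assumes "finite I" "\<And>i. i \<in> I \<Longrightarrow> modp_cycle p n X (c i)"
  shows "finprod (modp_homology_group p n X) (\<lambda>i. modp_class p n X (c i)) I = modp_class p n X (sum c I)"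
proof -
  interpret comm_group "modp_homology_group p n X" by (rule comm_group_modp_homology_group)
  show ?thesis using assms
  proof (induction I rule: finite_induct)
    case empty then show ?case by (simp add: one_modp_homology_group)
  next
    case (insert i I)
    then have "(\<lambda>i. modp_class p n X (c i)) \<in> I \<rightarrow> carrier (modp_homology_group p n X)"
      "modp_class p n X (c i) \<in> carrier (modp_homology_group p n X)"
      by (auto simp: carrier_modp_homology_group)
    then show ?case using insert by (simp add: mult_modp_class modp_cycle_sum)
  qed
qed

lemma modp_cycle_chain_map:
  assumes "modp_cycle p n X c" "continuous_map X Y f"
  shows "modp_cycle p n Y (chain_map n f c)"
proof -
  obtain e where "singular_chain n X c" "singular_chain (n - 1) X e" "chain_boundary n c = frag_cmul (int p) e"
    using assms(1) by (rule modp_cycleE)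
  then show ?thesis
    using assms(2) unfolding modp_cycle_def
    by (auto simp: chain_boundary_chain_map intro!: singular_chain_chain_map exI[of _ "chain_map (n - Suc 0) f e"])
qed

lemma modp_boundary_chain_map:
  assumes "modp_boundary p n X c" "continuous_map X Y f"
  shows "modp_boundary p n Y (chain_map n f c)"
proof -
  obtain u e where
    "singular_chain (Suc n) X u" "singular_chain n X e" "c = chain_boundary (Suc n) u + frag_cmul (int p) e"
    using assms(1) by (rule modp_boundaryE)
  then show ?thesis
    using assms(2)
    by (intro modp_boundaryI[of n Y "chain_map (Suc n) f u" "chain_map n f e"])
      (simp_all add: singular_chain_chain_map chain_map_add chain_boundary_chain_map)
qed

text \<open>Cycles depend on a topology only through its singular chains. This moves cross products
  from the product topology to its k-ification.\<close>

lemma modp_cycle_topology_mono: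
  "modp_cycle p n X c \<Longrightarrow> (\<And>m e. singular_chain m X e \<Longrightarrow> singular_chain m Y e) \<Longrightarrow> modp_cycle p n Y c"
  by (erule modp_cycleE) (erule modp_cycleI[rotated 2], blast+)

lemma modp_boundary_topology_mono:
  "modp_boundary p n X c \<Longrightarrow> (\<And>m e. singular_chain m X e \<Longrightarrow> singular_chain m Y e) \<Longrightarrow> modp_boundary p n Y c"
  by (erule modp_boundaryE) (erule modp_boundaryI[rotated 2], blast+)

section \<open>Cross products of cycles and boundaries\<close>

lemma modp_cycle_cross_chain:
  assumes "modp_cycle p i X c" "modp_cycle p j Y d"
  shows "modp_cycle p (i + j) (prod_topology X Y) (cross_chain i j c d)"
proof -
  obtain e where e: "singular_chain i X c" "singular_chain (i - 1) X e" "chain_boundary i c = frag_cmul (int p) e"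
    using assms(1) by (rule modp_cycleE)
  obtain f where f: "singular_chain j Y d" "singular_chain (j - 1) Y f" "chain_boundary j d = frag_cmul (int p) f"
    using assms(2) by (rule modp_cycleE)
  show ?thesis
  proof -
    \<comment> \<open>For \<open>i = 0\<close> the truncated \<open>i - 1\<close> would put
      \<open>cross_chain (i - 1) j e d\<close> in the wrong degree; as the boundary of
      \<open>c\<close> is then 0, the witness 0 serves. The same holds for
      \<open>?v\<close>.\<close>
    let ?u = "if i = 0 then 0 else cross_chain (i - 1) j e d"
    let ?v = "if j = 0 then 0 else cross_chain i (j - 1) c f"
    have u: "cross_chain (i - 1) j (chain_boundary i c) d = frag_cmul (int p) ?u"
      using e by (auto simp: cross_chain_cmul_left chain_boundary_def)
    have v: "cross_chain i (j - 1) c (chain_boundary j d) = frag_cmul (int p) ?v"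
      using f by (auto simp: cross_chain_cmul_right chain_boundary_def)
    have "singular_chain (i + j - 1) (prod_topology X Y) ?u"
      using singular_chain_cross_chain[OF e(2) f(1)] by auto
    moreover have "singular_chain (i + j - 1) (prod_topology X Y) ?v"
      using singular_chain_cross_chain[OF e(1) f(2)] by auto
    moreover have "chain_boundary (i + j) (cross_chain i j c d) =
        frag_cmul (int p) (?u + frag_cmul ((-1) ^ i) ?v)"
      unfolding chain_boundary_cross_chain[OF e(1) f(1)] u v by (simp add: frag_cmul_distrib2 mult.commute)
    ultimately show ?thesis
      using singular_chain_cross_chain[OF e(1) f(1)]
      by (intro modp_cycleI[of _ _ _ "?u + frag_cmul ((-1) ^ i) ?v"] singular_chain_add singular_chain_cmul)
  qed
qed

text \<open>Solve the Leibniz rule for the boundary of \<open>u\<close> crossed with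
  \<open>d\<close>. The correction term contains the boundary of \<open>d\<close> and is therefore a
  multiple of \<open>p\<close>.\<close>

lemma modp_boundary_cross_chain_left:
  assumes "modp_boundary p i X c" "modp_cycle p j Y d"
  shows "modp_boundary p (i + j) (prod_topology X Y) (cross_chain i j c d)"
proof -
  obtain u e where ue:
    "singular_chain (Suc i) X u" "singular_chain i X e" "c = chain_boundary (Suc i) u + frag_cmul (int p) e"
    using assms(1) by (rule modp_boundaryE)
  obtain f where f: "singular_chain j Y d" "singular_chain (j - 1) Y f" "chain_boundary j d = frag_cmul (int p) f"
    using assms(2) by (rule modp_cycleE)
  let ?v = "if j = 0 then 0 else cross_chain (Suc i) (j - 1) u f"
  have v: "cross_chain (Suc i) (j - 1) u (chain_boundary j d) = frag_cmul (int p) ?v"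
    using f by (auto simp: cross_chain_cmul_right chain_boundary_def)
  have "cross_chain i j c d = chain_boundary (Suc (i + j)) (cross_chain (Suc i) j u d) +
      frag_cmul (int p) (cross_chain i j e d + frag_cmul ((-1) ^ i) ?v)"
    using chain_boundary_cross_chain[OF ue(1) f(1)]
    unfolding v ue(3) cross_chain_add_left cross_chain_cmul_left
    by (simp add: poly_mapping_eq_iff fun_eq_iff lookup_minus lookup_add algebra_simps)
  moreover have "singular_chain (i + j) (prod_topology X Y) ?v"
    using singular_chain_cross_chain[OF ue(1) f(2)] by auto
  ultimately show ?thesis
    using singular_chain_cross_chain[OF ue(1) f(1)] singular_chain_cross_chain[OF ue(2) f(1)]
    by (intro modp_boundaryI[of _ _ "cross_chain (Suc i) j u d" "cross_chain i j e d + frag_cmul ((-1) ^ i) ?v"]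
        singular_chain_add singular_chain_cmul) (simp_all only: add_Suc)
qed

lemma modp_boundary_cross_chain_right:
  assumes "modp_cycle p i X c" "modp_boundary p j Y d"
  shows "modp_boundary p (i + j) (prod_topology X Y) (cross_chain i j c d)"
proof -
  obtain u e where ue:
    "singular_chain (Suc j) Y u" "singular_chain j Y e" "d = chain_boundary (Suc j) u + frag_cmul (int p) e"
    using assms(2) by (rule modp_boundaryE)
  obtain f where f: "singular_chain i X c" "singular_chain (i - 1) X f" "chain_boundary i c = frag_cmul (int p) f"
    using assms(1) by (rule modp_cycleE)
  let ?v = "if i = 0 then 0 else cross_chain (i - 1) (Suc j) f u"
  have v: "cross_chain (i - 1) (Suc j) (chain_boundary i c) u = frag_cmul (int p) ?v"
    using f by (auto simp: cross_chain_cmul_left chain_boundary_def)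
  \<comment> \<open>The wanted term carries the sign \<open>(-1) ^ i\<close> in the Leibniz rule;
    multiplying by that sign once more removes it.\<close>
  have sq: "(-1) ^ i * (-1 :: int) ^ i = 1" by (simp flip: power_mult_distrib)
  have "frag_cmul ((-1) ^ i) (chain_boundary (i + Suc j) (cross_chain i (Suc j) c u)) =
     frag_cmul ((-1) ^ i) (frag_cmul (int p) ?v) + cross_chain i j c (chain_boundary (Suc j) u)"
    unfolding chain_boundary_cross_chain[OF f(1) ue(1)] v by (simp add: frag_cmul_distrib2 sq)
  then have "cross_chain i j c d = chain_boundary (Suc (i + j)) (frag_cmul ((-1) ^ i) (cross_chain i (Suc j) c u)) +
      frag_cmul (int p) (cross_chain i j c e - frag_cmul ((-1) ^ i) ?v)"
    unfolding ue(3) cross_chain_add_right cross_chain_cmul_right chain_boundary_cmul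
    by (simp add: poly_mapping_eq_iff fun_eq_iff lookup_minus lookup_add algebra_simps)
  moreover have "singular_chain (i + j) (prod_topology X Y) ?v"
    using singular_chain_cross_chain[OF f(2) ue(1)] by auto
  ultimately show ?thesis
    using singular_chain_cross_chain[OF f(1) ue(1)] singular_chain_cross_chain[OF f(1) ue(2)]
    by (intro modp_boundaryI[of _ _ "frag_cmul ((-1) ^ i) (cross_chain i (Suc j) c u)"
          "cross_chain i j c e - frag_cmul ((-1) ^ i) ?v"]
        singular_chain_diff singular_chain_cmul) (simp_all only: add_Suc_right)
qed

section \<open>Direct sums of homology groups and representing cycles\<close>

lemma finprod_hom:
  assumes G: "comm_group G" and H: "comm_group H" and h: "h \<in> hom G H" and f: "f \<in> A \<rightarrow> carrier G" and A: "finite A"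
  shows "h (finprod G f A) = finprod H (\<lambda>a. h (f a)) A"
proof -
  interpret G: comm_group G by (rule G)
  interpret H: comm_group H by (rule H)
  show ?thesis using A f
  proof (induction A rule: finite_induct)
    case empty
    show ?case using hom_one[OF h G.group_axioms H.group_axioms] by simp
  next
    case (insert a A)
    have "(\<lambda>a. h (f a)) \<in> A \<rightarrow> carrier H" "h (f a) \<in> carrier H"
      using insert.prems hom_in_carrier[OF h] by (auto simp: Pi_iff)
    moreover have "finprod G f A \<in> carrier G" using insert.prems by (intro G.finprod_closed) auto
    ultimately show ?case
      using insert hom_mult[OF h] H.finprod_insert[of A a "\<lambda>a. h (f a)"] by simp
  qed
qed

text \<open>\<open>gfinprod\<close> multiplies over the support of its own argument. Since
  \<open>h\<close> may kill factors, the image can have smaller support, and the comparison goes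
  through the support of \<open>f\<close>.\<close>

lemma gfinprod_hom:
  assumes G: "comm_group G" and H: "comm_group H" and h: "h \<in> hom G H" and f: "f \<in> A \<rightarrow> carrier G"
    and fin: "finite {a \<in> A. f a \<noteq> \<one>\<^bsub>G\<^esub>}"
  shows "h (gfinprod G f A) = gfinprod H (\<lambda>a. h (f a)) A"
proof -
  interpret G: comm_group G by (rule G)
  interpret H: comm_group H by (rule H)
  have 1: "h \<one>\<^bsub>G\<^esub> = \<one>\<^bsub>H\<^esub>" by (rule hom_one[OF h G.group_axioms H.group_axioms])
  let ?S = "{a \<in> A. f a \<noteq> \<one>\<^bsub>G\<^esub>}" and ?T = "{a \<in> A. h (f a) \<noteq> \<one>\<^bsub>H\<^esub>}"
  have T: "?T \<subseteq> ?S" using 1 by auto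
  have "h (gfinprod G f A) = h (finprod G f ?S)" using fin by (simp add: gfinprod_def)
  also have "\<dots> = finprod H (\<lambda>a. h (f a)) ?S" by (rule finprod_hom[OF G H h _ fin]) (use f in auto)
  also have "\<dots> = finprod H (\<lambda>a. h (f a)) ?T"
    by (rule H.finprod_mono_neutral_cong_left[OF fin T, symmetric])
      (use f hom_in_carrier[OF h] in \<open>auto simp: Pi_iff\<close>)
  also have "\<dots> = gfinprod H (\<lambda>a. h (f a)) A" using finite_subset[OF T fin] by (simp add: gfinprod_def)
  finally show ?thesis .
qed

text \<open>A cycle chosen in every degree, almost all of them 0. Identities between elements of the
  direct sum are thereby reduced to identities between chains.\<close>

definition represents :: "nat \<Rightarrow> 'a topology \<Rightarrow> (nat \<Rightarrow> 'a chain) \<Rightarrow> (nat \<Rightarrow> 'a chain set) \<Rightarrow> bool" where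
  "represents p X c x \<longleftrightarrow> finite {n. c n \<noteq> 0} \<and> (\<forall>n. modp_cycle p n X (c n)) \<and> x = (\<lambda>n. modp_class p n X (c n))"

lemma restrict_UNIV: "restrict f UNIV = f"
  by (simp add: restrict_def)

lemma mult_modp_homology: "x \<otimes>\<^bsub>modp_homology p X\<^esub> y = (\<lambda>n. x n \<otimes>\<^bsub>modp_homology_group p n X\<^esub> y n)"
  by (simp add: modp_homology_def restrict_UNIV)

lemma comm_group_modp_homology: "comm_group (modp_homology p X)"
proof (rule group.group_comm_groupI)
  show "group (modp_homology p X)"
    unfolding modp_homology_def by (rule sum_group) (simp add: comm_group.axioms(2) comm_group_modp_homology_group)
  fix x y assume "x \<in> carrier (modp_homology p X)" "y \<in> carrier (modp_homology p X)"
  then have "x n \<in> carrier (modp_homology_group p n X)" "y n \<in> carrier (modp_homology_group p n X)" for n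
    unfolding modp_homology_def
    by (subst (asm) (1 2) carrier_sum_group; auto simp: comm_group.axioms(2) comm_group_modp_homology_group)+
  then show "x \<otimes>\<^bsub>modp_homology p X\<^esub> y = y \<otimes>\<^bsub>modp_homology p X\<^esub> x"
    unfolding mult_modp_homology by (intro ext comm_groupE(4)[OF comm_group_modp_homology_group])
qed

lemma carrier_modp_homology_iff: "x \<in> carrier (modp_homology p X) \<longleftrightarrow> (\<exists>c. represents p X c x)"
proof -
  have car: "carrier (modp_homology p X) = {x. (\<forall>n. x n \<in> carrier (modp_homology_group p n X)) \<and>
      finite {n. x n \<noteq> modp_class p n X 0}}"
    unfolding modp_homology_def
    by (subst carrier_sum_group) (auto simp: comm_group.axioms(2) comm_group_modp_homology_group one_modp_homology_group PiE_UNIV_domain)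
  show ?thesis
  proof
    assume x: "x \<in> carrier (modp_homology p X)"
    \<comment> \<open>A trivial class gets the chain 0 rather than an arbitrary boundary; otherwise
      the support could be infinite.\<close>
    define c where "c n = (if x n = modp_class p n X 0 then 0 else SOME c. modp_cycle p n X c \<and> x n = modp_class p n X c)" for n
    have ex: "\<exists>c. modp_cycle p n X c \<and> x n = modp_class p n X c" for n
      using x unfolding car carrier_modp_homology_group by blast
    have "modp_cycle p n X (c n) \<and> x n = modp_class p n X (c n)" for n
      using someI_ex[OF ex[of n]] by (auto simp: c_def)
    moreover have "{n. c n \<noteq> 0} \<subseteq> {n. x n \<noteq> modp_class p n X 0}" by (auto simp: c_def)
    ultimately show "\<exists>c. represents p X c x"
      using x finite_subset unfolding car represents_def by blast
  next
    assume "\<exists>c. represents p X c x"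
    then obtain c where c: "finite {n. c n \<noteq> 0}" "\<And>n. modp_cycle p n X (c n)" "x = (\<lambda>n. modp_class p n X (c n))"
      by (auto simp: represents_def)
    have "{n. x n \<noteq> modp_class p n X 0} \<subseteq> {n. c n \<noteq> 0}" using c(3) by auto
    then show "x \<in> carrier (modp_homology p X)"
      unfolding car using c finite_subset by (auto simp: carrier_modp_homology_group)
  qed
qed

lemma one_modp_homology: "\<one>\<^bsub>modp_homology p X\<^esub> = (\<lambda>n. modp_class p n X 0)"
  by (simp add: modp_homology_def one_modp_homology_group restrict_UNIV)

lemma represents_0: "represents p X (\<lambda>n. 0) \<one>\<^bsub>modp_homology p X\<^esub>"
  by (simp add: represents_def one_modp_homology)

lemma represents_unique: "represents p X c x \<Longrightarrow> represents p X c y \<Longrightarrow> x = y"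
  by (simp add: represents_def)

lemma represents_mult:
  assumes "represents p X c x" "represents p X d y"
  shows "represents p X (\<lambda>n. c n + d n) (x \<otimes>\<^bsub>modp_homology p X\<^esub> y)"
proof -
  have "{n. c n + d n \<noteq> 0} \<subseteq> {n. c n \<noteq> 0} \<union> {n. d n \<noteq> 0}" by auto
  then have "finite {n. c n + d n \<noteq> 0}" using assms finite_subset by (fastforce simp: represents_def)
  then show ?thesis
    using assms by (simp add: represents_def mult_modp_homology mult_modp_class modp_cycle_add)
qed

text \<open>\<open>d\<close> is the cycle \<open>c\<close> plus a boundary, hence a cycle. This lets
  the cycle for \<open>r\<close> be replaced by its image at the end of the homotopy.\<close>

lemma represents_homologous:
  assumes "represents p X c x" "\<And>n. modp_boundary p n X (d n - c n)" "finite {n. d n \<noteq> 0}"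
  shows "represents p X d x"
proof -
  have "modp_cycle p n X ((d n - c n) + c n)" for n
    using assms(1,2) modp_cycle_add modp_boundary_imp_cycle unfolding represents_def by blast
  moreover have "modp_class p n X (c n) = modp_class p n X (d n)" for n
    using modp_boundary_minus[OF assms(2)[of n]] by (simp add: modp_class_eq_iff)
  ultimately show ?thesis using assms by (simp add: represents_def)
qed

text \<open>\<open>modp_induced\<close> is a union over all representatives of the class; homologous
  cycles have homologous images, so only one coset occurs in the union.\<close>

lemma represents_induced:
  assumes c: "represents p X c x" and f: "continuous_map X Y f"
  shows "represents p Y (\<lambda>n. chain_map n f (c n)) (modp_induced p X Y f x)"
proof -
  have cyc: "modp_cycle p n X (c n)" and x: "x n = modp_class p n X (c n)" for n
    using c by (auto simp: represents_def)
  have "{n. chain_map n f (c n) \<noteq> 0} \<subseteq> {n. c n \<noteq> 0}" by auto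
  then have "finite {n. chain_map n f (c n) \<noteq> 0}" using c finite_subset by (auto simp: represents_def)
  moreover have "(\<Union>c\<in>x n. modp_class p n Y (chain_map n f c)) = modp_class p n Y (chain_map n f (c n))" for n
  proof -
    have "modp_class p n Y (chain_map n f d) = modp_class p n Y (chain_map n f (c n))" if "d \<in> x n" for d
      using modp_boundary_chain_map[OF modp_class_memD(2)[OF _ cyc] f] that
      by (simp add: modp_class_eq_iff x chain_map_diff)
    moreover have "c n \<in> x n" by (simp add: x modp_class_self)
    ultimately show ?thesis by blast
  qed
  ultimately show ?thesis
    using modp_cycle_chain_map[OF cyc f] by (simp add: represents_def modp_induced_def)
qed

definition graded_cross :: "(nat \<Rightarrow> 'a chain) \<Rightarrow> (nat \<Rightarrow> 'b chain) \<Rightarrow> nat \<Rightarrow> ('a \<times> 'b) chain" where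
  "graded_cross c d n = (\<Sum>i\<le>n. cross_chain i (n - i) (c i) (d (n - i)))"

lemma finite_support_graded_cross:
  assumes "finite {n. c n \<noteq> 0}" "finite {n. d n \<noteq> 0}"
  shows "finite {n. graded_cross c d n \<noteq> 0}"
proof -
  have "{n. graded_cross c d n \<noteq> 0} \<subseteq> (\<lambda>(i, j). i + j) ` ({n. c n \<noteq> 0} \<times> {n. d n \<noteq> 0})"
  proof
    fix n assume "n \<in> {n. graded_cross c d n \<noteq> 0}"
    then obtain i where i: "i \<le> n" "cross_chain i (n - i) (c i) (d (n - i)) \<noteq> 0"
      unfolding graded_cross_def by (metis (mono_tags, lifting) atMost_iff mem_Collect_eq sum.neutral)
    then have "c i \<noteq> 0" "d (n - i) \<noteq> 0" by auto
    then show "n \<in> (\<lambda>(i, j). i + j) ` ({n. c n \<noteq> 0} \<times> {n. d n \<noteq> 0})"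
      using i(1) by (intro image_eqI[of _ _ "(i, n - i)"]) auto
  qed
  then show ?thesis using assms finite_subset by blast
qed

text \<open>Cross products of chains are formed in the ordinary product, their classes in its
  k-ification. The assumption \<open>prod\<close> bridges the two and is later supplied by weak
  Hausdorffness.\<close>

lemma represents_cross:
  assumes c: "represents p X c x" and d: "represents p Y d y"
    and prod: "\<And>n e. singular_chain n (prod_topology X Y) e \<Longrightarrow> singular_chain n (kprod X Y) e"
  shows "represents p (kprod X Y) (graded_cross c d) (modp_cross p X Y x y)"
proof -
  have cyc: "modp_cycle p n X (c n)" "modp_cycle p n Y (d n)"
    and xy: "x n = modp_class p n X (c n)" "y n = modp_class p n Y (d n)" for n
    using c d by (auto simp: represents_def)
  have cr: "modp_cycle p (i + j) (kprod X Y) (cross_chain i j c' d')" if "modp_cycle p i X c'" "modp_cycle p j Y d'" for i j c' d'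
    by (rule modp_cycle_topology_mono[OF modp_cycle_cross_chain[OF that]]) (rule prod)
  have cr': "modp_cycle p n (kprod X Y) (cross_chain i (n - i) (c i) (d (n - i)))" if "i \<le> n" for i n
    using cr[OF cyc(1)[of i] cyc(2)[of "n - i"]] that by simp
  have union: "(\<Union>c'\<in>x i. \<Union>d'\<in>y j. modp_class p (i + j) (kprod X Y) (cross_chain i j c' d')) =
      modp_class p (i + j) (kprod X Y) (cross_chain i j (c i) (d j))" for i j
  proof -
    have "modp_class p (i + j) (kprod X Y) (cross_chain i j c' d') =
      modp_class p (i + j) (kprod X Y) (cross_chain i j (c i) (d j))" if "c' \<in> x i" "d' \<in> y j" for c' d'
    proof -
      have c': "modp_cycle p i X c'" "modp_boundary p i X (c' - c i)"
        and d': "modp_cycle p j Y d'" "modp_boundary p j Y (d' - d j)"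
        using that modp_class_memD cyc unfolding xy by blast+
      \<comment> \<open>The two representatives are changed one at a time; the sum below telescopes
        to the difference of the two cross products.\<close>
      have "modp_boundary p (i + j) (prod_topology X Y)
          (cross_chain i j (c' - c i) d' + cross_chain i j (c i) (d' - d j))"
        using modp_boundary_cross_chain_left[OF c'(2) d'(1)] modp_boundary_cross_chain_right[OF cyc(1) d'(2)]
        by (rule modp_boundary_add)
      then have "modp_boundary p (i + j) (kprod X Y)
          (cross_chain i j c' d' - cross_chain i j (c i) (d j))"
        by (intro modp_boundary_topology_mono[OF _ prod]) (simp_all add: cross_chain_diff_left cross_chain_diff_right)
      then show ?thesis by (simp add: modp_class_eq_iff)
    qed
    moreover have "c i \<in> x i" "d j \<in> y j" by (simp_all add: xy modp_class_self)
    ultimately show ?thesis by blast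
  qed
  have "modp_cross p X Y x y n = modp_class p n (kprod X Y) (graded_cross c d n)" for n
  proof -
    interpret comm_group "modp_homology_group p n (kprod X Y)" by (rule comm_group_modp_homology_group)
    have "modp_cross p X Y x y n = finprod (modp_homology_group p n (kprod X Y))
        (\<lambda>i. modp_class p n (kprod X Y) (cross_chain i (n - i) (c i) (d (n - i)))) {..n}"
      unfolding modp_cross_def
    proof (rule finprod_cong')
      fix i assume "i \<in> {..n}"
      then show "(\<Union>c\<in>x i. \<Union>d\<in>y (n - i). modp_class p n (kprod X Y) (cross_chain i (n - i) c d)) =
          modp_class p n (kprod X Y) (cross_chain i (n - i) (c i) (d (n - i)))"
        using union[of i "n - i"] by simp
    qed (auto simp: carrier_modp_homology_group cr')
    also have "\<dots> = modp_class p n (kprod X Y) (graded_cross c d n)"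
      unfolding graded_cross_def by (rule finprod_modp_class) (use cr' in auto)
    finally show ?thesis .
  qed
  moreover have "modp_cycle p n (kprod X Y) (graded_cross c d n)" for n
    unfolding graded_cross_def by (rule modp_cycle_sum) (use cr' in auto)
  ultimately show ?thesis
    using c d finite_support_graded_cross unfolding represents_def by blast
qed

lemma singular_chain_graded_cross:
  assumes "\<And>n. singular_chain n X (c n)" "\<And>n. singular_chain n Y (d n)"
  shows "singular_chain n (prod_topology X Y) (graded_cross c d n)"
  unfolding graded_cross_def
proof (rule singular_chain_sum)
  fix i assume "i \<in> {..n}"
  then show "singular_chain n (prod_topology X Y) (cross_chain i (n - i) (c i) (d (n - i)))"
    using singular_chain_cross_chain[OF assms, of i "n - i"] by simp
qed

lemma graded_cross_add_left: "graded_cross (\<lambda>n. c n + c' n) d n = graded_cross c d n + graded_cross c' d n"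
  by (simp add: graded_cross_def cross_chain_add_left sum.distrib)

lemma chain_map_graded_cross:
  "chain_map n (\<lambda>(a, b). (f a, g b)) (graded_cross c d n) =
     graded_cross (\<lambda>n. chain_map n f (c n)) (\<lambda>n. chain_map n g (d n)) n"
proof -
  have "chain_map n (\<lambda>(a, b). (f a, g b)) (cross_chain i (n - i) (c i) (d (n - i))) =
      cross_chain i (n - i) (chain_map i f (c i)) (chain_map (n - i) g (d (n - i)))" if "i \<le> n" for i
    using chain_map_cross_chain[of i "n - i" f g] that by simp
  then show ?thesis by (simp add: graded_cross_def chain_map_sum)
qed

text \<open>Both iterated sums run over the triples of degrees with total \<open>n\<close>; after
  reindexing, associativity applies to each summand.\<close>

lemma graded_cross_assoc:
  assumes "\<And>n. singular_chain n X (c n)" "\<And>n. singular_chain n Y (d n)" "\<And>n. singular_chain n Z (e n)"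
  shows "chain_map n (\<lambda>((a, b), c). (a, b, c)) (graded_cross (graded_cross c d) e n) =
     graded_cross c (graded_cross d e) n"
proof -
  let ?a = "\<lambda>((a, b), c). (a, b, c)"
  have a: "chain_map n ?a (cross_chain (i + j) (n - (i + j)) (cross_chain i j (c i) (d j)) (e (n - (i + j)))) =
     cross_chain i (n - i) (c i) (cross_chain j (n - i - j) (d j) (e (n - i - j)))" if "i + j \<le> n" for i j
    using cross_chain_assoc[OF assms(1)[of i] assms(2)[of j] assms(3)[of "n - (i + j)"]] that by (simp add: diff_diff_add)
  have "chain_map n ?a (graded_cross (graded_cross c d) e n) =
    (\<Sum>m\<le>n. \<Sum>i\<le>m. chain_map n ?a (cross_chain m (n - m) (cross_chain i (m - i) (c i) (d (m - i))) (e (n - m))))"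
    by (simp add: graded_cross_def cross_chain_sum_left chain_map_sum o_def)
  also have "\<dots> = (\<Sum>(i, j)\<in>{(i, j). i + j \<le> n}. chain_map n ?a (cross_chain (i + j) (n - (i + j)) (cross_chain i j (c i) (d j)) (e (n - (i + j)))))"
    unfolding sum.triangle_reindex_eq by simp
  also have "\<dots> = (\<Sum>(i, j)\<in>{(i, j). i + j \<le> n}. cross_chain i (n - i) (c i) (cross_chain j (n - i - j) (d j) (e (n - i - j))))"
    by (rule sum.cong) (use a in auto)
  also have "{(i, j). i + j \<le> n} = Sigma {..n} (\<lambda>i. {..n - i})" by auto
  also have "(\<Sum>(i, j)\<in>Sigma {..n} (\<lambda>i. {..n - i}). cross_chain i (n - i) (c i) (cross_chain j (n - i - j) (d j) (e (n - i - j)))) =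
     graded_cross c (graded_cross d e) n"
    by (simp add: graded_cross_def cross_chain_sum_right sum.Sigma[symmetric])
  finally show ?thesis .
qed

text \<open>With first degree 0 the only lattice path runs in the second direction, so crossing with
  a point is the inclusion of the slice over \<open>a\<close>. This identifies the two ends of the
  homotopy below.\<close>

lemma cross_chain_point:
  fixes a :: 'a and c :: "'b chain"
  shows "cross_chain 0 n (frag_of (\<lambda>x\<in>standard_simplex 0. a)) c = chain_map n (Pair a) c"
proof -
  have *: "cross_simplex 0 n (\<lambda>x\<in>standard_simplex 0. a) \<tau> = frag_of (simplex_map n (Pair a) \<tau>)" for \<tau> :: "(nat \<Rightarrow> real) \<Rightarrow> 'b"
  proof -
    have S: "{S. S \<subseteq> {..<0 + n} \<and> card S = 0} = {{}}"
      using finite_subset[of _ "{..<n}"] by auto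
    have "collapse_simplex n (\<lambda>t. card ({} \<inter> {..<t})) x \<in> standard_simplex 0" if "x \<in> standard_simplex n" for x
      by (rule collapse_simplex_in_standard_simplex[OF that]) simp
    moreover have "collapse_simplex n (\<lambda>t. card ({..<t} - {})) x = x" if "x \<in> standard_simplex n" for x
      by (rule collapse_simplex_id[OF that]) simp
    ultimately have "(\<lambda>x\<in>standard_simplex n. ((\<lambda>x\<in>standard_simplex 0. a) (collapse_simplex n (\<lambda>t. card ({} \<inter> {..<t})) x),
        \<tau> (collapse_simplex n (\<lambda>t. card ({..<t} - {})) x))) = simplex_map n (Pair a) \<tau>"
      by (intro ext) (simp add: simplex_map_def)
    then show ?thesis
      unfolding cross_simplex_def S by (simp add: shuffle_sign_def)
  qed
  have "cross_simplex 0 n (\<lambda>x\<in>standard_simplex 0. a) =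
      (frag_of \<circ> simplex_map n (Pair a) :: ((nat \<Rightarrow> real) \<Rightarrow> 'b) \<Rightarrow> ('a \<times> 'b) chain)"
    by (rule ext) (simp only: * comp_apply)
  then show ?thesis by (simp add: cross_chain_def chain_map_def)
qed

text \<open>The chain homotopy is the cross product with the fundamental simplex of the unit interval.\<close>

lemma modp_boundary_homotopic:
  assumes h: "continuous_map (prod_topology (top_of_set {0..1::real}) X) Y (\<lambda>(t, x). h t x)"
    and c: "modp_cycle p n X c"
  shows "modp_boundary p n Y (chain_map n (h 1) c - chain_map n (h 0) c)"
proof -
  let ?I = "top_of_set {0..1::real}"
  obtain e where e: "singular_chain n X c" "singular_chain (n - 1) X e" "chain_boundary n c = frag_cmul (int p) e"
    using c by (rule modp_cycleE)
  define \<iota> where "\<iota> = (\<lambda>x\<in>standard_simplex 1. x (1::nat) :: real)"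
  have "continuous_map (subtopology (powertop_real UNIV) (standard_simplex 1)) euclideanreal (\<lambda>x. x 1)"
    using continuous_map_product_projection[of "1::nat" UNIV "\<lambda>_. euclideanreal"]
    by (intro continuous_map_from_subtopology) simp
  moreover have "x 1 \<in> {0..1}" if "x \<in> standard_simplex 1" for x
    using that by (simp add: standard_simplex_def)
  ultimately have "continuous_map (subtopology (powertop_real UNIV) (standard_simplex 1)) ?I (\<lambda>x. x 1)"
    by (auto simp: continuous_map_in_subtopology)
  then have \<iota>: "singular_simplex 1 ?I \<iota>"
    unfolding singular_simplex_def by (auto simp: \<iota>_def elim!: continuous_map_eq)
  have "chain_boundary 1 (frag_of \<iota>) = frag_of (singular_face 1 0 \<iota>) - frag_of (singular_face 1 1 \<iota>)"
    by (simp add: chain_boundary_of)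
  also have "singular_face 1 0 \<iota> = (\<lambda>x\<in>standard_simplex 0. 1)"
    using simplical_face_in_standard_simplex[of 1 0]
    by (auto simp: singular_face_def \<iota>_def simplical_face_def standard_simplex_0 fun_eq_iff)
  also have "singular_face 1 1 \<iota> = (\<lambda>x\<in>standard_simplex 0. 0)"
    using simplical_face_in_standard_simplex[of 1 1]
    by (auto simp: singular_face_def \<iota>_def simplical_face_def standard_simplex_0 fun_eq_iff)
  finally have b: "chain_boundary 1 (frag_of \<iota>) =
      frag_of (\<lambda>x\<in>standard_simplex 0. 1) - frag_of (\<lambda>x\<in>standard_simplex 0. 0)" .
  let ?v = "if n = 0 then 0 else cross_chain 1 (n - 1) (frag_of \<iota>) e"
  have v: "cross_chain 1 (n - 1) (frag_of \<iota>) (chain_boundary n c) = frag_cmul (int p) ?v"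
    using e(3) by (auto simp: cross_chain_cmul_right chain_boundary_def)
  have \<iota>': "singular_chain 1 ?I (frag_of \<iota>)" using \<iota> by (simp only: singular_chain_of)
  have "chain_boundary (Suc n) (cross_chain 1 n (frag_of \<iota>) c) =
      chain_map n (Pair 1) c - chain_map n (Pair 0) c - frag_cmul (int p) ?v"
    using chain_boundary_cross_chain[OF \<iota>' e(1)] unfolding b v
    by (simp add: cross_chain_diff_left cross_chain_point)
  then have "chain_map n (Pair 1) c - chain_map n (Pair 0) c =
      chain_boundary (Suc n) (cross_chain 1 n (frag_of \<iota>) c) + frag_cmul (int p) ?v"
    by simp
  moreover have "singular_chain n (prod_topology ?I X) ?v"
    using singular_chain_cross_chain[OF \<iota>' e(2)] by auto
  moreover have "singular_chain (Suc n) (prod_topology ?I X) (cross_chain 1 n (frag_of \<iota>) c)"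
    using singular_chain_cross_chain[OF \<iota>' e(1)] by simp
  ultimately have "modp_boundary p n (prod_topology ?I X) (chain_map n (Pair 1) c - chain_map n (Pair 0) c)"
    by (intro modp_boundaryI)
  from modp_boundary_chain_map[OF this h] have "modp_boundary p n Y
      (chain_map n ((\<lambda>(t, x). h t x) \<circ> Pair 1) c - chain_map n ((\<lambda>(t, x). h t x) \<circ> Pair 0) c)"
    by (simp add: chain_map_diff chain_map_compose)
  then show ?thesis by (simp add: o_def)
qed

section \<open>k-ification and orbit spaces\<close>

text \<open>The detour is through normality and T1, which both pass to images under continuous
  closed maps, unlike the Hausdorff property in general.\<close>

lemma Hausdorff_space_closed_image:
  assumes K: "compact_space K" "Hausdorff_space K" and u: "continuous_map K Y u" "closed_map K Y u"
    and surj: "u ` topspace K = topspace Y"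
  shows "Hausdorff_space Y"
proof (rule normal_t1_imp_Hausdorff_space)
  show "normal_space Y"
    using normal_space_continuous_closed_map_image[OF _ u surj] K compact_Hausdorff_or_regular_imp_normal_space by blast
  show "t1_space Y"
    using t1_space_closed_map_image[OF u(2) surj] K(2) Hausdorff_imp_t1_space by blast
qed

text \<open>Closed subsets of \<open>K\<close> are compact Hausdorff again, so weak Hausdorffness
  makes \<open>u\<close> a closed map, and a closed image of \<open>K\<close> is Hausdorff.\<close>

lemma weak_Hausdorff_compact_image:
  fixes X :: "'a topology" and K :: "'b topology"
  assumes X: "weak_Hausdorff_space X" and K: "compact_space K" "Hausdorff_space K" and u: "continuous_map K X u"
  shows "compactin X (u ` topspace K)" "Hausdorff_space (subtopology X (u ` topspace K))"
    "closedin X (u ` topspace K)"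
proof -
  show "closedin X (u ` topspace K)" by (rule weak_Hausdorff_space_closedin_image[OF X K u])
  show "compactin X (u ` topspace K)" using image_compactin[OF _ u] K unfolding compact_space_def by blast
  have "closed_map K X u"
    unfolding closed_map_def
  proof (intro allI impI)
    fix T assume T: "closedin K T"
    have "closedin X (u ` topspace (subtopology K T))"
    proof (rule weak_Hausdorff_space_closedin_image[OF X])
      show "compact_space (subtopology K T)"
        using T K closedin_compact_space compact_space_subtopology by blast
    qed (auto simp: K u Hausdorff_space_subtopology continuous_map_from_subtopology)
    then show "closedin X (u ` T)"
      using T by (simp add: closedin_subset Int_absorb1)
  qed
  then have "closed_map K (subtopology X (u ` topspace K)) u"
    by (rule closed_map_into_subtopology) simp
  moreover have "continuous_map K (subtopology X (u ` topspace K)) u"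
    using u by (simp add: continuous_map_in_subtopology)
  moreover have "u ` topspace K \<subseteq> topspace X" using u by (auto simp: continuous_map_def)
  ultimately show "Hausdorff_space (subtopology X (u ` topspace K))"
    using Hausdorff_space_closed_image[OF K] by (metis topspace_subtopology_subset)
qed

lemma weak_Hausdorff_compact_subset_image:
  assumes X: "weak_Hausdorff_space X" and K: "compactin Y K" "Hausdorff_space (subtopology Y K)"
    and u: "continuous_map Y X u"
  shows "compactin X (u ` K)" "Hausdorff_space (subtopology X (u ` K))" "closedin X (u ` K)"
proof -
  have "topspace (subtopology Y K) = K" using compactin_subset_topspace[OF K(1)] by auto
  moreover have "compact_space (subtopology Y K)" using K(1) by (rule compact_space_subtopology)
  ultimately show "compactin X (u ` K)" "Hausdorff_space (subtopology X (u ` K))" "closedin X (u ` K)"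
    using weak_Hausdorff_compact_image[OF X _ K(2) continuous_map_from_subtopology[OF u]] by auto
qed

text \<open>The image lies in the product of its two projections. That product is closed and
  Hausdorff even if the whole space is not, and a compact set is closed inside it.\<close>

lemma weak_Hausdorff_prod_topology:
  fixes X :: "'a topology" and Y :: "'b topology"
  assumes X: "weak_Hausdorff_space X" and Y: "weak_Hausdorff_space Y"
  shows "weak_Hausdorff_space (prod_topology X Y)"
  unfolding weak_Hausdorff_space_def
proof (intro allI impI)
  fix K :: "('a \<times> 'b) set set topology" and u
  assume "compact_space K \<and> Hausdorff_space K \<and> continuous_map K (prod_topology X Y) u"
  then have K: "compact_space K" "Hausdorff_space K" and u: "continuous_map K (prod_topology X Y) u"
    and u1: "continuous_map K X (fst \<circ> u)" and u2: "continuous_map K Y (snd \<circ> u)"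
    by (auto simp: continuous_map_pairwise)
  let ?A = "(fst \<circ> u) ` topspace K" and ?B = "(snd \<circ> u) ` topspace K"
  note A = weak_Hausdorff_compact_image[OF X K u1] and B = weak_Hausdorff_compact_image[OF Y K u2]
  have sub: "u ` topspace K \<subseteq> ?A \<times> ?B"
  proof (rule image_subsetI)
    fix x assume "x \<in> topspace K"
    then show "u x \<in> ?A \<times> ?B" unfolding mem_Times_iff by (simp add: image_iff) blast
  qed
  have "compactin (prod_topology X Y) (u ` topspace K)"
    using image_compactin[OF _ u] K unfolding compact_space_def by blast
  then have "compactin (subtopology (prod_topology X Y) (?A \<times> ?B)) (u ` topspace K)"
    using sub by (simp add: compactin_subtopology)
  moreover have "Hausdorff_space (subtopology (prod_topology X Y) (?A \<times> ?B))"
    using A(2) B(2) by (simp add: subtopology_Times Hausdorff_space_prod_topology)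
  ultimately have "closedin (subtopology (prod_topology X Y) (?A \<times> ?B)) (u ` topspace K)"
    by (rule compactin_imp_closedin[rotated])
  moreover have "closedin (prod_topology X Y) (?A \<times> ?B)"
    using A(3) B(3) by (simp add: closedin_prod_Times_iff)
  ultimately show "closedin (prod_topology X Y) (u ` topspace K)"
    by (rule closedin_trans_full)
qed

section \<open>Continuity into and out of k-ifications\<close>

lemma continuous_map_from_kify:
  assumes "\<And>K. compactin X K \<Longrightarrow> Hausdorff_space (subtopology X K) \<Longrightarrow> continuous_map (subtopology X K) Z f"
  shows "continuous_map (kify X) Z f"
  unfolding continuous_map_def
proof (intro conjI allI impI)
  show "f \<in> topspace (kify X) \<rightarrow> topspace Z"
  proof
    fix x assume x: "x \<in> topspace (kify X)"
    then have "compactin X {x}" by simp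
    moreover have "Hausdorff_space (subtopology X {x})"
      by (auto simp: Hausdorff_space_def)
    ultimately have "continuous_map (subtopology X {x}) Z f" by (rule assms)
    then show "f x \<in> topspace Z" using x by (auto simp: continuous_map_def)
  qed
  fix U assume U: "openin Z U"
  show "openin (kify X) {x \<in> topspace (kify X). f x \<in> U}"
    unfolding openin_kify
  proof (intro conjI allI impI)
    fix K assume K: "compactin X K \<and> Hausdorff_space (subtopology X K)"
    then have "openin (subtopology X K) {x \<in> topspace (subtopology X K). f x \<in> U}"
      using openin_continuous_map_preimage[OF _ U] assms by blast
    also have "{x \<in> topspace (subtopology X K). f x \<in> U} = {x \<in> topspace (kify X). f x \<in> U} \<inter> K" by auto
    finally show "openin (subtopology X K) ({x \<in> topspace (kify X). f x \<in> U} \<inter> K)" .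
  qed simp
qed

lemma closedin_kify:
  "closedin (kify X) C \<longleftrightarrow> C \<subseteq> topspace X \<and>
     (\<forall>K. compactin X K \<and> Hausdorff_space (subtopology X K) \<longrightarrow> closedin (subtopology X K) (C \<inter> K))"
proof -
  have "openin (subtopology X K) ((topspace X - C) \<inter> K) \<longleftrightarrow> closedin (subtopology X K) (C \<inter> K)"
    if "C \<subseteq> topspace X" for K
  proof -
    have "topspace (subtopology X K) - C \<inter> K = (topspace X - C) \<inter> K" by auto
    moreover have "C \<inter> K \<subseteq> topspace (subtopology X K)" using that by auto
    ultimately show ?thesis by (simp add: closedin_def)
  qed
  then show ?thesis
    unfolding closedin_def[of "kify X"] topspace_kify openin_kify by auto
qed

text \<open>The standard simplex is compact Hausdorff, so each singular simplex of \<open>X\<close>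
  remains continuous into the finer topology.\<close>

lemma singular_chain_kify:
  assumes X: "weak_Hausdorff_space X" and c: "singular_chain n X c"
  shows "singular_chain n (kify X) c"
proof -
  let ?D = "subtopology (powertop_real UNIV) (standard_simplex n)"
  have "compact_space ?D" by (simp add: compact_space_subtopology compactin_standard_simplex)
  moreover have "Hausdorff_space ?D"
    by (intro Hausdorff_space_subtopology) (simp add: Hausdorff_space_product_topology)
  ultimately show ?thesis
    using c continuous_map_kify[OF X, of ?D] by (auto simp: singular_chain_def singular_simplex_def)
qed

lemma weak_Hausdorff_product_topology:
  fixes Y :: "'i \<Rightarrow> 'a topology"
  assumes Y: "\<And>i. i \<in> I \<Longrightarrow> weak_Hausdorff_space (Y i)"
  shows "weak_Hausdorff_space (product_topology Y I)"
  unfolding weak_Hausdorff_space_def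
proof (intro allI impI)
  fix K :: "('i \<Rightarrow> 'a) set set topology" and u
  assume "compact_space K \<and> Hausdorff_space K \<and> continuous_map K (product_topology Y I) u"
  then have K: "compact_space K" "Hausdorff_space K" and u: "continuous_map K (product_topology Y I) u" by auto
  have ui: "continuous_map K (Y i) (\<lambda>z. u z i)" if "i \<in> I" for i
    using u that by (simp add: continuous_map_componentwise)
  let ?A = "\<lambda>i. (\<lambda>z. u z i) ` topspace K"
  have A: "Hausdorff_space (subtopology (Y i) (?A i))" "closedin (Y i) (?A i)" if "i \<in> I" for i
    using weak_Hausdorff_compact_image[OF Y[OF that] K ui[OF that]] by auto
  have "u z \<in> extensional I" if "z \<in> topspace K" for z
    using u that by (auto simp: continuous_map_componentwise)
  then have sub: "u ` topspace K \<subseteq> PiE I ?A" by (auto simp: PiE_def)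
  have "compactin (product_topology Y I) (u ` topspace K)"
    using image_compactin[OF _ u] K unfolding compact_space_def by blast
  then have "compactin (subtopology (product_topology Y I) (PiE I ?A)) (u ` topspace K)"
    using sub by (simp add: compactin_subtopology)
  moreover have "Hausdorff_space (subtopology (product_topology Y I) (PiE I ?A))"
    using A(1) by (simp add: subtopology_product_topology Hausdorff_space_product_topology)
  ultimately have "closedin (subtopology (product_topology Y I) (PiE I ?A)) (u ` topspace K)"
    by (rule compactin_imp_closedin[rotated])
  moreover have "closedin (product_topology Y I) (PiE I ?A)"
    using A(2) by (simp add: closedin_product_topology)
  ultimately show "closedin (product_topology Y I) (u ` topspace K)"
    by (rule closedin_trans_full)
qed

text \<open>A compact Hausdorff test space that maps continuously into the ordinary product also
  does so into the k-ified one. In this form the continuity axioms for operads, actions and algebras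
  are applied.\<close>

lemma continuous_map_kprod_family:
  assumes f: "continuous_map (kprod_family Y A F) Z f"
    and wh: "weak_Hausdorff_space Y" "\<And>a. a \<in> A \<Longrightarrow> weak_Hausdorff_space (F a)"
    and K: "compact_space K" "Hausdorff_space K"
    and u: "continuous_map K Y u" and v: "\<And>a. a \<in> A \<Longrightarrow> continuous_map K (F a) (v a)"
  shows "continuous_map K Z (\<lambda>z. f (u z, \<lambda>a\<in>A. v a z))"
proof -
  have "continuous_map K (prod_topology Y (product_topology F A)) (\<lambda>z. (u z, \<lambda>a\<in>A. v a z))"
    by (intro continuous_map_pairedI u continuous_map_coordinatewise_then_product) (simp_all add: v)
  moreover have "weak_Hausdorff_space (prod_topology Y (product_topology F A))"
    using wh by (intro weak_Hausdorff_prod_topology weak_Hausdorff_product_topology)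
  ultimately have "continuous_map K (kprod_family Y A F) (\<lambda>z. (u z, \<lambda>a\<in>A. v a z))"
    using continuous_map_kify K by blast
  from continuous_map_compose[OF this f] show ?thesis by (simp add: o_def)
qed

text \<open>The disjoint union of all compact Hausdorff subspaces. The condition
  \<open>kify X = X\<close> says that \<open>X\<close> is a quotient of it, which brings theorems on
  products of quotient maps to bear.\<close>

definition compact_Hausdorff_pieces :: "'a topology \<Rightarrow> ('a set \<times> 'a) topology" where
  "compact_Hausdorff_pieces X =
     sum_topology (subtopology X) {K. compactin X K \<and> Hausdorff_space (subtopology X K)}"

lemma quotient_map_compact_Hausdorff_pieces:
  assumes "kify X = X"
  shows "quotient_map (compact_Hausdorff_pieces X) X snd"
  unfolding quotient_map_def
proof (intro conjI allI impI)
  have sing: "compactin X {x} \<and> Hausdorff_space (subtopology X {x})" if "x \<in> topspace X" for x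
    using that by (auto simp: Hausdorff_space_def)
  then have "x \<in> snd ` topspace (compact_Hausdorff_pieces X)" if "x \<in> topspace X" for x
    using that by (intro image_eqI[of _ _ "({x}, x)"]) (auto simp: compact_Hausdorff_pieces_def)
  then show "snd ` topspace (compact_Hausdorff_pieces X) = topspace X"
    by (auto simp: compact_Hausdorff_pieces_def)
  fix U assume U: "U \<subseteq> topspace X"
  have "{x. (K, x) \<in> {z \<in> topspace (compact_Hausdorff_pieces X). snd z \<in> U}} = U \<inter> K"
    if "compactin X K" "Hausdorff_space (subtopology X K)" for K
    using U that by (auto simp: compact_Hausdorff_pieces_def)
  then have "openin (compact_Hausdorff_pieces X) {z \<in> topspace (compact_Hausdorff_pieces X). snd z \<in> U} \<longleftrightarrow> openin (kify X) U"
    using U by (subst compact_Hausdorff_pieces_def) (auto simp: openin_sum_topology openin_kify compact_Hausdorff_pieces_def)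
  then show "openin (compact_Hausdorff_pieces X) {x. x \<in> topspace (compact_Hausdorff_pieces X) \<and> snd x \<in> U} \<longleftrightarrow> openin X U"
    by (simp add: assms)
qed

text \<open>The product with a locally compact Hausdorff space preserves quotient maps, so
  \<open>L\<close> times the pieces of \<open>Y\<close> is a quotient presentation of
  \<open>L \<times> B\<close>. Each piece is open in the sum, hence continuity can be checked on one
  piece at a time.\<close>

lemma continuous_map_prod_quotient:
  assumes q: "quotient_map Y B q" and Y: "kify Y = Y"
    and L: "locally_compact_space L" "Hausdorff_space L"
    and f: "\<And>K. compactin Y K \<Longrightarrow> Hausdorff_space (subtopology Y K) \<Longrightarrow>
      continuous_map (prod_topology L (subtopology Y K)) Z (\<lambda>(t, y). f (t, q y))"
  shows "continuous_map (prod_topology L B) Z f"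
proof -
  let ?S = "compact_Hausdorff_pieces Y"
  have "quotient_map ?S B (q \<circ> snd)"
    using quotient_map_compact_Hausdorff_pieces[OF Y] q by (rule quotient_map_compose)
  then have quo: "quotient_map (prod_topology L ?S) (prod_topology L B) (\<lambda>(t, z). (t, (q \<circ> snd) z))"
    by (rule quotient_map_prod_right[OF L(1) disjI1[OF L(2)]])
  have "continuous_map (prod_topology L ?S) Z (\<lambda>(t, z). f (t, q (snd z)))"
    unfolding continuous_map_def
  proof (intro conjI allI impI)
    show "(\<lambda>(t, z). f (t, q (snd z))) \<in> topspace (prod_topology L ?S) \<rightarrow> topspace Z"
    proof clarify
      fix t K y assume "(t, K, y) \<in> topspace (prod_topology L ?S)"
      then have K: "compactin Y K" "Hausdorff_space (subtopology Y K)"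
        and ty: "(t, y) \<in> topspace (prod_topology L (subtopology Y K))"
        by (auto simp: compact_Hausdorff_pieces_def)
      show "f (t, q (snd (K, y))) \<in> topspace Z"
        using funcset_mem[OF continuous_map_funspace[OF f[OF K]] ty] by simp
    qed
    fix W assume W: "openin Z W"
    show "openin (prod_topology L ?S) {x \<in> topspace (prod_topology L ?S). (case x of (t, z) \<Rightarrow> f (t, q (snd z))) \<in> W}"
      unfolding openin_prod_topology_alt
    proof (intro allI impI)
      fix t z assume "(t, z) \<in> {x \<in> topspace (prod_topology L ?S). (case x of (t, z) \<Rightarrow> f (t, q (snd z))) \<in> W}"
      then obtain K y where z: "z = (K, y)" "t \<in> topspace L" "y \<in> K" "y \<in> topspace Y" "f (t, q y) \<in> W"
        and K: "compactin Y K" "Hausdorff_space (subtopology Y K)"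
        by (cases z) (auto simp: compact_Hausdorff_pieces_def)
      let ?P = "prod_topology L (subtopology Y K)"
      have "openin ?P {x \<in> topspace ?P. (case x of (t, y) \<Rightarrow> f (t, q y)) \<in> W}"
        by (rule openin_continuous_map_preimage[OF f[OF K] W])
      moreover have "(t, y) \<in> {x \<in> topspace ?P. (case x of (t, y) \<Rightarrow> f (t, q y)) \<in> W}" using z by auto
      ultimately obtain U V where UV: "openin L U" "openin (subtopology Y K) V" "t \<in> U" "y \<in> V"
        "U \<times> V \<subseteq> {x \<in> topspace ?P. (case x of (t, y) \<Rightarrow> f (t, q y)) \<in> W}"
        unfolding openin_prod_topology_alt by meson
      have V: "V \<subseteq> K \<inter> topspace Y" using openin_subset[OF UV(2)] by auto
      have "openin ?S ({K} \<times> V)"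
        unfolding compact_Hausdorff_pieces_def openin_sum_topology
      proof (intro conjI ballI)
        show "{K} \<times> V \<subseteq> Sigma {K. compactin Y K \<and> Hausdorff_space (subtopology Y K)} (topspace \<circ> subtopology Y)"
          using K V by auto
        show "openin (subtopology Y K') {x. (K', x) \<in> {K} \<times> V}" for K'
          using UV(2) by (cases "K' = K") auto
      qed
      moreover have "U \<times> ({K} \<times> V) \<subseteq> {x \<in> topspace (prod_topology L ?S). (case x of (t, z) \<Rightarrow> f (t, q (snd z))) \<in> W}"
        using UV(5) K V by (auto simp: compact_Hausdorff_pieces_def)
      ultimately show "\<exists>U V. openin L U \<and> openin ?S V \<and> t \<in> U \<and> z \<in> V \<and>
          U \<times> V \<subseteq> {x \<in> topspace (prod_topology L ?S). (case x of (t, z) \<Rightarrow> f (t, q (snd z))) \<in> W}"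
        using UV(1,3,4) z(1) by blast
    qed
  qed
  then have "continuous_map (prod_topology L ?S) Z (f \<circ> (\<lambda>(t, z). (t, (q \<circ> snd) z)))"
    by (simp add: o_def case_prod_unfold)
  then show ?thesis by (rule continuous_compose_quotient_map[OF quo])
qed

section \<open>Orbit spaces\<close>

lemma topspace_orbit_space [simp]: "topspace (orbit_space \<Gamma> act X) = orbits \<Gamma> (topspace X) act"
proof
  show "topspace (orbit_space \<Gamma> act X) \<subseteq> orbits \<Gamma> (topspace X) act"
    using openin_topspace openin_orbit_space by blast
  have "{x \<in> topspace X. orbit \<Gamma> act x \<in> orbits \<Gamma> (topspace X) act} = topspace X"
    by (auto simp: orbits_def)
  then have "openin (orbit_space \<Gamma> act X) (orbits \<Gamma> (topspace X) act)"
    by (simp add: openin_orbit_space)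
  then show "orbits \<Gamma> (topspace X) act \<subseteq> topspace (orbit_space \<Gamma> act X)" by (rule openin_subset)
qed

lemma quotient_map_orbit_space: "quotient_map X (orbit_space \<Gamma> act X) (orbit \<Gamma> act)"
  unfolding quotient_map_def by (auto simp: openin_orbit_space orbits_def)

lemma orbit_eq_iff:
  assumes G: "group \<Gamma>" and act: "G_space \<Gamma> act X" and x: "x \<in> topspace X" "y \<in> topspace X"
  shows "orbit \<Gamma> act x = orbit \<Gamma> act y \<longleftrightarrow> (\<exists>g\<in>carrier \<Gamma>. y = act g x)"
proof -
  interpret group \<Gamma> by (rule G)
  have m: "act (g \<otimes>\<^bsub>\<Gamma>\<^esub> h) z = act g (act h z)" if "g \<in> carrier \<Gamma>" "h \<in> carrier \<Gamma>" "z \<in> topspace X" for g h z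
    using act that unfolding G_space_def by blast
  have 1: "act \<one>\<^bsub>\<Gamma>\<^esub> z = z" if "z \<in> topspace X" for z
    using act that unfolding G_space_def by blast
  show ?thesis
  proof
    assume "orbit \<Gamma> act x = orbit \<Gamma> act y"
    moreover have "y \<in> orbit \<Gamma> act y" using 1[OF x(2)] by (force simp: orbit_def)
    ultimately show "\<exists>g\<in>carrier \<Gamma>. y = act g x" by (auto simp: orbit_def)
  next
    assume "\<exists>g\<in>carrier \<Gamma>. y = act g x"
    then obtain g where g: "g \<in> carrier \<Gamma>" "y = act g x" by blast
    show "orbit \<Gamma> act x = orbit \<Gamma> act y"
    proof (intro equalityI subsetI)
      fix z assume "z \<in> orbit \<Gamma> act x"
      then obtain h where h: "h \<in> carrier \<Gamma>" "z = act h x" by (auto simp: orbit_def)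
      have "z = act (h \<otimes>\<^bsub>\<Gamma>\<^esub> inv\<^bsub>\<Gamma>\<^esub> g \<otimes>\<^bsub>\<Gamma>\<^esub> g) x" using h g by (simp add: m_assoc)
      also have "\<dots> = act (h \<otimes>\<^bsub>\<Gamma>\<^esub> inv\<^bsub>\<Gamma>\<^esub> g) y" using h g x by (subst m) auto
      finally show "z \<in> orbit \<Gamma> act y" using h(1) g(1) unfolding orbit_def by blast
    next
      fix z assume "z \<in> orbit \<Gamma> act y"
      then obtain h where h: "h \<in> carrier \<Gamma>" "z = act h y" by (auto simp: orbit_def)
      then have "z = act (h \<otimes>\<^bsub>\<Gamma>\<^esub> g) x" using g x by (simp add: m)
      then show "z \<in> orbit \<Gamma> act x" using h(1) g(1) unfolding orbit_def by blast
    qed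
  qed
qed

text \<open>
  A compact Hausdorff subset of \<open>X\<close> lies in an invariant one, \<open>M\<close>, and the image of \<open>M\<close> in the
  orbit space is again compact Hausdorff, since the orbit map of a finite group is closed on \<open>M\<close>.
\<close>

lemma weak_Hausdorff_orbit_space:
  assumes k: "kify X = X" and X: "weak_Hausdorff_space X"
    and G: "group \<Gamma>" "finite (carrier \<Gamma>)" and act: "G_space \<Gamma> act X"
  shows "weak_Hausdorff_space (orbit_space \<Gamma> act X)"
  unfolding weak_Hausdorff_space_def
proof (intro allI impI)
  interpret group \<Gamma> by (rule G)
  let ?O = "orbit_space \<Gamma> act X" and ?q = "orbit \<Gamma> act"
  fix K :: "'a set set set topology" and u
  assume "compact_space K \<and> Hausdorff_space K \<and> continuous_map K ?O u"
  then have K: "compact_space K" "Hausdorff_space K" and u: "continuous_map K ?O u" by auto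
  have quo: "quotient_map X ?O ?q" by (rule quotient_map_orbit_space)
  then have q: "continuous_map X ?O ?q" by (rule quotient_imp_continuous_map)
  have closedO: "closedin ?O U \<longleftrightarrow> closedin X {x \<in> topspace X. ?q x \<in> U}" if "U \<subseteq> topspace ?O" for U
    using quo that unfolding quotient_map_closedin by blast
  have cont: "continuous_map X X (act g)" if "g \<in> carrier \<Gamma>" for g
    using act that by (simp add: G_space_def)
  have actX: "act g x \<in> topspace X" if "g \<in> carrier \<Gamma>" "x \<in> topspace X" for g x
    using cont[OF that(1)] that(2) by (auto simp: continuous_map_def)
  have qeq: "?q x = ?q y \<longleftrightarrow> (\<exists>g\<in>carrier \<Gamma>. y = act g x)" if "x \<in> topspace X" "y \<in> topspace X" for x y
    by (rule orbit_eq_iff[OF G(1) act that])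
  have pre: "{x \<in> topspace X. ?q x \<in> ?q ` C} = (\<Union>g\<in>carrier \<Gamma>. act g ` C)" if "C \<subseteq> topspace X" for C
    using that qeq actX by (auto simp: image_iff) (metis subsetD)+
  let ?C = "{x \<in> topspace X. ?q x \<in> u ` topspace K}"
  have "closedin (kify X) ?C"
    unfolding closedin_kify
  proof (intro conjI allI impI)
    fix L assume L: "compactin X L \<and> Hausdorff_space (subtopology X L)"
    then have LX: "L \<subseteq> topspace X" by (simp add: compactin_subset_topspace)
    define M where "M = (\<Union>g\<in>carrier \<Gamma>. act g ` L)"
    have MX: "M \<subseteq> topspace X" using LX actX by (auto simp: M_def)
    have LM: "L \<subseteq> M"
    proof
      fix x assume "x \<in> L"
      then have "act \<one>\<^bsub>\<Gamma>\<^esub> x = x" using LX act unfolding G_space_def by blast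
      then show "x \<in> M" using \<open>x \<in> L\<close> unfolding M_def by force
    qed
    \<comment> \<open>\<open>M\<close> is the image of this compact Hausdorff space under the action
      map; finiteness of the group makes the discrete factor compact.\<close>
    let ?D = "prod_topology (discrete_topology (carrier \<Gamma>)) (subtopology X L)"
    have D: "compact_space ?D" "Hausdorff_space ?D"
      using L G(2) by (simp_all add: compact_space_prod_topology compact_space_discrete_topology
          compact_space_subtopology Hausdorff_space_prod_topology)
    have contD: "continuous_map ?D X (\<lambda>(g, x). act g x)"
      unfolding continuous_map_def
    proof (intro conjI allI impI)
      show "(\<lambda>(g, x). act g x) \<in> topspace ?D \<rightarrow> topspace X" using actX by auto
      fix W assume W: "openin X W"
      show "openin ?D {z \<in> topspace ?D. (case z of (g, x) \<Rightarrow> act g x) \<in> W}"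
        unfolding openin_prod_topology_alt
      proof (intro allI impI)
        fix g x assume gx: "(g, x) \<in> {z \<in> topspace ?D. (case z of (g, x) \<Rightarrow> act g x) \<in> W}"
        then have "openin (subtopology X L) {x \<in> topspace (subtopology X L). act g x \<in> W}"
          using openin_continuous_map_preimage[OF continuous_map_from_subtopology[OF cont] W] by auto
        then show "\<exists>U V. openin (discrete_topology (carrier \<Gamma>)) U \<and> openin (subtopology X L) V \<and> g \<in> U \<and> x \<in> V \<and>
            U \<times> V \<subseteq> {z \<in> topspace ?D. (case z of (g, x) \<Rightarrow> act g x) \<in> W}"
          using gx by (intro exI[of _ "{g}"] exI[of _ "{x \<in> topspace (subtopology X L). act g x \<in> W}"]) auto
      qed
    qed
    have imD: "(\<lambda>(g, x). act g x) ` topspace ?D = M" using LX by (force simp: M_def)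
    have M: "compactin X M" "Hausdorff_space (subtopology X M)" "closedin X M"
      using weak_Hausdorff_compact_image[OF X D contD] unfolding imD by auto
    have preM: "{x \<in> topspace X. ?q x \<in> ?q ` M} = M"
    proof -
      have sub: "act g ` M \<subseteq> M" if g: "g \<in> carrier \<Gamma>" for g
      proof clarify
        fix y assume "y \<in> M"
        then obtain h x where h: "h \<in> carrier \<Gamma>" "x \<in> L" "y = act h x" by (auto simp: M_def)
        then have "act g y = act (g \<otimes>\<^bsub>\<Gamma>\<^esub> h) x" using g act LX unfolding G_space_def by auto
        then show "act g y \<in> M" using g h unfolding M_def by blast
      qed
      have "M \<subseteq> act \<one>\<^bsub>\<Gamma>\<^esub> ` M"
      proof
        fix x assume "x \<in> M"
        moreover have "act \<one>\<^bsub>\<Gamma>\<^esub> x = x" using \<open>x \<in> M\<close> MX act unfolding G_space_def by blast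
        ultimately show "x \<in> act \<one>\<^bsub>\<Gamma>\<^esub> ` M" by (metis imageI)
      qed
      then have "M \<subseteq> (\<Union>g\<in>carrier \<Gamma>. act g ` M)" by (rule subset_trans) (rule UN_upper[OF one_closed])
      then have "(\<Union>g\<in>carrier \<Gamma>. act g ` M) = M" by (intro equalityI UN_least sub)
      then show ?thesis using pre[OF MX] by simp
    qed
    have qMO: "?q ` M \<subseteq> topspace ?O" using MX by (auto simp: orbits_def)
    have clqM: "closedin ?O (?q ` M)" using closedO[OF qMO] preM M(3) by simp
    have tM: "topspace (subtopology X M) = M" "topspace (subtopology ?O (?q ` M)) = ?q ` M"
      using MX qMO by auto
    have "Hausdorff_space (subtopology ?O (?q ` M))"
    proof (rule Hausdorff_space_closed_image[of "subtopology X M" _ ?q])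
      show "compact_space (subtopology X M)" by (rule compact_space_subtopology[OF M(1)])
      show "continuous_map (subtopology X M) (subtopology ?O (?q ` M)) ?q"
        using q by (auto simp: continuous_map_in_subtopology continuous_map_from_subtopology)
      \<comment> \<open>The preimage of the image of \<open>C\<close> is a finite union of
        translates of \<open>C\<close>, each compact Hausdorff and hence closed in
        \<open>X\<close>.\<close>
      have "closed_map (subtopology X M) ?O ?q"
        unfolding closed_map_def
      proof (intro allI impI)
        fix C assume C: "closedin (subtopology X M) C"
        then have CX: "C \<subseteq> topspace X" and "C \<subseteq> M" using closedin_subset by fastforce+
        have "compactin X C"
          using closedin_compact_space[OF compact_space_subtopology[OF M(1)] C] by (simp add: compactin_subtopology)
        moreover have "Hausdorff_space (subtopology X C)"
          using M(2) \<open>C \<subseteq> M\<close> by (metis Hausdorff_space_subtopology inf.absorb2 subtopology_subtopology)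
        ultimately have "closedin X (act g ` C)" if "g \<in> carrier \<Gamma>" for g
          using weak_Hausdorff_compact_subset_image(3)[OF X _ _ cont[OF that]] by blast
        then have "closedin X (\<Union>g\<in>carrier \<Gamma>. act g ` C)" using G(2) by (intro closedin_Union) auto
        then have "closedin X {x \<in> topspace X. ?q x \<in> ?q ` C}" using pre[OF CX] by simp
        moreover have "?q ` C \<subseteq> topspace ?O" using CX by (auto simp: orbits_def)
        ultimately show "closedin ?O (?q ` C)" using closedO by blast
      qed
      then show "closed_map (subtopology X M) (subtopology ?O (?q ` M)) ?q"
        by (rule closed_map_into_subtopology) (auto simp: tM)
    qed (use M tM in auto)
    moreover have "compactin (subtopology ?O (?q ` M)) (u ` {x \<in> topspace K. u x \<in> ?q ` M})"
    proof -
      have "closedin K {x \<in> topspace K. u x \<in> ?q ` M}" by (rule closedin_continuous_map_preimage[OF u clqM])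
      then have "compactin K {x \<in> topspace K. u x \<in> ?q ` M}" using K(1) closedin_compact_space by blast
      then have "compactin ?O (u ` {x \<in> topspace K. u x \<in> ?q ` M})" by (rule image_compactin[OF _ u])
      then show ?thesis by (auto simp: compactin_subtopology)
    qed
    ultimately have "closedin (subtopology ?O (?q ` M)) (u ` {x \<in> topspace K. u x \<in> ?q ` M})"
      by (rule compactin_imp_closedin)
    then have "closedin ?O (u ` {x \<in> topspace K. u x \<in> ?q ` M})"
      using clqM by (rule closedin_trans_full)
    then have "closedin X {x \<in> topspace X. ?q x \<in> u ` {x \<in> topspace K. u x \<in> ?q ` M}}"
      by (rule closedin_continuous_map_preimage[OF q])
    \<comment> \<open>A point of \<open>L\<close> has its orbit in the image of \<open>M\<close>, so
      only that part of the image of \<open>u\<close> is seen on \<open>L\<close>.\<close>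
    moreover have "?C \<inter> L = {x \<in> topspace X. ?q x \<in> u ` {x \<in> topspace K. u x \<in> ?q ` M}} \<inter> L"
      using LM by auto
    ultimately show "closedin (subtopology X L) (?C \<inter> L)"
      unfolding closedin_subtopology by (intro exI conjI)
  qed auto
  then have "closedin X ?C" by (simp add: k)
  moreover have "u ` topspace K \<subseteq> topspace ?O" using u by (auto simp: continuous_map_def)
  ultimately show "closedin ?O (u ` topspace K)" using closedO by blast
qed

section \<open>Operads and their actions\<close>

lemma tuple_cong: "(\<And>a. a \<in> A \<Longrightarrow> f a = g a) \<Longrightarrow> tuple A f = tuple A g"
  unfolding tuple_def by (intro arg_cong[where f = "\<lambda>S. Tup (Abs_fset S)"] image_cong) auto

lemma tuple_in_dprod:
  assumes "\<And>a. a \<in> A \<Longrightarrow> f a \<in> B a"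
  shows "tuple A f \<in> dprod A B"
proof -
  have "tuple A f = tuple A (restrict f A)" by (rule tuple_cong) simp
  then show ?thesis using assms unfolding dprod_def by auto
qed

lemma dprodD:
  assumes "u \<in> dprod A B" "finite A"
  shows "a \<in> A \<Longrightarrow> proj u a \<in> B a" "tuple A (proj u) = u"
proof -
  obtain f where f: "u = tuple A f" "f \<in> (\<Pi>\<^sub>E a\<in>A. B a)" using assms(1) by (auto simp: dprod_def)
  then show "a \<in> A \<Longrightarrow> proj u a \<in> B a" using assms(2) by auto
  show "tuple A (proj u) = u" unfolding f(1) by (rule tuple_cong) (use assms(2) in auto)
qed

lemma finite_dprod: "finite_family A B \<Longrightarrow> finite (dprod A B)"
  by (auto simp: dprod_def intro!: finite_PiE)

lemma finite_std [simp]: "finite (std n)"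
  by (simp add: std_def)

lemma std_1: "std 1 = {Pt 1}"
  by (auto simp: std_def)

lemma std_2: "std 2 = {Pt 1, Pt 2}"
proof -
  have "{1..2::nat} = {1, 2}" by auto
  then show ?thesis by (simp add: std_def)
qed

lemma dprod_singleton_eta: "u \<in> dprod {e} B \<Longrightarrow> tuple {e} (\<lambda>_. proj u e) = u"
  using dprodD(2)[of u "{e}" B] tuple_cong[of "{e}" "\<lambda>_. proj u e" "proj u"] by simp

lemma bij_betw_dprod_singleton: "bij_betw (\<lambda>u. proj u e) (dprod {e} (\<lambda>_. S)) S"
proof (rule bij_betw_byWitness[where f' = "\<lambda>s. tuple {e} (\<lambda>_. s)"])
  show "\<forall>u\<in>dprod {e} (\<lambda>_. S). tuple {e} (\<lambda>_. proj u e) = u" by (simp add: dprod_singleton_eta)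
  show "(\<lambda>u. proj u e) ` dprod {e} (\<lambda>_. S) \<subseteq> S" using dprodD(1)[of _ "{e}" "\<lambda>_. S" e] by auto
  show "(\<lambda>s. tuple {e} (\<lambda>_. s)) ` S \<subseteq> dprod {e} (\<lambda>_. S)" using tuple_in_dprod[of "{e}"] by auto
qed simp

lemma bij_betw_singleton_dprod: "bij_betw (\<lambda>s. tuple {e} (\<lambda>_. s)) S (dprod {e} (\<lambda>_. S))"
proof (rule bij_betw_byWitness[where f' = "\<lambda>u. proj u e"])
  show "\<forall>u\<in>dprod {e} (\<lambda>_. S). tuple {e} (\<lambda>_. proj u e) = u" by (simp add: dprod_singleton_eta)
  show "(\<lambda>u. proj u e) ` dprod {e} (\<lambda>_. S) \<subseteq> S" using dprodD(1)[of _ "{e}" "\<lambda>_. S" e] by auto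
  show "(\<lambda>s. tuple {e} (\<lambda>_. s)) ` S \<subseteq> dprod {e} (\<lambda>_. S)" using tuple_in_dprod[of "{e}"] by auto
qed simp

lemma dprod_empty: "dprod {} B = {tuple {} t}"
  by (auto simp: dprod_def tuple_def)

section \<open>Consequences of the axioms for operads, algebras and actions\<close>

lemma operad_cgwh:
  assumes "operad \<O>" "finite A"
  shows "cgwh_space (op_space \<O> A)"
  using assms(1)[unfolded operad_def, THEN conjunct1] assms(2) by blast

lemma operad_map_continuous:
  assumes "operad \<O>" "finite A" "bij_betw \<sigma> A A'"
  shows "continuous_map (op_space \<O> A) (op_space \<O> A') (op_map \<O> A A' \<sigma>)"
  using assms(1)[unfolded operad_def, THEN conjunct2, THEN conjunct1] assms(2-) by blast

lemma operad_map_closed: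
  assumes "operad \<O>" "finite A" "bij_betw \<sigma> A A'" "c \<in> op_pts \<O> A"
  shows "op_map \<O> A A' \<sigma> c \<in> op_pts \<O> A'"
  using continuous_map_funspace[OF operad_map_continuous[OF assms(1-3)]] assms(4) by (rule funcset_mem)

lemma operad_map_ident:
  assumes "operad \<O>" "finite A" "\<And>a. a \<in> A \<Longrightarrow> \<sigma> a = a" "c \<in> op_pts \<O> A"
  shows "op_map \<O> A A \<sigma> c = c"
  using assms(1)[unfolded operad_def, THEN conjunct2, THEN conjunct2, THEN conjunct1] assms(2-) by blast

lemma operad_map_compose:
  assumes "operad \<O>" "finite A" "bij_betw \<sigma> A A'" "bij_betw \<tau> A' A''" "c \<in> op_pts \<O> A"
  shows "op_map \<O> A' A'' \<tau> (op_map \<O> A A' \<sigma> c) = op_map \<O> A A'' (\<tau> \<circ> \<sigma>) c"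
  using assms(1)[unfolded operad_def, THEN conjunct2, THEN conjunct2, THEN conjunct2, THEN conjunct1] assms(2-) by simp

text \<open>Functoriality does not directly compare two functions that agree only on
  \<open>A\<close>. Precomposing both with a retraction \<open>?\<rho>\<close> onto \<open>A\<close>
  makes them equal everywhere, and \<open>?\<rho>\<close> acts as the identity because it fixes
  \<open>A\<close>.\<close>

lemma operad_map_cong:
  assumes O: "operad \<O>" and A: "finite A" and \<sigma>: "bij_betw \<sigma> A A'"
    and eq: "\<And>a. a \<in> A \<Longrightarrow> \<sigma> a = \<tau> a" and c: "c \<in> op_pts \<O> A"
  shows "op_map \<O> A A' \<sigma> c = op_map \<O> A A' \<tau> c"
proof (cases "A = {}")
  case True
  then have "A' = {}" using \<sigma> by (simp add: bij_betw_def)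
  then show ?thesis using True operad_map_ident[OF O A _ c] by simp
next
  case False
  then obtain a where a: "a \<in> A" by blast
  let ?\<rho> = "\<lambda>x. if x \<in> A then x else a"
  have \<tau>: "bij_betw \<tau> A A'" using \<sigma> eq bij_betw_cong by blast
  have \<rho>: "bij_betw ?\<rho> A A" by (rule bij_betw_cong[THEN iffD1, OF _ bij_betw_id]) simp
  have "\<sigma> \<circ> ?\<rho> = \<tau> \<circ> ?\<rho>" using eq a by auto
  moreover have "op_map \<O> A A ?\<rho> c = c" by (rule operad_map_ident[OF O A _ c]) simp
  ultimately show ?thesis
    using operad_map_compose[OF O A \<rho> \<sigma> c] operad_map_compose[OF O A \<rho> \<tau> c] by simp
qed

lemma operad_comp_closed:
  assumes "operad \<O>" "finite_family A B" "g \<in> op_pts \<O> A" "c \<in> op_fam \<O> A B"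
  shows "op_comp \<O> A B g c \<in> op_pts \<O> (dsum A B)"
proof -
  have "\<forall>A B. finite_family A B \<longrightarrow>
       continuous_map (kprod_family (op_space \<O> A) A (\<lambda>a. op_space \<O> (B a)))
         (op_space \<O> (dsum A B)) (\<lambda>(g, c). op_comp \<O> A B g c)"
    by (rule assms(1)[unfolded operad_def, THEN conjunct2, THEN conjunct2, THEN conjunct2, THEN conjunct2, THEN conjunct2, THEN conjunct2, THEN conjunct1])
  then have "continuous_map (kprod_family (op_space \<O> A) A (\<lambda>a. op_space \<O> (B a)))
         (op_space \<O> (dsum A B)) (\<lambda>(g, c). op_comp \<O> A B g c)"
    using assms(2) by blast
  from funcset_mem[OF continuous_map_funspace[OF this], of "(g, c)"] assms(3,4) show ?thesis by simp
qed

lemma operad_unit: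
  assumes "operad \<O>"
  shows "op_unit \<O> \<in> op_pts \<O> (std 1)"
  by (rule assms[unfolded operad_def, THEN conjunct2, THEN conjunct2, THEN conjunct2, THEN conjunct2, THEN conjunct2, THEN conjunct1])

lemma operad_empty:
  assumes "operad \<O>"
  shows "\<exists>c. op_pts \<O> {} = {c}"
  by (rule assms[unfolded operad_def, THEN conjunct2, THEN conjunct2, THEN conjunct2, THEN conjunct2, THEN conjunct1])

lemma bij_betw_singletons: "bij_betw (\<lambda>_. b) {a} {b}"
  by (simp add: bij_betw_def)

lemma unit_at_closed: "operad \<O> \<Longrightarrow> unit_at \<O> a \<in> op_pts \<O> {a}"
  unfolding unit_at_def using operad_map_closed[OF _ _ bij_betw_singletons[of a "Pt 1"]] operad_unit
  by (metis finite.simps std_1)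

lemma operad_algebra_continuous:
  assumes "operad_algebra \<O> X \<theta>" "finite A"
  shows "continuous_map (kprod_family (op_space \<O> A) A (\<lambda>_. X)) X (\<lambda>(c, x). \<theta> A c x)"
  using assms(1)[unfolded operad_algebra_def, THEN conjunct1] assms(2-) by blast

lemma operad_algebra_map:
  assumes "operad_algebra \<O> X \<theta>" "finite A" "bij_betw \<sigma> A A'" "c \<in> op_pts \<O> A" "x \<in> (\<Pi>\<^sub>E a\<in>A'. topspace X)"
  shows "\<theta> A' (op_map \<O> A A' \<sigma> c) x = \<theta> A c (\<lambda>a\<in>A. x (\<sigma> a))"
  using assms(1)[unfolded operad_algebra_def, THEN conjunct2, THEN conjunct1] assms(2-) by blast

lemma operad_algebra_map_const:
  assumes "operad_algebra \<O> X \<theta>" "finite A" "bij_betw \<sigma> A A'" "c \<in> op_pts \<O> A" "z \<in> topspace X"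
  shows "\<theta> A' (op_map \<O> A A' \<sigma> c) (\<lambda>_\<in>A'. z) = \<theta> A c (\<lambda>_\<in>A. z)"
proof -
  have "(\<lambda>a\<in>A. (\<lambda>_\<in>A'. z) (\<sigma> a)) = (\<lambda>_\<in>A. z)"
    using assms(3) by (auto simp: bij_betw_def)
  then show ?thesis using operad_algebra_map[OF assms(1-4), of "\<lambda>_\<in>A'. z"] assms(5) by simp
qed

lemma operad_algebra_unit:
  assumes "operad_algebra \<O> X \<theta>" "x \<in> topspace X"
  shows "\<theta> {a} (unit_at \<O> a) (\<lambda>_\<in>{a}. x) = x"
  using assms(1)[unfolded operad_algebra_def, THEN conjunct2, THEN conjunct2, THEN conjunct1] assms(2-) by blast

lemma operad_algebra_closed:
  assumes "operad_algebra \<O> X \<theta>" "finite A" "c \<in> op_pts \<O> A" "x \<in> (\<Pi>\<^sub>E a\<in>A. topspace X)"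
  shows "\<theta> A c x \<in> topspace X"
  using funcset_mem[OF continuous_map_funspace[OF operad_algebra_continuous[OF assms(1,2)]], of "(c, x)"]
    assms(3,4) by simp

lemma operad_action_continuous:
  assumes "operad_action \<G> \<C> lam" "finite_family A B"
  shows "continuous_map (kprod_family (op_space \<G> A) A (\<lambda>a. op_space \<C> (B a)))
         (op_space \<C> (dprod A B)) (\<lambda>(g, c). lam A B g c)"
  using assms(1)[unfolded operad_action_def, THEN conjunct1] assms(2) by blast

lemma operad_action_closed:
  assumes "operad_action \<G> \<C> lam" "finite_family A B" "g \<in> op_pts \<G> A" "c \<in> op_fam \<C> A B"
  shows "lam A B g c \<in> op_pts \<C> (dprod A B)"
  using funcset_mem[OF continuous_map_funspace[OF operad_action_continuous[OF assms(1,2)]], of "(g, c)"]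
    assms(3,4) by simp

lemma operad_action_map:
  assumes "operad_action \<G> \<C> lam" "finite_family A B" "bij_betw \<sigma> A A'"
    "\<And>a. a \<in> A \<Longrightarrow> bij_betw (\<tau> a) (B a) (B' (\<sigma> a))" "g \<in> op_pts \<G> A" "c \<in> op_fam \<C> A B"
  shows "lam A' B' (op_map \<G> A A' \<sigma> g) (fam_map \<C> A B A' B' \<sigma> \<tau> c) =
          op_map \<C> (dprod A B) (dprod A' B')
            (\<lambda>u. tuple A' (\<lambda>a'. let a = inv_into A \<sigma> a' in \<tau> a (proj u a))) (lam A B g c)"
  using assms(1)[unfolded operad_action_def, THEN conjunct2, THEN conjunct1] assms(2-) by blast

lemma operad_action_unit:
  assumes "operad_action \<G> \<C> lam" "finite B" "c \<in> op_pts \<C> B"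
  shows "lam {a} (\<lambda>_. B) (unit_at \<G> a) (\<lambda>_\<in>{a}. c) =
       op_map \<C> B (dprod {a} (\<lambda>_. B)) (\<lambda>b. tuple {a} (\<lambda>_. b)) c"
  using assms(1)[unfolded operad_action_def, THEN conjunct2, THEN conjunct2, THEN conjunct1] assms(2-) by blast

lemma operad_action_units:
  assumes "operad_action \<G> \<C> lam" "finite A" "g \<in> op_pts \<G> A"
  shows "lam A (\<lambda>a. {t a}) g (\<lambda>a\<in>A. unit_at \<C> (t a)) = unit_at \<C> (tuple A t)"
  using assms(1)[unfolded operad_action_def, THEN conjunct2, THEN conjunct2, THEN conjunct2, THEN conjunct1] assms(2-) by blast

lemma operad_action_comp:
  assumes "operad_action \<G> \<C> lam" "finite_family A B" "finite_family (dsum A B) D"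
    "g \<in> op_pts \<G> A" "h \<in> op_fam \<G> A B" "c \<in> op_fam \<C> (dsum A B) D"
  shows "op_map \<C> (dprod (dsum A B) D) (dprod A (\<lambda>a. dprod (B a) (\<lambda>b. D (IPair a b))))
            (\<lambda>u. tuple A (\<lambda>a. tuple (B a) (\<lambda>b. proj u (IPair a b))))
            (lam (dsum A B) D (op_comp \<G> A B g h) c) =
          lam A (\<lambda>a. dprod (B a) (\<lambda>b. D (IPair a b))) g
            (\<lambda>a\<in>A. lam (B a) (\<lambda>b. D (IPair a b)) (h a) (\<lambda>b\<in>B a. c (IPair a b)))"
  using assms(1)[unfolded operad_action_def, THEN conjunct2, THEN conjunct2, THEN conjunct2, THEN conjunct2, THEN conjunct1] assms(2-) by blast

lemma einf_ring_space_distrib: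
  assumes "einf_ring_space \<C> \<G> lam X \<theta> \<xi>" "finite_family A B"
    "g \<in> op_pts \<G> A" "c \<in> op_fam \<C> A B" "x \<in> (\<Pi>\<^sub>E u\<in>dsum A B. topspace X)"
  shows "\<xi> A g (\<lambda>a\<in>A. \<theta> (B a) (c a) (\<lambda>b\<in>B a. x (IPair a b))) =
          \<theta> (dprod A B) (lam A B g c) (\<lambda>u\<in>dprod A B. \<xi> A g (\<lambda>a\<in>A. x (IPair a (proj u a))))"
  using assms(1)[unfolded einf_ring_space_def, THEN conjunct2, THEN conjunct2, THEN conjunct2] assms(2-) by blast

text \<open>Over the empty index set the unit law applies with singletons as the family.
  \<open>lam\<close> still takes \<open>B\<close> as an argument, and naturality along the identity
  of the empty set shows that the value does not depend on it.\<close>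

lemma operad_action_empty:
  assumes act: "operad_action \<G> \<C> lam" and G: "operad \<G>" and C: "operad \<C>" and g: "g \<in> op_pts \<G> {}"
  shows "lam {} B g (\<lambda>_. undefined) = unit_at \<C> (tuple {} t)"
proof -
  let ?B = "\<lambda>a. {t a}"
  have u: "lam {} ?B g (\<lambda>_. undefined) = unit_at \<C> (tuple {} t)"
    using operad_action_units[OF act _ g, of t] by (simp add: restrict_def)
  have "op_map \<G> {} {} id g = g" by (rule operad_map_ident[OF G _ _ g]) auto
  moreover have "fam_map \<C> {} ?B {} B id (\<lambda>_. id) (\<lambda>_. undefined) = (\<lambda>_. undefined)"
    by (simp add: fam_map_def restrict_def)
  ultimately have "lam {} B g (\<lambda>_. undefined) = op_map \<C> (dprod {} ?B) (dprod {} B)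
      (\<lambda>u. tuple {} (\<lambda>a'. let a = inv_into {} id a' in id (proj u a))) (unit_at \<C> (tuple {} t))"
    using operad_action_map[OF act, of "{}" ?B id "{}" "\<lambda>_. id" B g "\<lambda>_. undefined"] g u by simp
  also have "\<dots> = unit_at \<C> (tuple {} t)"
    unfolding dprod_empty[of _ t]
    by (rule operad_map_ident[OF C _ _ unit_at_closed[OF C]]) (auto simp: tuple_def)
  finally show ?thesis .
qed

text \<open>Contractibility gives a path from the unit over \<open>std 1\<close>; relabelling
  carries it to \<open>{e}\<close>, the index set over which the composite operation will
  live.\<close>

lemma operad_path:
  assumes O: "operad \<O>" and contr: "contractible_space (op_space \<O> (std 1))" and h: "h \<in> op_pts \<O> {e}"
  obtains \<gamma> where "continuous_map (top_of_set {0..1::real}) (op_space \<O> {e}) \<gamma>" "\<gamma> 0 = unit_at \<O> e" "\<gamma> 1 = h"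
proof -
  let ?P = "op_space \<O> (std 1)"
  have s: "bij_betw (\<lambda>_. e) (std 1) {e}" "bij_betw (\<lambda>_. Pt 1) {e} (std 1)"
    unfolding std_1 by (rule bij_betw_singletons)+
  let ?h = "op_map \<O> {e} (std 1) (\<lambda>_. Pt 1) h"
  have h': "?h \<in> topspace ?P" by (rule operad_map_closed[OF O _ s(2) h]) simp
  have "path_connected_space ?P" using contr by (rule contractible_imp_path_connected_space)
  then obtain p where p: "pathin ?P p" "p 0 = op_unit \<O>" "p 1 = ?h"
    using h' operad_unit[OF O] unfolding path_connected_space_def by blast
  show thesis
  proof (rule that[of "op_map \<O> (std 1) {e} (\<lambda>_. e) \<circ> p"])
    show "continuous_map (top_of_set {0..1::real}) (op_space \<O> {e}) (op_map \<O> (std 1) {e} (\<lambda>_. e) \<circ> p)"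
      using p(1) unfolding pathin_def
      by (rule continuous_map_compose) (rule operad_map_continuous[OF O finite_std s(1)])
    show "(op_map \<O> (std 1) {e} (\<lambda>_. e) \<circ> p) 0 = unit_at \<O> e" by (simp add: p(2) unit_at_def)
    have "op_map \<O> (std 1) {e} (\<lambda>_. e) ?h = op_map \<O> {e} {e} ((\<lambda>_. e) \<circ> (\<lambda>_. Pt 1)) h"
      by (rule operad_map_compose[OF O _ s(2) s(1) h]) simp
    also have "\<dots> = h" by (rule operad_map_ident[OF O _ _ h]) auto
    finally show "(op_map \<O> (std 1) {e} (\<lambda>_. e) \<circ> p) 1 = h" by (simp add: p(3))
  qed
qed

section \<open>The action of \<open>H\<^sub>*(\<Sigma>\<^sub>k)\<close> and multiplication\<close>

lemma lift_perm_Pt [simp]: "lift_perm \<sigma> (Pt i) = Pt (\<sigma> i)"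
  by (simp add: lift_perm_def)

lemma bij_betw_lift_perm:
  assumes "\<sigma> \<in> carrier (sym_group n)"
  shows "bij_betw (lift_perm \<sigma>) (std n) (std n)"
proof -
  have "\<sigma> permutes {1..n}" using assms by (simp add: sym_group_carrier)
  then have "bij_betw \<sigma> {1..n} {1..n}" by (rule permutes_imp_bij)
  then have "inj_on \<sigma> {1..n}" "\<sigma> ` {1..n} = {1..n}" by (auto simp: bij_betw_def)
  moreover have "lift_perm \<sigma> ` std n = Pt ` \<sigma> ` {1..n}" by (simp add: std_def image_image)
  moreover have "inj_on (lift_perm \<sigma>) (std n)"
  proof (rule inj_onI)
    fix u v assume "u \<in> std n" "v \<in> std n" and eq: "lift_perm \<sigma> u = lift_perm \<sigma> v"
    then obtain i j where ij: "u = Pt i" "i \<in> {1..n}" "v = Pt j" "j \<in> {1..n}" unfolding std_def by blast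
    then have "\<sigma> i = \<sigma> j" using eq by simp
    then show "u = v" using inj_onD[OF \<open>inj_on \<sigma> {1..n}\<close> _ ij(2,4)] ij by simp
  qed
  ultimately show ?thesis by (simp add: bij_betw_def std_def)
qed

lemma G_space_sigma_act:
  assumes O: "operad \<O>"
  shows "G_space (sym_group n) (sigma_act \<O> n) (op_space \<O> (std n))"
  unfolding G_space_def
proof (intro conjI ballI)
  fix \<sigma> assume \<sigma>: "\<sigma> \<in> carrier (sym_group n)"
  show "continuous_map (op_space \<O> (std n)) (op_space \<O> (std n)) (sigma_act \<O> n \<sigma>)"
    by (rule operad_map_continuous[OF O finite_std bij_betw_lift_perm[OF \<sigma>]])
next
  fix c assume "c \<in> op_pts \<O> (std n)"
  then show "sigma_act \<O> n \<one>\<^bsub>sym_group n\<^esub> c = c"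
    by (intro operad_map_ident[OF O finite_std]) (auto simp: std_def sym_group_one)
next
  fix \<sigma> \<tau> c assume \<sigma>: "\<sigma> \<in> carrier (sym_group n)" and \<tau>: "\<tau> \<in> carrier (sym_group n)"
    and c: "c \<in> op_pts \<O> (std n)"
  have "bij_betw (lift_perm \<sigma> \<circ> lift_perm \<tau>) (std n) (std n)"
    using bij_betw_trans[OF bij_betw_lift_perm[OF \<tau>] bij_betw_lift_perm[OF \<sigma>]] .
  then have "op_map \<O> (std n) (std n) (lift_perm \<sigma> \<circ> lift_perm \<tau>) c = sigma_act \<O> n (\<sigma> \<otimes>\<^bsub>sym_group n\<^esub> \<tau>) c"
    by (rule operad_map_cong[OF O finite_std _ _ c]) (auto simp: std_def sym_group_mult)
  then show "sigma_act \<O> n (\<sigma> \<otimes>\<^bsub>sym_group n\<^esub> \<tau>) c = sigma_act \<O> n \<sigma> (sigma_act \<O> n \<tau> c)"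
    using operad_map_compose[OF O finite_std bij_betw_lift_perm[OF \<tau>] bij_betw_lift_perm[OF \<sigma>] c] by simp
qed

locale ring_space_action =
  fixes \<C> :: "'c operad" and \<G> :: "'g operad"
    and lam :: "ix set \<Rightarrow> (ix \<Rightarrow> ix set) \<Rightarrow> 'g \<Rightarrow> (ix \<Rightarrow> 'c) \<Rightarrow> 'c"
    and X :: "'x topology"
    and \<theta> :: "ix set \<Rightarrow> 'c \<Rightarrow> (ix \<Rightarrow> 'x) \<Rightarrow> 'x"
    and \<xi> :: "ix set \<Rightarrow> 'g \<Rightarrow> (ix \<Rightarrow> 'x) \<Rightarrow> 'x"
    and g :: 'g
  assumes C: "operad \<C>" and G: "operad \<G>" and action: "operad_action \<G> \<C> lam"
    and contractible: "contractible_space (op_space \<G> (std 1))"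
    and ring: "einf_ring_space \<C> \<G> lam X \<theta> \<xi>"
    and g: "g \<in> op_pts \<G> (std 2)"
begin

declare One_nat_def [simp del]

lemma X: "kify X = X" "weak_Hausdorff_space X"
  and \<theta>: "operad_algebra \<C> X \<theta>" and \<xi>: "operad_algebra \<G> X \<xi>"
  using ring[unfolded einf_ring_space_def] by (auto simp: cgwh_space_def)

lemma op_space_std: "kify (op_space \<C> (std k)) = op_space \<C> (std k)" "weak_Hausdorff_space (op_space \<C> (std k))"
  using operad_cgwh[OF C, of "std k"] by (auto simp: cgwh_space_def)

lemma weak_Hausdorff_op_space: "finite A \<Longrightarrow> weak_Hausdorff_space (op_space \<G> A)" "finite A \<Longrightarrow> weak_Hausdorff_space (op_space \<C> A)"
  using operad_cgwh G C by (auto simp: cgwh_space_def)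

definition times :: "'x \<times> 'x \<Rightarrow> 'x" where
  "times = (\<lambda>(a, b). \<xi> (std 2) g (\<lambda>u\<in>std 2. if u = Pt 1 then a else b))"

text \<open>\<open>\<lambda>(h; -)\<close> as a self-map of \<open>\<C>(k)\<close>, for a unary operation \<open>h \<in> \<G>({e})\<close>.\<close>

definition unary :: "ix \<Rightarrow> nat \<Rightarrow> 'g \<Rightarrow> 'c \<Rightarrow> 'c" where
  "unary e k h c = op_map \<C> (dprod {e} (\<lambda>_. std k)) (std k) (\<lambda>u. proj u e)
     (lam {e} (\<lambda>_. std k) h (\<lambda>_\<in>{e}. c))"

section \<open>Self-maps of \<open>\<C>(k)\<close> given by unary operations\<close>

lemma lam_singleton_closed:
  "h \<in> op_pts \<G> {e} \<Longrightarrow> c \<in> op_pts \<C> (std k) \<Longrightarrow>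
   lam {e} (\<lambda>_. std k) h (\<lambda>_\<in>{e}. c) \<in> op_pts \<C> (dprod {e} (\<lambda>_. std k))"
  by (rule operad_action_closed[OF action]) auto

lemma finite_dprod_std: "finite (dprod {e} (\<lambda>_. std k))"
  by (rule finite_dprod) simp

lemma unary_closed:
  assumes "h \<in> op_pts \<G> {e}" "c \<in> op_pts \<C> (std k)"
  shows "unary e k h c \<in> op_pts \<C> (std k)"
  unfolding unary_def
  by (rule operad_map_closed[OF C finite_dprod_std bij_betw_dprod_singleton lam_singleton_closed[OF assms]])

lemma unary_unit:
  assumes c: "c \<in> op_pts \<C> (std k)"
  shows "unary e k (unit_at \<G> e) c = c"
proof -
  have "unary e k (unit_at \<G> e) c = op_map \<C> (std k) (std k) ((\<lambda>u. proj u e) \<circ> (\<lambda>b. tuple {e} (\<lambda>_. b))) c"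
    unfolding unary_def operad_action_unit[OF action finite_std c]
    by (rule operad_map_compose[OF C finite_std bij_betw_singleton_dprod bij_betw_dprod_singleton c])
  also have "\<dots> = c" by (rule operad_map_ident[OF C finite_std _ c]) simp
  finally show ?thesis .
qed

text \<open>Naturality of the action in the bijection of its one argument. As it holds for every
  \<open>h\<close>, all stages of a path of unary operations descend to orbits, not only its
  ends.\<close>

lemma unary_map:
  assumes h: "h \<in> op_pts \<G> {e}" and c: "c \<in> op_pts \<C> (std k)" and \<sigma>: "bij_betw \<sigma> (std k) (std k)"
  shows "unary e k h (op_map \<C> (std k) (std k) \<sigma> c) = op_map \<C> (std k) (std k) \<sigma> (unary e k h c)"
proof -
  let ?S = "std k" and ?P = "dprod {e} (\<lambda>_. std k)"
  let ?l = "lam {e} (\<lambda>_. ?S) h (\<lambda>_\<in>{e}. c)"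
  let ?t = "\<lambda>u. tuple {e} (\<lambda>a'. let a = inv_into {e} id a' in \<sigma> (proj u a))"
  have l: "?l \<in> op_pts \<C> ?P" by (rule lam_singleton_closed[OF h c])
  have "inv_into {e} id e = e" by (simp add: inv_into_def)
  then have t: "?t u = tuple {e} (\<lambda>_. \<sigma> (proj u e))" for u
    by (intro tuple_cong) simp
  have "fam_map \<C> {e} (\<lambda>_. ?S) {e} (\<lambda>_. ?S) id (\<lambda>_. \<sigma>) (\<lambda>_\<in>{e}. c) = (\<lambda>_\<in>{e}. op_map \<C> ?S ?S \<sigma> c)"
    by (auto simp: fam_map_def inv_into_def)
  moreover have "op_map \<G> {e} {e} id h = h" by (rule operad_map_ident[OF G _ _ h]) auto
  moreover have "lam {e} (\<lambda>_. ?S) (op_map \<G> {e} {e} id h)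
      (fam_map \<C> {e} (\<lambda>_. ?S) {e} (\<lambda>_. ?S) id (\<lambda>_. \<sigma>) (\<lambda>_\<in>{e}. c)) = op_map \<C> ?P ?P ?t ?l"
    by (rule operad_action_map[OF action]) (use \<sigma> h c in auto)
  ultimately have "lam {e} (\<lambda>_. ?S) h (\<lambda>_\<in>{e}. op_map \<C> ?S ?S \<sigma> c) = op_map \<C> ?P ?P ?t ?l" by simp
  then have "unary e k h (op_map \<C> ?S ?S \<sigma> c) = op_map \<C> ?P ?S (\<lambda>u. proj u e) (op_map \<C> ?P ?P ?t ?l)"
    by (simp add: unary_def)
  also have "\<dots> = op_map \<C> ?P ?S ((\<lambda>u. proj u e) \<circ> ?t) ?l"
  proof (rule operad_map_compose[OF C finite_dprod_std _ bij_betw_dprod_singleton l])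
    have "bij_betw ((\<lambda>s. tuple {e} (\<lambda>_. s)) \<circ> (\<sigma> \<circ> (\<lambda>u. proj u e))) ?P ?P"
      by (intro bij_betw_trans[OF bij_betw_trans[OF bij_betw_dprod_singleton \<sigma>] bij_betw_singleton_dprod])
    then show "bij_betw ?t ?P ?P" by (simp only: t o_def)
  qed
  also have "(\<lambda>u. proj u e) \<circ> ?t = \<sigma> \<circ> (\<lambda>u. proj u e)" by (auto simp: t)
  also have "op_map \<C> ?P ?S (\<sigma> \<circ> (\<lambda>u. proj u e)) ?l = op_map \<C> ?S ?S \<sigma> (unary e k h c)"
    unfolding unary_def
    by (rule operad_map_compose[OF C finite_dprod_std bij_betw_dprod_singleton \<sigma> l, symmetric])
  finally show ?thesis .
qed

text \<open>The index and the value of \<open>\<gamma>(g; 1, *)\<close>, where \<open>*\<close> is the point of \<open>\<G>(\<emptyset>)\<close>.\<close>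

definition e\<^sub>1 :: ix where "e\<^sub>1 = IPair (Pt 1) (Pt 1)"

definition B\<^sub>1 :: "ix \<Rightarrow> ix set" where "B\<^sub>1 a = (if a = Pt 1 then {Pt 1} else {})"

definition h\<^sub>1 :: 'g where
  "h\<^sub>1 = op_comp \<G> (std 2) B\<^sub>1 g (\<lambda>a\<in>std 2. if a = Pt 1 then unit_at \<G> (Pt 1) else SOME c. c \<in> op_pts \<G> {})"

lemma dsum_B\<^sub>1: "dsum (std 2) B\<^sub>1 = {e\<^sub>1}"
  by (auto simp: dsum_def B\<^sub>1_def e\<^sub>1_def std_2 split: if_splits)

lemma some_empty_op: "(SOME c. c \<in> op_pts \<G> {}) \<in> op_pts \<G> {}"
  using operad_empty[OF G] by (metis insertI1 someI_ex)

lemma family_B\<^sub>1: "(\<lambda>a\<in>std 2. if a = Pt 1 then unit_at \<G> (Pt 1) else SOME c. c \<in> op_pts \<G> {}) \<in> op_fam \<G> (std 2) B\<^sub>1"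
  using some_empty_op unit_at_closed[OF G, of "Pt 1"] by (auto simp: B\<^sub>1_def)

lemma h\<^sub>1: "h\<^sub>1 \<in> op_pts \<G> {e\<^sub>1}"
proof -
  have "finite_family (std 2) B\<^sub>1" by (simp add: B\<^sub>1_def)
  from operad_comp_closed[OF G this g family_B\<^sub>1] show ?thesis unfolding dsum_B\<^sub>1 h\<^sub>1_def .
qed

lemma times_closed: "a \<in> topspace X \<Longrightarrow> b \<in> topspace X \<Longrightarrow> times (a, b) \<in> topspace X"
  unfolding times_def using operad_algebra_closed[OF \<xi> finite_std g] by auto

text \<open>
  Distributivity, with \<open>b\<close> written as an additive operation in one variable. As the unit of \<open>\<C>\<close> is
  \<open>\<lambda>(*; ())\<close>, the action law turns the resulting \<open>\<lambda>(g; c, 1)\<close> into \<open>\<lambda>(\<gamma>(g; 1, *); c)\<close>.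
\<close>

lemma times_diagonal:
  assumes c: "c \<in> op_pts \<C> (std k)" and a: "a \<in> topspace X" and b: "b \<in> topspace X"
  shows "times (\<theta> (std k) c (\<lambda>_\<in>std k. a), b) = \<theta> (std k) (unary e\<^sub>1 k h\<^sub>1 c) (\<lambda>_\<in>std k. times (a, b))"
proof -
  let ?A = "std 2" and ?S = "std k" and ?pt = "SOME c. c \<in> op_pts \<G> {}" and ?z = "times (a, b)"
  let ?h = "\<lambda>a\<in>std 2. if a = Pt 1 then unit_at \<G> (Pt 1) else SOME c. c \<in> op_pts \<G> {}"
  let ?c = "\<lambda>_\<in>{e\<^sub>1}. c"
  define B where "B = (\<lambda>a. dprod (B\<^sub>1 a) (\<lambda>_. ?S))"
  \<comment> \<open>The operations that distributivity will see: a relabelled copy of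
    \<open>c\<close> in the first slot, by the unit law (\<open>d1\<close>), and the unit of
    \<open>\<C>\<close> in the second, produced by the nullary operation
    (\<open>d2\<close>).\<close>
  define d where "d = (\<lambda>a\<in>?A. lam (B\<^sub>1 a) (\<lambda>_. ?S) (?h a) (\<lambda>b\<in>B\<^sub>1 a. ?c (IPair a b)))"
  let ?P = "dprod {e\<^sub>1} (\<lambda>_. ?S)" and ?l = "lam {e\<^sub>1} (\<lambda>_. ?S) h\<^sub>1 ?c"
  let ?\<beta> = "\<lambda>u. tuple ?A (\<lambda>a. tuple (B\<^sub>1 a) (\<lambda>b. proj u (IPair a b)))"
  define e0 where "e0 = tuple {} (\<lambda>_::ix. Pt 0)"
  have [simp]: "Pt 1 \<in> ?A" "Pt 2 \<in> ?A" by (auto simp: std_2)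
  have z: "?z \<in> topspace X" by (rule times_closed[OF a b])
  have l: "?l \<in> op_pts \<C> ?P" by (rule lam_singleton_closed[OF h\<^sub>1 c])
  have finB1: "finite_family ?A B\<^sub>1" by (simp add: B\<^sub>1_def)
  have B: "B (Pt 1) = dprod {Pt 1} (\<lambda>_. ?S)" "B (Pt 2) = {e0}"
    by (simp_all add: B_def B\<^sub>1_def dprod_empty[of _ "\<lambda>_. Pt 0"] e0_def)
  have finB: "finite_family ?A B"
    unfolding B_def by (auto intro!: finite_dprod simp: B\<^sub>1_def)
  have d1: "d (Pt 1) = op_map \<C> ?S (B (Pt 1)) (\<lambda>b. tuple {Pt 1} (\<lambda>_. b)) c"
  proof -
    have "(\<lambda>b\<in>{Pt 1}. ?c (IPair (Pt 1) b)) = (\<lambda>_\<in>{Pt 1}. c)" by (auto simp: e\<^sub>1_def)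
    then show ?thesis
      using operad_action_unit[OF action finite_std c, of "Pt 1"] by (simp add: d_def B B\<^sub>1_def)
  qed
  have d2: "d (Pt 2) = unit_at \<C> e0"
    using operad_action_empty[OF action G C some_empty_op, of "\<lambda>_. ?S"]
    by (simp add: d_def B\<^sub>1_def e0_def restrict_def)
  have d: "d \<in> op_fam \<C> ?A B"
  proof -
    have "d (Pt 1) \<in> op_pts \<C> (B (Pt 1))"
      unfolding d1 B(1) by (rule operad_map_closed[OF C finite_std bij_betw_singleton_dprod c])
    moreover have "d (Pt 2) \<in> op_pts \<C> (B (Pt 2))" unfolding d2 B(2) by (rule unit_at_closed[OF C])
    moreover have "d \<in> extensional ?A" by (simp add: d_def)
    ultimately show ?thesis by (auto simp: std_2 PiE_def)
  qed
  \<comment> \<open>The composition law of the action: the iterated operation \<open>d\<close>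
    followed by \<open>g\<close> is the composite \<open>h\<^sub>1\<close> applied to
    \<open>c\<close> alone, up to the relabelling \<open>?\<beta>\<close>.\<close>
  have assoc: "op_map \<C> ?P (dprod ?A B) ?\<beta> ?l = lam ?A B g d"
    using operad_action_comp[OF action finB1, of "\<lambda>_. ?S" g ?h ?c] g family_B\<^sub>1 c
    unfolding dsum_B\<^sub>1 h\<^sub>1_def[symmetric] B_def[symmetric] d_def[symmetric] by simp
  \<comment> \<open>The inverse reads off the first coordinate; the second is forced, since
    \<open>B (Pt 2)\<close> is the one-point empty product.\<close>
  have \<beta>: "bij_betw ?\<beta> ?P (dprod ?A B)"
  proof (rule bij_betw_byWitness[where f' = "\<lambda>v. tuple {e\<^sub>1} (\<lambda>_. proj (proj v (Pt 1)) (Pt 1))"])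
    have p: "proj (proj (?\<beta> u) (Pt 1)) (Pt 1) = proj u e\<^sub>1" for u by (simp add: B\<^sub>1_def e\<^sub>1_def)
    show "\<forall>u\<in>?P. tuple {e\<^sub>1} (\<lambda>_. proj (proj (?\<beta> u) (Pt 1)) (Pt 1)) = u"
      unfolding p by (simp add: dprod_singleton_eta)
    show "\<forall>v\<in>dprod ?A B. ?\<beta> (tuple {e\<^sub>1} (\<lambda>_. proj (proj v (Pt 1)) (Pt 1))) = v"
    proof
      fix v assume v: "v \<in> dprod ?A B"
      have "tuple (B\<^sub>1 a) (\<lambda>b. proj (tuple {e\<^sub>1} (\<lambda>_. proj (proj v (Pt 1)) (Pt 1))) (IPair a b)) = proj v a"
        if "a \<in> ?A" for a
      proof -
        have va: "proj v a \<in> B a" by (rule dprodD(1)[OF v finite_std that])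
        have "tuple (B\<^sub>1 a) (proj (proj v a)) = proj v a"
          using dprodD(2)[OF va[unfolded B_def]] finB1 that by blast
        moreover have "tuple (B\<^sub>1 a) (\<lambda>b. proj (tuple {e\<^sub>1} (\<lambda>_. proj (proj v (Pt 1)) (Pt 1))) (IPair a b)) =
            tuple (B\<^sub>1 a) (proj (proj v a))"
          by (rule tuple_cong) (auto simp: B\<^sub>1_def e\<^sub>1_def split: if_splits)
        ultimately show ?thesis by simp
      qed
      then have "?\<beta> (tuple {e\<^sub>1} (\<lambda>_. proj (proj v (Pt 1)) (Pt 1))) = tuple ?A (proj v)"
        by (intro tuple_cong)
      then show "?\<beta> (tuple {e\<^sub>1} (\<lambda>_. proj (proj v (Pt 1)) (Pt 1))) = v"
        using dprodD(2)[OF v finite_std] by simp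
    qed
    show "?\<beta> ` ?P \<subseteq> dprod ?A B"
    proof (rule image_subsetI, rule tuple_in_dprod)
      fix u a assume "u \<in> ?P" "a \<in> ?A"
      then show "tuple (B\<^sub>1 a) (\<lambda>b. proj u (IPair a b)) \<in> B a"
        unfolding B_def
        by (intro tuple_in_dprod) (use dprodD(1)[of u "{e\<^sub>1}" "\<lambda>_. ?S" e\<^sub>1] in \<open>auto simp: B\<^sub>1_def e\<^sub>1_def split: if_splits\<close>)
    qed
    show "(\<lambda>v. tuple {e\<^sub>1} (\<lambda>_. proj (proj v (Pt 1)) (Pt 1))) ` dprod ?A B \<subseteq> ?P"
    proof (rule image_subsetI, rule tuple_in_dprod)
      fix v assume "v \<in> dprod ?A B"
      then have "proj v (Pt 1) \<in> dprod {Pt 1} (\<lambda>_. ?S)" using dprodD(1)[of v ?A B "Pt 1"] B(1) by simp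
      then show "proj (proj v (Pt 1)) (Pt 1) \<in> ?S" using dprodD(1)[of _ "{Pt 1}" "\<lambda>_. ?S"] by simp
    qed
  qed
  \<comment> \<open>The input is \<open>a\<close> at every index of the first slot and
    \<open>b\<close> at the single index of the second.\<close>
  define x where "x = (\<lambda>u\<in>dsum ?A B. if ix_fst u = Pt 1 then a else b)"
  have x: "x (IPair i j) = (if i = Pt 1 then a else b)" if "i \<in> ?A" "j \<in> B i" for i j
    using that by (auto simp: x_def dsum_def)
  have "\<xi> ?A g (\<lambda>i\<in>?A. \<theta> (B i) (d i) (\<lambda>j\<in>B i. x (IPair i j))) =
      \<theta> (dprod ?A B) (lam ?A B g d) (\<lambda>u\<in>dprod ?A B. \<xi> ?A g (\<lambda>i\<in>?A. x (IPair i (proj u i))))"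
    by (rule einf_ring_space_distrib[OF ring finB g d]) (use a b in \<open>auto simp: x_def\<close>)
  moreover have "(\<lambda>i\<in>?A. \<theta> (B i) (d i) (\<lambda>j\<in>B i. x (IPair i j))) =
      (\<lambda>i\<in>?A. if i = Pt 1 then \<theta> ?S c (\<lambda>_\<in>?S. a) else b)"
  proof (rule restrict_ext)
    fix i assume i: "i \<in> ?A"
    then consider "i = Pt 1" | "i = Pt 2" by (auto simp: std_2)
    then show "\<theta> (B i) (d i) (\<lambda>j\<in>B i. x (IPair i j)) = (if i = Pt 1 then \<theta> ?S c (\<lambda>_\<in>?S. a) else b)"
    proof cases
      case 1
      have "(\<lambda>j\<in>B (Pt 1). x (IPair (Pt 1) j)) = (\<lambda>_\<in>B (Pt 1). a)" by (rule restrict_ext) (simp add: x)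
      then show ?thesis
        using 1 operad_algebra_map_const[OF \<theta> finite_std bij_betw_singleton_dprod c a, of "Pt 1"] by (simp add: d1 B)
    next
      case 2
      have "(\<lambda>j\<in>B (Pt 2). x (IPair (Pt 2) j)) = (\<lambda>_\<in>B (Pt 2). b)" by (rule restrict_ext) (simp add: x)
      then show ?thesis
        using 2 operad_algebra_unit[OF \<theta> b, of e0] by (simp add: d2 B)
    qed
  qed
  \<comment> \<open>Any selection of one input from each slot is \<open>a\<close> followed by
    \<open>b\<close>, so every inner product is the same.\<close>
  moreover have "(\<lambda>u\<in>dprod ?A B. \<xi> ?A g (\<lambda>i\<in>?A. x (IPair i (proj u i)))) = (\<lambda>_\<in>dprod ?A B. ?z)"
  proof (rule restrict_ext)
    fix u assume "u \<in> dprod ?A B"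
    then have "(\<lambda>i\<in>?A. x (IPair i (proj u i))) = (\<lambda>i\<in>?A. if i = Pt 1 then a else b)"
      by (intro restrict_ext) (simp add: x dprodD(1))
    then show "\<xi> ?A g (\<lambda>i\<in>?A. x (IPair i (proj u i))) = ?z" by (simp add: times_def)
  qed
  ultimately have "times (\<theta> ?S c (\<lambda>_\<in>?S. a), b) = \<theta> (dprod ?A B) (lam ?A B g d) (\<lambda>_\<in>dprod ?A B. ?z)"
    by (simp add: times_def)
  also have "\<dots> = \<theta> ?P ?l (\<lambda>_\<in>?P. ?z)"
    unfolding assoc[symmetric] by (rule operad_algebra_map_const[OF \<theta> finite_dprod_std \<beta> l z])
  also have "\<dots> = \<theta> ?S (unary e\<^sub>1 k h\<^sub>1 c) (\<lambda>_\<in>?S. ?z)"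
    unfolding unary_def
    by (rule operad_algebra_map_const[OF \<theta> finite_dprod_std bij_betw_dprod_singleton l z, symmetric])
  finally show ?thesis .
qed

section \<open>Continuity of the multiplication and of the diagonal action\<close>

lemma \<theta>_continuous:
  assumes A: "finite A" and K: "compact_space K" "Hausdorff_space K"
    and u: "continuous_map K (op_space \<C> A) u" and v: "\<And>a. a \<in> A \<Longrightarrow> continuous_map K X (v a)"
  shows "continuous_map K X (\<lambda>z. \<theta> A (u z) (\<lambda>a\<in>A. v a z))"
  using continuous_map_kprod_family[OF operad_algebra_continuous[OF \<theta> A] weak_Hausdorff_op_space(2)[OF A] X(2) K u v] by simp

lemma continuous_map_times: "continuous_map (kprod X X) X times"
proof (rule continuous_map_from_kify)
  fix K assume K: "compactin (prod_topology X X) K" "Hausdorff_space (subtopology (prod_topology X X) K)"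
  let ?K = "subtopology (prod_topology X X) K"
  have "continuous_map ?K X (\<lambda>z. if a = Pt 1 then fst z else snd z)" for a
    by (cases "a = Pt 1") (simp_all add: continuous_map_from_subtopology continuous_map_fst continuous_map_snd)
  moreover have "continuous_map ?K (op_space \<G> (std 2)) (\<lambda>_. g)" using g by simp
  ultimately have "continuous_map ?K X (\<lambda>z. (\<lambda>(c, x). \<xi> (std 2) c x) (g, \<lambda>a\<in>std 2. if a = Pt 1 then fst z else snd z))"
    by (rule continuous_map_kprod_family[OF operad_algebra_continuous[OF \<xi> finite_std] weak_Hausdorff_op_space(1)[OF finite_std] X(2)
          compact_space_subtopology[OF K(1)] K(2), rotated])
  then show "continuous_map ?K X times" by (simp add: times_def case_prod_unfold)
qed

abbreviation orb :: "nat \<Rightarrow> 'c \<Rightarrow> 'c set" where "orb k \<equiv> orbit (sym_group k) (sigma_act \<C> k)"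

lemma quotient_orb: "quotient_map (op_space \<C> (std k)) (Bsigma \<C> k) (orb k)"
  by (rule quotient_map_orbit_space)

lemma topspace_BsigmaE:
  assumes "Q \<in> topspace (Bsigma \<C> k)"
  obtains c where "c \<in> op_pts \<C> (std k)" "Q = orb k c"
  using assms by (auto simp: orbits_def)

lemma orb_eq_iff:
  assumes "c \<in> op_pts \<C> (std k)" "d \<in> op_pts \<C> (std k)"
  shows "orb k c = orb k d \<longleftrightarrow> (\<exists>\<sigma>\<in>carrier (sym_group k). d = sigma_act \<C> k \<sigma> c)"
  by (rule orbit_eq_iff[OF sym_group_is_group G_space_sigma_act[OF C] assms])

lemma orb_self: "c \<in> op_pts \<C> (std k) \<Longrightarrow> c \<in> orb k c"
proof -
  assume c: "c \<in> op_pts \<C> (std k)"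
  have "id \<in> carrier (sym_group k)" by (simp add: sym_group_carrier permutes_id)
  moreover have "sigma_act \<C> k id c = c"
    by (rule operad_map_ident[OF C finite_std _ c]) (auto simp: std_def)
  ultimately show "c \<in> orb k c" unfolding orbit_def by force
qed

text \<open>All inputs are equal, so permuting those of \<open>c\<close> changes nothing and
  \<open>the_elem\<close> is applied to a singleton.\<close>

lemma diagonal_action_orb:
  assumes c: "c \<in> op_pts \<C> (std k)" and x: "x \<in> topspace X"
  shows "diagonal_action \<theta> k (orb k c, x) = \<theta> (std k) c (\<lambda>_\<in>std k. x)"
proof -
  have "\<theta> (std k) d (\<lambda>_\<in>std k. x) = \<theta> (std k) c (\<lambda>_\<in>std k. x)" if "d \<in> orb k c" for d
    using that operad_algebra_map_const[OF \<theta> finite_std bij_betw_lift_perm c x] by (auto simp: orbit_def)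
  then have "(\<lambda>c. \<theta> (std k) c (\<lambda>_\<in>std k. x)) ` orb k c = {\<theta> (std k) c (\<lambda>_\<in>std k. x)}"
    using imageI[OF orb_self[OF c], of "\<lambda>c. \<theta> (std k) c (\<lambda>_\<in>std k. x)"]
    by (intro equalityI image_subsetI) simp_all
  then show ?thesis by (simp add: diagonal_action_def)
qed

text \<open>A compact Hausdorff test set \<open>K\<close> projects to a compact Hausdorff
  \<open>L\<close> in \<open>X\<close>. Over \<open>L\<close> the orbit map stays a quotient map
  after taking products, so continuity follows from that of \<open>\<theta>\<close> on
  \<open>L\<close> times compact Hausdorff pieces of \<open>\<C>(k)\<close>.\<close>

lemma continuous_map_diagonal_action:
  "continuous_map (kprod (Bsigma \<C> k) X) X (diagonal_action \<theta> k)"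
proof (rule continuous_map_from_kify)
  let ?B = "Bsigma \<C> k" and ?D = "diagonal_action \<theta> k"
  fix K assume K: "compactin (prod_topology ?B X) K" "Hausdorff_space (subtopology (prod_topology ?B X) K)"
  define L where "L = subtopology X (snd ` K)"
  have L: "compact_space L" "Hausdorff_space L"
    using weak_Hausdorff_compact_subset_image[OF X(2) K continuous_map_snd]
    by (simp_all add: L_def compact_space_subtopology)
  have "continuous_map (prod_topology L ?B) X (\<lambda>(x, Q). ?D (Q, x))"
  proof (rule continuous_map_prod_quotient[OF quotient_orb op_space_std(1)])
    show "locally_compact_space L" using L by (simp add: compact_imp_locally_compact_space)
    show "Hausdorff_space L" by (rule L)
    fix K' assume K': "compactin (op_space \<C> (std k)) K'" "Hausdorff_space (subtopology (op_space \<C> (std k)) K')"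
    let ?P = "prod_topology L (subtopology (op_space \<C> (std k)) K')"
    have P: "compact_space ?P" "Hausdorff_space ?P"
      using L K' by (simp_all add: compact_space_prod_topology Hausdorff_space_prod_topology compact_space_subtopology)
    have "continuous_map ?P (op_space \<C> (std k)) snd"
      using continuous_map_snd[of L "subtopology (op_space \<C> (std k)) K'"] by (simp add: continuous_map_in_subtopology)
    moreover have "continuous_map ?P X fst"
      using continuous_map_fst[of L "subtopology (op_space \<C> (std k)) K'"] by (simp add: L_def continuous_map_in_subtopology)
    ultimately have "continuous_map ?P X (\<lambda>z. \<theta> (std k) (snd z) (\<lambda>_\<in>std k. fst z))"
      by (rule \<theta>_continuous[OF finite_std P])
    then show "continuous_map ?P X (\<lambda>(x, c). (\<lambda>(x, Q). ?D (Q, x)) (x, orb k c))"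
      by (rule continuous_map_eq) (auto simp: L_def diagonal_action_orb)
  qed
  moreover have "continuous_map (subtopology (prod_topology ?B X) K) (prod_topology L ?B) prod.swap"
  proof -
    have "continuous_map (subtopology (prod_topology ?B X) K) L (\<lambda>z. snd z)"
      unfolding L_def by (auto simp: continuous_map_in_subtopology continuous_map_from_subtopology continuous_map_snd)
    moreover have "continuous_map (subtopology (prod_topology ?B X) K) ?B (\<lambda>z. fst z)"
      by (simp add: continuous_map_from_subtopology continuous_map_fst)
    ultimately have "continuous_map (subtopology (prod_topology ?B X) K) (prod_topology L ?B) (\<lambda>z. (snd z, fst z))"
      by (rule continuous_map_pairedI)
    then show ?thesis by (rule continuous_map_eq) (auto simp: prod.swap_def)
  qed
  ultimately have "continuous_map (subtopology (prod_topology ?B X) K) X ((\<lambda>(x, Q). ?D (Q, x)) \<circ> prod.swap)"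
    by (rule continuous_map_compose[rotated])
  then show "continuous_map (subtopology (prod_topology ?B X) K) X ?D"
    by (rule continuous_map_eq) auto
qed

lemma weak_Hausdorff_Bsigma: "weak_Hausdorff_space (Bsigma \<C> k)"
proof (rule weak_Hausdorff_orbit_space[OF op_space_std sym_group_is_group _ G_space_sigma_act[OF C]])
  show "finite (carrier (sym_group k))" by (simp add: sym_group_def finite_permutations)
qed

lemma singular_chain_kprod_Bsigma:
  "singular_chain n (prod_topology (Bsigma \<C> k) X) e \<Longrightarrow> singular_chain n (kprod (Bsigma \<C> k) X) e"
  by (rule singular_chain_kify[OF weak_Hausdorff_prod_topology[OF weak_Hausdorff_Bsigma X(2)]])

lemma singular_chain_kprod_X:
  "singular_chain n (prod_topology X X) e \<Longrightarrow> singular_chain n (kprod X X) e"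
  by (rule singular_chain_kify[OF weak_Hausdorff_prod_topology[OF X(2) X(2)]])

text \<open>A representative is chosen; by \<open>unary_map\<close> another one changes the result
  by a permutation only, which the orbit forgets.\<close>

definition unary_orbit :: "nat \<Rightarrow> 'g \<Rightarrow> 'c set \<Rightarrow> 'c set" where
  "unary_orbit k h Q = orb k (unary e\<^sub>1 k h (SOME c. c \<in> Q))"

lemma unary_orbit_orb:
  assumes h: "h \<in> op_pts \<G> {e\<^sub>1}" and c: "c \<in> op_pts \<C> (std k)"
  shows "unary_orbit k h (orb k c) = orb k (unary e\<^sub>1 k h c)"
proof -
  have "(SOME d. d \<in> orb k c) \<in> orb k c" using orb_self[OF c] by (rule someI)
  then obtain \<sigma> where \<sigma>: "\<sigma> \<in> carrier (sym_group k)" and eq: "(SOME d. d \<in> orb k c) = sigma_act \<C> k \<sigma> c"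
    by (auto simp: orbit_def)
  have "unary e\<^sub>1 k h (sigma_act \<C> k \<sigma> c) = sigma_act \<C> k \<sigma> (unary e\<^sub>1 k h c)"
    by (rule unary_map[OF h c bij_betw_lift_perm[OF \<sigma>]])
  moreover have "orb k (unary e\<^sub>1 k h c) = orb k (sigma_act \<C> k \<sigma> (unary e\<^sub>1 k h c))"
    using unary_closed[OF h c] operad_map_closed[OF C finite_std bij_betw_lift_perm[OF \<sigma>]] \<sigma>
    by (subst orb_eq_iff) auto
  ultimately show ?thesis by (simp add: unary_orbit_def eq)
qed

text \<open>Joint continuity in time and orbit: the interval is compact Hausdorff, so it suffices to
  look at its product with compact Hausdorff pieces of \<open>\<C>(k)\<close>, where continuity of
  \<open>lam\<close> on the k-ified product applies.\<close>

lemma continuous_map_unary_orbit: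
  assumes \<gamma>: "continuous_map (top_of_set {0..1::real}) (op_space \<G> {e\<^sub>1}) \<gamma>"
  shows "continuous_map (prod_topology (top_of_set {0..1::real}) (Bsigma \<C> k)) (Bsigma \<C> k)
    (\<lambda>(t, Q). unary_orbit k (\<gamma> t) Q)"
proof (rule continuous_map_prod_quotient[OF quotient_orb op_space_std(1)])
  let ?I = "top_of_set {0..1::real}"
  have I: "compact_space ?I" "Hausdorff_space ?I"
    by (simp_all add: compact_space_subtopology compactin_euclidean_iff Hausdorff_space_subtopology)
  then show "locally_compact_space ?I" "Hausdorff_space ?I" by (simp_all add: compact_imp_locally_compact_space)
  fix K assume K: "compactin (op_space \<C> (std k)) K" "Hausdorff_space (subtopology (op_space \<C> (std k)) K)"
  let ?P = "prod_topology ?I (subtopology (op_space \<C> (std k)) K)"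
  have P: "compact_space ?P" "Hausdorff_space ?P"
    using I K by (simp_all add: compact_space_prod_topology Hausdorff_space_prod_topology compact_space_subtopology)
  have s: "continuous_map ?P (op_space \<C> (std k)) snd"
    using continuous_map_snd[of ?I "subtopology (op_space \<C> (std k)) K"] by (simp add: continuous_map_in_subtopology)
  have f: "continuous_map ?P (op_space \<G> {e\<^sub>1}) (\<lambda>z. \<gamma> (fst z))"
    using continuous_map_compose[OF continuous_map_fst \<gamma>] by (simp add: o_def)
  have fam: "finite_family {e\<^sub>1} (\<lambda>_. std k)" by simp
  have "continuous_map ?P (op_space \<C> (dprod {e\<^sub>1} (\<lambda>_. std k)))
      (\<lambda>z. (\<lambda>(h, c). lam {e\<^sub>1} (\<lambda>_. std k) h c) (\<gamma> (fst z), \<lambda>_\<in>{e\<^sub>1}. snd z))"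
  proof (rule continuous_map_kprod_family[OF _ _ _ P f])
    show "continuous_map (kprod_family (op_space \<G> {e\<^sub>1}) {e\<^sub>1} (\<lambda>_. op_space \<C> (std k)))
        (op_space \<C> (dprod {e\<^sub>1} (\<lambda>_. std k))) (\<lambda>(h, c). lam {e\<^sub>1} (\<lambda>_. std k) h c)"
      by (rule operad_action_continuous[OF action fam])
  qed (use weak_Hausdorff_op_space s in auto)
  from continuous_map_compose[OF this operad_map_continuous[OF C finite_dprod_std bij_betw_dprod_singleton]]
  have "continuous_map ?P (op_space \<C> (std k)) (\<lambda>z. unary e\<^sub>1 k (\<gamma> (fst z)) (snd z))"
    by (simp add: unary_def o_def)
  from continuous_map_compose[OF this quotient_imp_continuous_map[OF quotient_orb]]
  have "continuous_map ?P (Bsigma \<C> k) (\<lambda>z. orb k (unary e\<^sub>1 k (\<gamma> (fst z)) (snd z)))"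
    by (simp add: o_def)
  then show "continuous_map ?P (Bsigma \<C> k) (\<lambda>(t, c). (\<lambda>(t, Q). unary_orbit k (\<gamma> t) Q) (t, orb k c))"
  proof (rule continuous_map_eq)
    fix z assume z: "z \<in> topspace ?P"
    then have "\<gamma> (fst z) \<in> op_pts \<G> {e\<^sub>1}" using funcset_mem[OF continuous_map_funspace[OF \<gamma>], of "fst z"] by auto
    then show "orb k (unary e\<^sub>1 k (\<gamma> (fst z)) (snd z)) =
        (case z of (t, c) \<Rightarrow> (\<lambda>(t, Q). unary_orbit k (\<gamma> t) Q) (t, orb k c))"
      using z by (auto simp: unary_orbit_orb)
  qed
qed

text \<open>A path in \<open>\<G>(1)\<close> from \<open>1\<close> to \<open>\<gamma>(g; 1, *)\<close> gives a homotopy from the identity of \<open>\<C>(k)/\<Sigma>\<^sub>k\<close>.\<close>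

lemma modp_boundary_unary_orbit:
  assumes c: "modp_cycle p n (Bsigma \<C> k) c"
  shows "modp_boundary p n (Bsigma \<C> k) (chain_map n (unary_orbit k h\<^sub>1) c - c)"
proof -
  obtain \<gamma> where \<gamma>: "continuous_map (top_of_set {0..1::real}) (op_space \<G> {e\<^sub>1}) \<gamma>"
    "\<gamma> 0 = unit_at \<G> e\<^sub>1" "\<gamma> 1 = h\<^sub>1"
    using operad_path[OF G contractible h\<^sub>1] by blast
  have "chain_map n (unary_orbit k (\<gamma> 0)) c = c"
  proof (rule chain_map_id_gen)
    show "singular_chain n (Bsigma \<C> k) c" using c by (rule modp_cycle_singular_chain)
    fix Q assume "Q \<in> topspace (Bsigma \<C> k)"
    then obtain d where "d \<in> op_pts \<C> (std k)" "Q = orb k d" by (rule topspace_BsigmaE)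
    then show "unary_orbit k (\<gamma> 0) Q = Q"
      by (simp add: \<gamma>(2) unary_orbit_orb unit_at_closed[OF G] unary_unit)
  qed
  then show ?thesis
    using modp_boundary_homotopic[OF continuous_map_unary_orbit[OF \<gamma>(1)] c] by (simp add: \<gamma>(3))
qed

lemma diagonal_action_times:
  assumes Q: "Q \<in> topspace (Bsigma \<C> k)" and a: "a \<in> topspace X" and b: "b \<in> topspace X"
  shows "diagonal_action \<theta> k (unary_orbit k h\<^sub>1 Q, times (a, b)) = times (diagonal_action \<theta> k (Q, a), b)"
proof -
  obtain c where c: "c \<in> op_pts \<C> (std k)" "Q = orb k c" using Q by (rule topspace_BsigmaE)
  show ?thesis
    unfolding c(2) unary_orbit_orb[OF h\<^sub>1 c(1)] diagonal_action_orb[OF c(1) a]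
      diagonal_action_orb[OF unary_closed[OF h\<^sub>1 c(1)] times_closed[OF a b]] times_diagonal[OF c(1) a b] ..
qed

section \<open>The identity in homology, first for one \<open>k\<close> and then for the sum\<close>

definition component_action :: "nat \<Rightarrow> nat \<Rightarrow> (nat \<Rightarrow> 'c set chain set) \<Rightarrow> (nat \<Rightarrow> 'x chain set) \<Rightarrow> (nat \<Rightarrow> 'x chain set)" where
  "component_action p k r x = modp_induced p (kprod (Bsigma \<C> k) X) X (diagonal_action \<theta> k) (modp_cross p (Bsigma \<C> k) X r x)"

lemma homology_action_eq_gfinprod: "homology_action p \<C> X \<theta> r x = gfinprod (modp_homology p X) (\<lambda>k. component_action p k (r k) x) UNIV"
  by (simp add: homology_action_def component_action_def)

lemma represents_component_action:
  assumes "represents p (Bsigma \<C> k) c r" "represents p X a x"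
  shows "represents p X (\<lambda>n. chain_map n (diagonal_action \<theta> k) (graded_cross c a n)) (component_action p k r x)"
  unfolding component_action_def
  by (intro represents_induced[OF represents_cross[OF assms] continuous_map_diagonal_action] singular_chain_kprod_Bsigma)

lemma represents_homology_product:
  assumes "represents p X a x" "represents p X b y"
  shows "represents p X (\<lambda>n. chain_map n times (graded_cross a b n)) (homology_product p X \<xi> g x y)"
  unfolding homology_product_def times_def[symmetric]
  by (intro represents_induced[OF represents_cross[OF assms] continuous_map_times] singular_chain_kprod_X)

text \<open>The homotopy allows the cycle \<open>c\<close> for \<open>r\<close> to be replaced by
  its image under \<open>unary_orbit\<close>. After that, \<open>diagonal_action_times\<close> is an
  equality of points, and associativity brings both sides to the same triple cross product
  \<open>?E\<close>.\<close>

lemma component_action_homology_product: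
  assumes r: "r \<in> carrier (modp_homology p (Bsigma \<C> k))"
    and x: "x \<in> carrier (modp_homology p X)" and y: "y \<in> carrier (modp_homology p X)"
  shows "component_action p k r (homology_product p X \<xi> g x y) = homology_product p X \<xi> g (component_action p k r x) y"
proof -
  let ?B = "Bsigma \<C> k" and ?D = "diagonal_action \<theta> k" and ?u = "unary_orbit k h\<^sub>1"
  obtain c a b where c: "represents p ?B c r" and a: "represents p X a x" and b: "represents p X b y"
    using r x y unfolding carrier_modp_homology_iff by blast
  have cyc: "modp_cycle p n ?B (c n)" and sing: "singular_chain n ?B (c n)" "singular_chain n X (a n)" "singular_chain n X (b n)" for n
    using a b c by (auto simp: represents_def intro: modp_cycle_singular_chain)
  have c': "represents p ?B (\<lambda>n. chain_map n ?u (c n)) r"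
  proof (rule represents_homologous[OF c modp_boundary_unary_orbit[OF cyc]])
    have "{n. chain_map n ?u (c n) \<noteq> 0} \<subseteq> {n. c n \<noteq> 0}" by auto
    then show "finite {n. chain_map n ?u (c n) \<noteq> 0}" using c finite_subset by (auto simp: represents_def)
  qed
  have "chain_map n ?D (graded_cross (\<lambda>n. chain_map n ?u (c n)) (\<lambda>n. chain_map n times (graded_cross a b n)) n) =
      chain_map n times (graded_cross (\<lambda>n. chain_map n ?D (graded_cross c a n)) b n)" for n
  proof -
    let ?E = "graded_cross (graded_cross c a) b n" and ?a = "\<lambda>((a, b), c). (a, b, c)"
    have E: "singular_chain n (prod_topology (prod_topology ?B X) X) ?E"
      by (intro singular_chain_graded_cross sing)
    have "chain_map n ?D (graded_cross (\<lambda>n. chain_map n ?u (c n)) (\<lambda>n. chain_map n times (graded_cross a b n)) n) =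
        chain_map n ?D (chain_map n (\<lambda>(Q, z). (?u Q, times z)) (chain_map n ?a ?E))"
      by (simp add: chain_map_graded_cross graded_cross_assoc[OF sing])
    also have "\<dots> = chain_map n (?D \<circ> ((\<lambda>(Q, z). (?u Q, times z)) \<circ> ?a)) ?E"
      by (simp only: chain_map_compose o_apply)
    \<comment> \<open>The last factor is written with \<open>id\<close> so that the right side is an
      instance of \<open>chain_map_graded_cross\<close>.\<close>
    also have "\<dots> = chain_map n (times \<circ> (\<lambda>(w, z). (?D w, id z))) ?E"
      by (rule chain_map_eq[OF E]) (auto simp: diagonal_action_times)
    also have "\<dots> = chain_map n times (graded_cross (\<lambda>n. chain_map n ?D (graded_cross c a n)) (\<lambda>n. chain_map n id (b n)) n)"
      by (simp only: chain_map_compose o_apply chain_map_graded_cross)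
    also have "(\<lambda>n. chain_map n id (b n)) = b" using chain_map_ident[OF sing(3)] by (intro ext)
    finally show ?thesis .
  qed
  then show ?thesis
    using represents_unique[OF represents_component_action[OF c' represents_homology_product[OF a b]]]
      represents_homology_product[OF represents_component_action[OF c a] b] by simp
qed

text \<open>This bounds the support of the family of summands by that of \<open>r\<close>; without
  finite support \<open>gfinprod\<close> would not be the intended sum.\<close>

lemma component_action_one:
  assumes x: "x \<in> carrier (modp_homology p X)"
  shows "component_action p k \<one>\<^bsub>modp_homology p (Bsigma \<C> k)\<^esub> x = \<one>\<^bsub>modp_homology p X\<^esub>"
proof -
  obtain a where a: "represents p X a x" using x unfolding carrier_modp_homology_iff by blast
  have "(\<lambda>n. chain_map n (diagonal_action \<theta> k) (graded_cross (\<lambda>n. 0) a n)) = (\<lambda>n. 0)"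
    by (simp add: graded_cross_def)
  with represents_component_action[OF represents_0[of p "Bsigma \<C> k"] a]
  show ?thesis using represents_unique represents_0 by metis
qed

lemma component_action_closed:
  assumes "r \<in> carrier (modp_homology p (Bsigma \<C> k))" "x \<in> carrier (modp_homology p X)"
  shows "component_action p k r x \<in> carrier (modp_homology p X)"
  using assms represents_component_action unfolding carrier_modp_homology_iff by blast

text \<open>Additivity is needed in the left variable, where the sum over \<open>k\<close> stands
  once \<open>r\<close> has acted on \<open>x\<close>.\<close>

lemma homology_product_hom:
  assumes y: "y \<in> carrier (modp_homology p X)"
  shows "(\<lambda>x. homology_product p X \<xi> g x y) \<in> hom (modp_homology p X) (modp_homology p X)"
proof (rule homI)
  obtain b where b: "represents p X b y" using y unfolding carrier_modp_homology_iff by blast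
  show "homology_product p X \<xi> g x y \<in> carrier (modp_homology p X)" if "x \<in> carrier (modp_homology p X)" for x
    using that b represents_homology_product unfolding carrier_modp_homology_iff by blast
  fix x x' assume "x \<in> carrier (modp_homology p X)" "x' \<in> carrier (modp_homology p X)"
  then obtain a a' where a: "represents p X a x" and a': "represents p X a' x'"
    unfolding carrier_modp_homology_iff by blast
  show "homology_product p X \<xi> g (x \<otimes>\<^bsub>modp_homology p X\<^esub> x') y =
      homology_product p X \<xi> g x y \<otimes>\<^bsub>modp_homology p X\<^esub> homology_product p X \<xi> g x' y"
    using represents_unique[OF represents_homology_product[OF represents_mult[OF a a'] b]]
      represents_mult[OF represents_homology_product[OF a b] represents_homology_product[OF a' b]]
    by (simp add: graded_cross_add_left chain_map_add)
qed

lemma homology_action_product: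
  assumes r: "r \<in> carrier (sigma_homology p \<C>)"
    and x: "x \<in> carrier (modp_homology p X)" and y: "y \<in> carrier (modp_homology p X)"
  shows "homology_action p \<C> X \<theta> r (homology_product p X \<xi> g x y) =
         homology_product p X \<xi> g (homology_action p \<C> X \<theta> r x) y"
proof -
  let ?M = "modp_homology p X" and ?h = "\<lambda>x. homology_product p X \<xi> g x y"
  have M: "comm_group ?M" by (rule comm_group_modp_homology)
  have rk: "r k \<in> carrier (modp_homology p (Bsigma \<C> k))" and fin: "finite {k. r k \<noteq> \<one>\<^bsub>modp_homology p (Bsigma \<C> k)\<^esub>}" for k
    using r unfolding sigma_homology_def
    by (subst (asm) carrier_sum_group; auto simp: comm_group.axioms(2) comm_group_modp_homology)+
  have "{k \<in> UNIV. component_action p k (r k) x \<noteq> \<one>\<^bsub>?M\<^esub>} \<subseteq> {k. r k \<noteq> \<one>\<^bsub>modp_homology p (Bsigma \<C> k)\<^esub>}"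
    using component_action_one[OF x] by (auto intro!: notI)
  then have fin': "finite {k \<in> UNIV. component_action p k (r k) x \<noteq> \<one>\<^bsub>?M\<^esub>}" using fin finite_subset by blast
  have "?h (homology_action p \<C> X \<theta> r x) = gfinprod ?M (\<lambda>k. ?h (component_action p k (r k) x)) UNIV"
    unfolding homology_action_eq_gfinprod
    by (rule gfinprod_hom[OF M M homology_product_hom[OF y] _ fin']) (use component_action_closed[OF rk x] in auto)
  also have "(\<lambda>k. ?h (component_action p k (r k) x)) = (\<lambda>k. component_action p k (r k) (?h x))"
    by (rule ext) (simp add: component_action_homology_product[OF rk x y])
  finally show ?thesis by (simp add: homology_action_eq_gfinprod)
qed

end

theorem corollary83:
  fixes p :: nat
    and \<C> :: "'c operad" and \<G> :: "'g operad"
    and lam :: "ix set \<Rightarrow> (ix \<Rightarrow> ix set) \<Rightarrow> 'g \<Rightarrow> (ix \<Rightarrow> 'c) \<Rightarrow> 'c"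
    and X :: "'x topology"
    and \<theta> :: "ix set \<Rightarrow> 'c \<Rightarrow> (ix \<Rightarrow> 'x) \<Rightarrow> 'x"
    and \<xi> :: "ix set \<Rightarrow> 'g \<Rightarrow> (ix \<Rightarrow> 'x) \<Rightarrow> 'x"
  assumes "Factorial_Ring.prime p"
    and "einf_operad_pair TYPE('v) TYPE('w) \<C> \<G> lam"
    and "einf_ring_space \<C> \<G> lam X \<theta> \<xi>"
    and "g\<^sub>2 \<in> op_pts \<G> (std 2)"
    and "r \<in> carrier (sigma_homology p \<C>)"
    and "x \<in> carrier (modp_homology p X)"
    and "y \<in> carrier (modp_homology p X)"
  shows "homology_action p \<C> X \<theta> r (homology_product p X \<xi> g\<^sub>2 x y) =
         homology_product p X \<xi> g\<^sub>2 (homology_action p \<C> X \<theta> r x) y"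
proof -
  have "einf_operad TYPE('v) \<C>" "einf_operad TYPE('w) \<G>" and action: "operad_action \<G> \<C> lam"
    using assms(2) by (auto simp: einf_operad_pair_def)
  then have "operad \<C>" "operad \<G>" "contractible_space (op_space \<G> (std 1))"
    by (auto simp: einf_operad_def)
  then interpret ring_space_action \<C> \<G> lam X \<theta> \<xi> g\<^sub>2
    using action assms(3,4) by unfold_locales
  show ?thesis using assms(5-7) by (rule homology_action_product)
qed

end
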